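(* For every $k\ge2$, let $L(k)=\mathcal{L}(U(A_{2^k}))$ be the rational nilpotent Lie algebra corresponding, under the Malcev correspondence, to the group $U(A_{2^k})$ over $\mathbb{Q}$. Then $L(k)$ is a filiform nilpotent Lie algebra over $\mathbb{Q}$ of dimension $2^k-1$ and derived length $k$. Moreover, for every $k\ge 2$ there exists a solvable Lie algebra over $\mathbb{Q}$ of dimension $2^k$ and derived length $k+1$.
   Context: For $c\ge 2$, $A_c$ is the algebra of polynomials in $t$ over $\mathbb{Q}$ with zero constant term, modulo the ideal generated by $t^{c+1}$. $U(A_c)$ is the group, under composition, of all mappings $A_c\to A_c$ of the form $x\mapsto x+a_2x^2+\dots+a_cx^c$ with $a_i\in\mathbb{Q}$. This is a torsion free divisible nilpotent group. Malcev correspondence: for a nilpotent Lie algebra $L$ over $\mathbb{Q}$, the Baker–Campbell–Hausdorff operation $x\circ y=\log(\exp x\exp y)=x+y+\frac12(x,y)+\cdots$, where $(\cdot,\cdot)$ is the Lie bracket, makes the set $L$ a torsion free divisible nilpotent group. For a torsion free divisible nilpotent group $D$, $\mathcal{L}(D)$ is the unique rational nilpotent Lie algebra on the same underlying set whose Baker–Campbell–Hausdorff group is $D$, with scalar multiplication $qa=a^q$ ($q\in\mathbb{Q}$). A nilpotent Lie algebra of finite dimension $d\ge 2$ is filiform if its nilpotency class is exactly $d-1$. The derived length (solvability length) of a solvable Lie algebra is the length of its derived series. *)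

theory Defs
  imports
    "Jordan_Normal_Form.VS_Connect"
    "HOL-Computational_Algebra.Polynomial"
begin

section \<open>Lie algebras\<close>

text \<open>As in \<^locale>\<open>module\<close>, the fields \<^const>\<open>mult\<close> and \<^const>\<open>one\<close> inherited from rings are ignored.\<close>

record ('a, 'b) lie_alg = "('a, 'b) module" +
  bracket :: "'b \<Rightarrow> 'b \<Rightarrow> 'b"

locale lie_algebra = vectorspace K L
  for K :: "('a, 'k) ring_scheme" and L :: "('a, 'b, 'l) lie_alg_scheme" +
  assumes bracket_closed:
      "\<lbrakk>x \<in> carrier L; y \<in> carrier L\<rbrakk> \<Longrightarrow> bracket L x y \<in> carrier L"
    and bracket_add_left:
      "\<lbrakk>x \<in> carrier L; y \<in> carrier L; z \<in> carrier L\<rbrakk> \<Longrightarrow>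
        bracket L (x \<oplus>\<^bsub>L\<^esub> y) z = bracket L x z \<oplus>\<^bsub>L\<^esub> bracket L y z"
    and bracket_add_right:
      "\<lbrakk>x \<in> carrier L; y \<in> carrier L; z \<in> carrier L\<rbrakk> \<Longrightarrow>
        bracket L x (y \<oplus>\<^bsub>L\<^esub> z) = bracket L x y \<oplus>\<^bsub>L\<^esub> bracket L x z"
    and bracket_smult_left:
      "\<lbrakk>a \<in> carrier K; x \<in> carrier L; y \<in> carrier L\<rbrakk> \<Longrightarrow>
        bracket L (a \<odot>\<^bsub>L\<^esub> x) y = a \<odot>\<^bsub>L\<^esub> bracket L x y"
    and bracket_smult_right:
      "\<lbrakk>a \<in> carrier K; x \<in> carrier L; y \<in> carrier L\<rbrakk> \<Longrightarrow>
        bracket L x (a \<odot>\<^bsub>L\<^esub> y) = a \<odot>\<^bsub>L\<^esub> bracket L x y"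
    and bracket_self:
      "x \<in> carrier L \<Longrightarrow> bracket L x x = \<zero>\<^bsub>L\<^esub>"
    and jacobi:
      "\<lbrakk>x \<in> carrier L; y \<in> carrier L; z \<in> carrier L\<rbrakk> \<Longrightarrow>
        bracket L x (bracket L y z) \<oplus>\<^bsub>L\<^esub> bracket L y (bracket L z x)
          \<oplus>\<^bsub>L\<^esub> bracket L z (bracket L x y) = \<zero>\<^bsub>L\<^esub>"
begin

definition bracket_span :: "'b set \<Rightarrow> 'b set \<Rightarrow> 'b set" where
  "bracket_span A B = span {bracket L x y | x y. x \<in> A \<and> y \<in> B}"

text \<open>Both series are indexed from 0: \<open>lower_central_series n\<close> is the term
  usually written \<open>\<gamma>\<^sub>n\<^sub>+\<^sub>1(L)\<close>.\<close>

primrec lower_central_series :: "nat \<Rightarrow> 'b set" where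
  "lower_central_series 0 = carrier L"
| "lower_central_series (Suc n) = bracket_span (lower_central_series n) (carrier L)"

primrec derived_series :: "nat \<Rightarrow> 'b set" where
  "derived_series 0 = carrier L"
| "derived_series (Suc n) = bracket_span (derived_series n) (derived_series n)"

definition nilpotent :: bool where
  "nilpotent \<longleftrightarrow> (\<exists>n. lower_central_series n = {\<zero>\<^bsub>L\<^esub>})"

definition nilpotency_class :: nat where
  "nilpotency_class = (LEAST n. lower_central_series n = {\<zero>\<^bsub>L\<^esub>})"

definition solvable :: bool where
  "solvable \<longleftrightarrow> (\<exists>n. derived_series n = {\<zero>\<^bsub>L\<^esub>})"

definition derived_length :: nat where
  "derived_length = (LEAST n. derived_series n = {\<zero>\<^bsub>L\<^esub>})"

definition filiform :: bool where
  "filiform \<longleftrightarrow> nilpotent \<and> fin_dim \<and> dim \<ge> 2 \<and> nilpotency_class = dim - 1"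

end


section \<open>The Baker--Campbell--Hausdorff operation\<close>

text \<open>Formal power series over \<open>\<rat>\<close> in two noncommuting variables, given by their coefficients on
  words; the letters \<^const>\<open>False\<close> and \<^const>\<open>True\<close> stand for the first and the second variable.\<close>

type_synonym nc_series = "bool list \<Rightarrow> rat"

definition nc_var :: "bool \<Rightarrow> nc_series" where
  "nc_var v w = of_bool (w = [v])"

definition nc_one :: nc_series where
  "nc_one w = of_bool (w = [])"

definition nc_mult :: "nc_series \<Rightarrow> nc_series \<Rightarrow> nc_series" where
  "nc_mult f g w = (\<Sum>i\<le>length w. f (take i w) * g (drop i w))"

primrec nc_pow :: "nc_series \<Rightarrow> nat \<Rightarrow> nc_series" where
  "nc_pow f 0 = nc_one"
| "nc_pow f (Suc n) = nc_mult f (nc_pow f n)"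

text \<open>For \<open>f\<close> without constant term, \<open>f\<^sup>n\<close> has no terms on words shorter than \<open>n\<close>. Hence the
  truncated sums below are the full series \<open>exp f\<close> (for \<open>f\<close> with constant term 0) and \<open>log f\<close>
  (for \<open>f\<close> with constant term 1).\<close>

definition nc_exp :: "nc_series \<Rightarrow> nc_series" where
  "nc_exp f w = (\<Sum>n\<le>length w. nc_pow f n w / fact n)"

definition nc_log :: "nc_series \<Rightarrow> nc_series" where
  "nc_log f w = (\<Sum>n=1..length w. (-1) ^ (n + 1) / of_nat n * nc_pow (\<lambda>u. f u - nc_one u) n w)"

definition bch_series :: nc_series where
  "bch_series = nc_log (nc_mult (nc_exp (nc_var False)) (nc_exp (nc_var True)))"

locale rational_lie_algebra = lie_algebra "class_ring :: rat ring" L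
  for L :: "(rat, 'b, 'l) lie_alg_scheme"
begin

fun word_bracket :: "'b \<Rightarrow> 'b \<Rightarrow> bool list \<Rightarrow> 'b" where
  "word_bracket x y [] = \<zero>\<^bsub>L\<^esub>"
| "word_bracket x y [v] = (if v then y else x)"
| "word_bracket x y (v # v' # w) = bracket L (if v then y else x) (word_bracket x y (v' # w))"

text \<open>The value of the Lie series \<open>log (exp x exp y)\<close> in a nilpotent Lie algebra. The homogeneous
  component of degree \<open>n\<close> of \<^const>\<open>bch_series\<close> is a Lie polynomial, so by the
  Dynkin--Specht--Wever theorem it is obtained by replacing each word by \<open>1/n\<close> times its iterated
  bracket (Dynkin's form of the series). Brackets of more than \<^const>\<open>nilpotency_class\<close> elements
  vanish, so the sum over the remaining finitely many words is the whole series.\<close>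

definition bch :: "'b \<Rightarrow> 'b \<Rightarrow> 'b" where
  "bch x y = (\<Oplus>\<^bsub>L\<^esub>w\<in>{w. w \<noteq> [] \<and> length w \<le> nilpotency_class}.
     (bch_series w / of_nat (length w)) \<odot>\<^bsub>L\<^esub> word_bracket x y w)"

end


section \<open>The Malcev correspondence\<close>

text \<open>\<open>is_malcev_lie_algebra D L\<close>: \<open>L\<close> is a rational nilpotent Lie algebra on the underlying set of
  the group \<open>D\<close> whose BCH group is \<open>D\<close>, with \<open>q a = a\<^sup>q\<close>. For \<open>q = m / n\<close> the element
  \<open>a\<^sup>q\<close> is the \<open>n\<close>-th root of \<open>a\<^sup>m\<close> in \<open>D\<close>. Such an \<open>L\<close> exists only if \<open>D\<close> is torsion free,
  divisible and nilpotent, and its operations are then determined by \<open>D\<close> on \<^term>\<open>carrier D\<close>.\<close>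

definition is_malcev_lie_algebra :: "('g, 'm) monoid_scheme \<Rightarrow> (rat, 'g) lie_alg \<Rightarrow> bool" where
  "is_malcev_lie_algebra D L \<longleftrightarrow>
     group D \<and> rational_lie_algebra L \<and> lie_algebra.nilpotent class_ring L \<and>
     carrier L = carrier D \<and> \<zero>\<^bsub>L\<^esub> = \<one>\<^bsub>D\<^esub> \<and>
     (\<forall>x\<in>carrier D. \<forall>y\<in>carrier D. rational_lie_algebra.bch L x y = x \<otimes>\<^bsub>D\<^esub> y) \<and>
     (\<forall>a\<in>carrier D. \<forall>(m::int) (n::nat). n > 0 \<longrightarrow>
        ((of_int m / of_nat n) \<odot>\<^bsub>L\<^esub> a) [^]\<^bsub>D\<^esub> n = a [^]\<^bsub>D\<^esub> m)"


section \<open>The groups of truncated polynomial substitutions\<close>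

text \<open>Inside the polynomials without constant term, the ideal generated by \<open>t ^ (c + 1)\<close> is
  \<open>t ^ (c + 1) \<rat>[t]\<close>: an ideal of a \<open>\<rat>\<close>-algebra contains the scalar multiples of its generator.\<close>

definition trunc_rel :: "nat \<Rightarrow> (rat poly \<times> rat poly) set" where
  "trunc_rel c = {(p, q). coeff p 0 = 0 \<and> coeff q 0 = 0 \<and> monom 1 (c + 1) dvd p - q}"

definition trunc_algebra :: "nat \<Rightarrow> rat poly set set" where
  "trunc_algebra c = {p. coeff p 0 = 0} // trunc_rel c"

text \<open>The map \<open>x \<mapsto> x + a\<^sub>2 x\<^sup>2 + \<dots> + a\<^sub>c x\<^sup>c\<close> on residue classes.\<close>

definition U_map :: "nat \<Rightarrow> (nat \<Rightarrow> rat) \<Rightarrow> rat poly set \<Rightarrow> rat poly set" where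
  "U_map c a = (\<lambda>X\<in>trunc_algebra c.
     \<Union>p\<in>X. trunc_rel c `` {p + (\<Sum>i=2..c. Polynomial.smult (a i) (p ^ i))})"

definition U_group :: "nat \<Rightarrow> (rat poly set \<Rightarrow> rat poly set) monoid" where
  "U_group c =
     \<lparr>carrier = range (U_map c),
      mult = compose (trunc_algebra c),
      one = (\<lambda>X\<in>trunc_algebra c. X)\<rparr>"

end

theory Submission
  imports Defs "HOL-Number_Theory.Cong"
begin

text \<open>The series \<open>exp x exp y\<close> is group-like for the shuffle product. The powers of a group-like series
  are polynomials in the exponent whose linear coefficient is the logarithm, so \<open>log (exp x exp y)\<close>
  is primitive, and \<open>exp log F = F\<close>. By the Dynkin--Specht--Wever theorem it can be evaluated at
  nilpotent derivations through brackets. The vector fields \<open>t\<^sup>i\<^sup>+\<^sup>1 d/dt\<close>, \<open>1 \<le> i < c\<close>, act nilpotently on polynomials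
  modulo \<open>t\<^sup>c\<^sup>+\<^sup>1\<close>; the exponential of a derivation is a substitution, and comparing coefficients every
  substitution arises once. Hence \<open>U(A\<^sub>c)\<close> is the Baker--Campbell--Hausdorff group of the Lie algebra
  with basis \<open>e\<^sub>1, \<dots>, e\<^sub>c\<^sub>-\<^sub>1\<close> and \<open>[e\<^sub>i, e\<^sub>j] = (i - j) e\<^sub>i\<^sub>+\<^sub>j\<close>. Its lower central series drops by one dimension
  per step after the first, and its \<open>n\<close>-th derived algebra is spanned by the \<open>e\<^sub>i\<close> with \<open>i \<ge> 2\<^sup>n\<^sup>+\<^sup>1 - 1\<close>.
  Adjoining \<open>e\<^sub>0\<close> adds one dimension and one step to the derived series.

  The Malcev Lie algebra of a group is unique: the group and the scalar multiplication determine the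
  polynomial curves, and \<open>x + y\<close> and \<open>[x, y]/2\<close> are coefficients of \<open>t\<^sup>-\<^sup>1 (t x \<circ> t y)\<close>.\<close>

section \<open>Series in two noncommuting variables\<close>

text \<open>\<open>bch\<close> is given by Dynkin's formula inside the Lie algebra, where no
  associative product is available, whereas the group law is recognised on operators, where
  exponentials multiply. Primitivity of the series makes the two evaluations agree; this is why
  shuffles enter. The logarithm is reached through the powers F^n because these are group-like by an
  immediate induction, and an identity valid for all natural n is one between polynomials in n.
  Derivations reverse the bracket, so the operators of -f, which respect it, are used, and the
  resulting identity is inverted at the end. The claim concerns every Lie algebra attached to the
  group, not just a constructed model; hence the uniqueness argument. The size c = 2^k is extremal:
  a derivation step sends the lowest index x to 2x + 1, so it doubles x + 1. Starting from x = 1,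
  the index 2^k - 1 = c - 1 is reached after k - 1 steps, starting from x = 0 after k steps; a
  single basis vector is then left, and one more step kills it.\<close>

lemma nc_mult_Nil [simp]: "nc_mult f g [] = f [] * g []"
  by (simp add: nc_mult_def)

text \<open>Dropping a leading letter obeys a Leibniz rule with the constant term
  \<open>f []\<close>; with it, convolution identities follow by induction on the word.\<close>

lemma nc_mult_Cons:
  "nc_mult f g (a # w) = f [] * g (a # w) + nc_mult (\<lambda>u. f (a # u)) g w"
  unfolding nc_mult_def length_Cons by (subst sum.atMost_Suc_shift) simp

lemma nc_mult_add_left: "nc_mult (\<lambda>u. f u + g u) h w = nc_mult f h w + nc_mult g h w"
  by (simp add: nc_mult_def algebra_simps sum.distrib)

lemma nc_mult_diff_left: "nc_mult (\<lambda>u. f u - g u) h w = nc_mult f h w - nc_mult g h w"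
  by (simp add: nc_mult_def algebra_simps sum_subtractf)

lemma nc_mult_scale_left: "nc_mult (\<lambda>u. c * f u) h w = c * nc_mult f h w"
  by (simp add: nc_mult_def algebra_simps sum_distrib_left)

lemma nc_mult_sum_right:
  "nc_mult f (\<lambda>u. \<Sum>i\<in>A. g i u) w = (\<Sum>i\<in>A. nc_mult f (g i) w)"
  unfolding nc_mult_def sum_distrib_left by (rule sum.swap)

lemma nc_mult_assoc: "nc_mult (nc_mult f g) h = nc_mult f (nc_mult g h)"
proof
  show "nc_mult (nc_mult f g) h w = nc_mult f (nc_mult g h) w" for w
  proof (induction w arbitrary: f)
    case (Cons a w)
    have "(\<lambda>u. nc_mult f g (a # u)) = (\<lambda>u. f [] * g (a # u) + nc_mult (\<lambda>v. f (a # v)) g u)"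
      by (simp add: nc_mult_Cons)
    then show ?case
      using Cons.IH[of "\<lambda>v. f (a # v)"]
      by (simp add: nc_mult_Cons nc_mult_add_left nc_mult_scale_left algebra_simps)
  qed simp
qed

lemma nc_mult_one_left [simp]: "nc_mult nc_one f = f"
proof
  show "nc_mult nc_one f w = f w" for w
  proof (cases w)
    case (Cons a v)
    have "nc_mult (\<lambda>u. nc_one (a # u)) f v = 0"
      by (simp add: nc_mult_def nc_one_def)
    then show ?thesis
      by (simp add: Cons nc_mult_Cons nc_one_def)
  qed (simp add: nc_one_def)
qed

lemma nc_pow_add: "nc_pow f (m + n) = nc_mult (nc_pow f m) (nc_pow f n)"
  by (induction m) (simp_all add: nc_mult_assoc)

lemma nc_pow_eq_0:
  assumes "f [] = 0" "length w < n"
  shows "nc_pow f n w = 0"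
  using assms(2)
proof (induction n arbitrary: w)
  case (Suc n)
  have "f (take i w) * nc_pow f n (drop i w) = 0" if "i \<le> length w" for i
  proof (cases i)
    case 0
    then show ?thesis using assms(1) by simp
  next
    case (Suc j)
    then have "length (drop i w) < n" using Suc.prems that by simp
    then show ?thesis using Suc.IH by simp
  qed
  then show ?case by (simp add: nc_mult_def del: mult_eq_0_iff)
qed simp

text \<open>The binomial expansion of \<open>(1 + g)\<^sup>n\<close> is a polynomial in \<open>n\<close> on every word; its linear
  coefficient is the logarithm. Identities between the powers \<open>F\<^sup>n\<close>, \<open>n\<close> a natural number,
  therefore pass to \<open>log F\<close> by comparing coefficients.\<close>

fun binomial_poly :: "nat \<Rightarrow> rat poly" where
  "binomial_poly 0 = 1"
| "binomial_poly (Suc n) = Polynomial.smult (1 / of_nat (Suc n)) ([:- of_nat n, 1:] * binomial_poly n)"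

lemma poly_binomial_poly: "poly (binomial_poly j) (of_nat n) = of_nat (n choose j)"
proof (induction j)
  case (Suc j)
  have "of_nat (Suc j) * of_nat (n choose Suc j) = (of_nat n - of_nat j) * (of_nat (n choose j) :: rat)"
  proof (cases "j \<le> n")
    case True
    have "Suc j * (n choose Suc j) = (n - j) * (n choose j)"
      by (metis binomial_absorb_comp binomial_absorption)
    then have "of_nat (Suc j * (n choose Suc j)) = (of_nat ((n - j) * (n choose j)) :: rat)"
      by simp
    then show ?thesis using True by (simp add: of_nat_diff algebra_simps)
  qed (cases "j = n"; simp add: not_le binomial_eq_0)
  then show ?case
    by (simp add: Suc field_simps)
qed simp

lemma coeff_0_binomial_poly: "coeff (binomial_poly j) 0 = of_bool (j = 0)"
  using poly_binomial_poly[of j 0] by (cases j) (simp_all add: poly_0_coeff_0)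

text \<open>To first order in x the power (1 + z)^x is 1 + x log (1 + z), so these numbers are the
  coefficients of log (1 + z).\<close>

lemma coeff_1_binomial_poly:
  "coeff (binomial_poly j) 1 = (if j = 0 then 0 else (-1) ^ (j + 1) / of_nat j)"
proof (induction j)
  case (Suc j)
  show ?case
  proof (cases "j = 0")
    case False
    then show ?thesis
      using Suc by (simp add: coeff_0_binomial_poly coeff_pCons field_simps)
  qed (simp add: coeff_pCons)
qed simp

lemma degree_binomial_poly: "degree (binomial_poly j) \<le> j"
proof (induction j)
  case (Suc j)
  have "degree ([:- of_nat j, 1:] * binomial_poly j) \<le> 1 + j"
    using degree_mult_le[of "[:- of_nat j, 1:]" "binomial_poly j"] Suc by simp
  moreover have "degree (binomial_poly (Suc j)) \<le> degree ([:- of_nat j, 1:] * binomial_poly j)"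
    unfolding binomial_poly.simps by (rule degree_smult_le)
  ultimately show ?case by linarith
qed simp

text \<open>The coefficient of w in F^x for an indeterminate exponent x. If \<open>F [] = 1\<close>,
  the powers of F - 1 beyond \<open>length w\<close> vanish on w, so the cut-off loses
  nothing.\<close>

definition nc_power_poly :: "nc_series \<Rightarrow> bool list \<Rightarrow> rat poly" where
  "nc_power_poly F w =
     (\<Sum>j\<le>length w. Polynomial.smult (nc_pow (\<lambda>u. F u - nc_one u) j w) (binomial_poly j))"

lemma nc_pow_binomial:
  "nc_pow F n w = (\<Sum>j\<le>n. of_nat (n choose j) * nc_pow (\<lambda>u. F u - nc_one u) j w)"
proof (induction n arbitrary: w)
  case (Suc n)
  define G where "G = (\<lambda>u. F u - nc_one u)"
  let ?G = "\<lambda>j. nc_pow G j w"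
  have IH: "nc_pow F n = (\<lambda>u. \<Sum>j\<le>n. of_nat (n choose j) * nc_pow G j u)"
    using Suc.IH by (auto simp: G_def)
  have "nc_pow F (Suc n) w = nc_pow F n w + nc_mult G (nc_pow F n) w"
    using nc_mult_diff_left[of F nc_one "nc_pow F n" w] by (simp add: G_def)
  also have "nc_mult G (nc_pow F n) w = (\<Sum>j\<le>n. of_nat (n choose j) * ?G (Suc j))"
    unfolding IH nc_mult_sum_right
    by (intro sum.cong refl) (simp add: nc_mult_def algebra_simps sum_distrib_left)
  also have "nc_pow F n w = (\<Sum>j\<le>Suc n. of_nat (n choose j) * ?G j)"
    unfolding IH by simp
  also have "\<dots> = ?G 0 + (\<Sum>j\<le>n. of_nat (n choose Suc j) * ?G (Suc j))"
    by (subst sum.atMost_Suc_shift) simp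
  also have "\<dots> + (\<Sum>j\<le>n. of_nat (n choose j) * ?G (Suc j))
      = ?G 0 + (\<Sum>j\<le>n. of_nat (Suc n choose Suc j) * ?G (Suc j))"
    by (simp add: sum.distrib algebra_simps)
  also have "\<dots> = (\<Sum>j\<le>Suc n. of_nat (Suc n choose j) * ?G j)"
    by (subst sum.atMost_Suc_shift) simp
  finally show ?case by (simp only: G_def)
qed simp

lemma pderiv_sum: "pderiv (sum f A) = (\<Sum>x\<in>A. pderiv (f x))"
  by (induction A rule: infinite_finite_induct) (simp_all add: pderiv_add)

text \<open>Infinitely many common values force equality. This carries identities between natural
  powers to identities in an indeterminate exponent.\<close>

lemma poly_eqI_of_nat:
  fixes p q :: "rat poly"
  assumes "\<And>n. poly p (of_nat n) = poly q (of_nat n)"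
  shows "p = q"
proof (rule ccontr)
  assume "p \<noteq> q"
  then have "finite {x. poly (p - q) x = 0}" by (intro poly_roots_finite) simp
  moreover have "range of_nat \<subseteq> {x. poly (p - q) x = 0}" using assms by auto
  ultimately have "finite (range (of_nat :: nat \<Rightarrow> rat))" by (rule finite_subset[rotated])
  then show False by (simp add: finite_image_iff inj_on_def)
qed

context
  fixes F :: nc_series
  assumes F_Nil: "F [] = 1"
begin

lemma poly_nc_power_poly: "poly (nc_power_poly F w) (of_nat n) = nc_pow F n w"
proof -
  let ?G = "\<lambda>j. nc_pow (\<lambda>u. F u - nc_one u) j w"
  have "poly (nc_power_poly F w) (of_nat n) = (\<Sum>j\<le>length w. of_nat (n choose j) * ?G j)"
    by (simp add: nc_power_poly_def poly_sum poly_binomial_poly mult.commute)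
  \<comment> \<open>Both cut-offs are compared with \<open>length w + n\<close>: terms beyond
    \<open>length w\<close> vanish by \<open>nc_pow_eq_0\<close>, terms beyond n through the
    binomial coefficient.\<close>
  also have "\<dots> = (\<Sum>j\<le>length w + n. of_nat (n choose j) * ?G j)"
    using F_Nil by (intro sum.mono_neutral_left) (auto intro!: nc_pow_eq_0 simp: nc_one_def)
  also have "\<dots> = (\<Sum>j\<le>n. of_nat (n choose j) * ?G j)"
    by (intro sum.mono_neutral_right) auto
  finally show ?thesis unfolding nc_pow_binomial[of F] .
qed

lemma coeff_1_nc_power_poly: "coeff (nc_power_poly F w) 1 = nc_log F w"
proof -
  have "nc_log F w = (\<Sum>j\<le>length w. nc_pow (\<lambda>u. F u - nc_one u) j w * coeff (binomial_poly j) 1)"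
    unfolding nc_log_def by (intro sum.mono_neutral_cong_left) (auto simp: coeff_1_binomial_poly[unfolded One_nat_def])
  then show ?thesis by (simp add: nc_power_poly_def coeff_sum)
qed

lemma coeff_0_nc_power_poly: "coeff (nc_power_poly F w) 0 = nc_one w"
  using poly_nc_power_poly[of w 0] by (simp add: poly_0_coeff_0)

lemma degree_nc_power_poly: "degree (nc_power_poly F w) \<le> length w"
  unfolding nc_power_poly_def
proof (rule degree_sum_le)
  fix j assume "j \<in> {..length w}"
  then show "degree (Polynomial.smult (nc_pow (\<lambda>u. F u - nc_one u) j w) (binomial_poly j)) \<le> length w"
    using degree_smult_le[of "nc_pow (\<lambda>u. F u - nc_one u) j w" "binomial_poly j"] degree_binomial_poly[of j]
    by (meson atMost_iff le_trans)
qed simp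

text \<open>The differential equation of F^x: F^(m + n) = F^m F^n is extended to an indeterminate m
  and differentiated at m = 0, where F^m contributes its linear coefficient log F.\<close>

lemma pderiv_nc_power_poly:
  "pderiv (nc_power_poly F w)
     = (\<Sum>i\<le>length w. Polynomial.smult (nc_log F (take i w)) (nc_power_poly F (drop i w)))"
proof (rule poly_eqI_of_nat)
  fix n
  let ?P = "nc_power_poly F"
  note poly_P = poly_nc_power_poly
  have "pcompose (?P w) [:of_nat n, 1:]
    = (\<Sum>i\<le>length w. Polynomial.smult (nc_pow F n (drop i w)) (?P (take i w)))"
  proof (rule poly_eqI_of_nat)
    fix m
    have "poly (?P w) (of_nat n + of_nat m) = nc_pow F (m + n) w"
      by (subst poly_P[symmetric]) (simp add: add.commute)
    also have "\<dots> = (\<Sum>i\<le>length w. nc_pow F n (drop i w) * nc_pow F m (take i w))"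
      by (simp add: nc_pow_add nc_mult_def mult.commute)
    finally show "poly (pcompose (?P w) [:of_nat n, 1:]) (of_nat m)
      = poly (\<Sum>i\<le>length w. Polynomial.smult (nc_pow F n (drop i w)) (?P (take i w))) (of_nat m)"
      by (simp add: poly_pcompose poly_sum poly_P)
  qed
  then have *: "pderiv (pcompose (?P w) [:of_nat n, 1:])
    = (\<Sum>i\<le>length w. Polynomial.smult (nc_pow F n (drop i w)) (pderiv (?P (take i w))))"
    by (simp add: pderiv_sum pderiv_smult)
  have coeff_1: "poly (pderiv p) 0 = coeff p 1" for p :: "rat poly"
    by (simp add: poly_0_coeff_0 coeff_pderiv)
  have "poly (pderiv (?P w)) (of_nat n) = poly (pderiv (pcompose (?P w) [:of_nat n, 1:])) 0"
    by (simp add: pderiv_pcompose poly_pcompose pderiv_pCons)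
  also have "\<dots> = (\<Sum>i\<le>length w. nc_pow F n (drop i w) * nc_log F (take i w))"
    unfolding * poly_sum poly_smult coeff_1 coeff_1_nc_power_poly ..
  also have "\<dots> = poly (\<Sum>i\<le>length w. Polynomial.smult (nc_log F (take i w)) (?P (drop i w))) (of_nat n)"
    unfolding poly_sum poly_smult poly_P by (intro sum.cong refl mult.commute)
  finally show "poly (pderiv (?P w)) (of_nat n)
    = poly (\<Sum>i\<le>length w. Polynomial.smult (nc_log F (take i w)) (?P (drop i w))) (of_nat n)" .
qed

text \<open>Comparison of coefficients in the differential equation, with F^0 = 1, gives F^x = exp
  (x log F).\<close>

lemma coeff_nc_power_poly: "coeff (nc_power_poly F w) n = nc_pow (nc_log F) n w / fact n"
proof (induction n arbitrary: w)
  case 0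
  then show ?case by (simp add: coeff_0_nc_power_poly)
next
  case (Suc n)
  have "of_nat (Suc n) * coeff (nc_power_poly F w) (Suc n) = coeff (pderiv (nc_power_poly F w)) n"
    by (simp add: coeff_pderiv)
  also have "\<dots> = (\<Sum>i\<le>length w. nc_log F (take i w) * (nc_pow (nc_log F) n (drop i w) / fact n))"
    by (simp add: pderiv_nc_power_poly coeff_sum Suc)
  also have "\<dots> = nc_pow (nc_log F) (Suc n) w / fact n"
    by (simp only: nc_pow.simps nc_mult_def sum_divide_distrib times_divide_eq_right)
  finally have *: "of_nat (Suc n) * coeff (nc_power_poly F w) (Suc n) = nc_pow (nc_log F) (Suc n) w / fact n" .
  have "coeff (nc_power_poly F w) (Suc n) = nc_pow (nc_log F) (Suc n) w / fact n / of_nat (Suc n)"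
    unfolding *[symmetric] by (rule nonzero_mult_div_cancel_left[symmetric]) simp
  then show ?case by (simp only: fact_Suc divide_divide_eq_left mult.commute[of "of_nat (Suc n)"])
qed

text \<open>The case x = 1 of F^x = exp (x log F); the degree bound lets the sum of all coefficients
  stop at \<open>length w\<close>.\<close>

lemma nc_exp_log: "nc_exp (nc_log F) = F"
proof
  fix w
  have "F w = poly (nc_power_poly F w) 1"
    using poly_nc_power_poly[of w 1] by (simp add: nc_mult_def nc_one_def sum.atMost_Suc)
  also have "\<dots> = (\<Sum>n\<le>length w. coeff (nc_power_poly F w) n)"
    using degree_nc_power_poly[of w]
    by (simp add: poly_altdef) (intro sum.mono_neutral_left; auto simp: coeff_eq_0)
  finally show "nc_exp (nc_log F) w = F w"
    by (simp add: nc_exp_def coeff_nc_power_poly)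
qed

end

section \<open>Shuffles\<close>

text \<open>\<open>shuffle_sum f u v\<close> is the sum of \<open>f\<close> over the shuffles of \<open>u\<close> and \<open>v\<close>, with multiplicity.\<close>

function shuffle_sum :: "nc_series \<Rightarrow> bool list \<Rightarrow> bool list \<Rightarrow> rat" where
  "shuffle_sum f [] v = f v"
| "shuffle_sum f (a # u) [] = f (a # u)"
| "shuffle_sum f (a # u) (b # v) =
     shuffle_sum (\<lambda>w. f (a # w)) u (b # v) + shuffle_sum (\<lambda>w. f (b # w)) (a # u) v"
  by pat_completeness auto
termination by (relation "measure (\<lambda>(f, u, v). length u + length v)") auto

lemma shuffle_sum_Nil_right [simp]: "shuffle_sum f u [] = f u"
  by (cases u) simp_all

lemma shuffle_sum_add:
  "shuffle_sum (\<lambda>w. f w + g w) u v = shuffle_sum f u v + shuffle_sum g u v"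
proof (induction f u v arbitrary: g rule: shuffle_sum.induct)
  case (3 f a u b v)
  show ?case by (simp only: shuffle_sum.simps 3 add_ac)
qed simp_all

lemma shuffle_sum_scale: "shuffle_sum (\<lambda>w. c * f w) u v = c * shuffle_sum f u v"
proof (induction f u v rule: shuffle_sum.induct)
  case (3 f a u b v)
  show ?case by (simp only: shuffle_sum.simps 3) (simp add: algebra_simps)
qed simp_all

lemma shuffle_sum_zero: "shuffle_sum (\<lambda>w. 0) u v = 0"
  using shuffle_sum_scale[of 0 "\<lambda>w. 0"] by simp

lemma shuffle_sum_sum:
  "finite A \<Longrightarrow> shuffle_sum (\<lambda>w. \<Sum>i\<in>A. f i w) u v = (\<Sum>i\<in>A. shuffle_sum (f i) u v)"
  by (induction A rule: finite_induct) (simp_all add: shuffle_sum_zero shuffle_sum_add)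

text \<open>Cutting a shuffle of u and v into two pieces cuts both words: the left piece shuffles a
  prefix of each, the right piece the remaining suffixes. So deconcatenation is compatible with
  shuffling.\<close>

lemma shuffle_sum_mult:
  "shuffle_sum (nc_mult f g) u v =
     (\<Sum>i\<le>length u. \<Sum>j\<le>length v.
        shuffle_sum f (take i u) (take j v) * shuffle_sum g (drop i u) (drop j v))"
proof (induction "length u + length v" arbitrary: f u v rule: less_induct)
  case less
  let ?M = "\<lambda>f u v. \<Sum>i\<le>length u. \<Sum>j\<le>length v.
        shuffle_sum f (take i u) (take j v) * shuffle_sum g (drop i u) (drop j v)"
  show ?case
  proof (cases u)
    case Nil
    then show ?thesis by (simp add: nc_mult_def)
  next
    case u: (Cons a u')
    show ?thesis
    proof (cases v)
      case Nil
      then show ?thesis by (simp add: nc_mult_def)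
    next
      case v: (Cons b v')
      let ?fa = "\<lambda>w. f (a # w)" and ?fb = "\<lambda>w. f (b # w)"
      have shift: "(\<lambda>w. nc_mult f g (a # w)) = (\<lambda>w. f [] * g (a # w) + nc_mult (\<lambda>w. f (a # w)) g w)" for a
        by (simp add: nc_mult_Cons)
      have 1: "shuffle_sum (nc_mult f g) u v
        = f [] * shuffle_sum g u v + (?M ?fa u' v + ?M ?fb u v')"
      proof -
        have "shuffle_sum (nc_mult ?fa g) u' v = ?M ?fa u' v"
          "shuffle_sum (nc_mult ?fb g) u v' = ?M ?fb u v'"
          by (rule less; simp add: u v)+
        then show ?thesis
          unfolding u v shuffle_sum.simps shift shuffle_sum_add shuffle_sum_scale
          by (simp add: algebra_simps)
      qed
      \<comment> \<open>Facts 2 to 4 separate the terms with i = 0 or j = 0. When both are positive,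
        the first letter of the left piece comes from u or from v, which matches the two sums in
        fact 1.\<close>
      have 2: "?M ?fa u' v = (\<Sum>i\<le>length u'. f (a # take i u') * shuffle_sum g (drop i u') v
          + (\<Sum>j\<le>length v'. shuffle_sum ?fa (take i u') (b # take j v') * shuffle_sum g (drop i u') (drop j v')))"
        unfolding v length_Cons by (subst sum.atMost_Suc_shift) simp
      have 3: "?M ?fb u v' = (\<Sum>j\<le>length v'. f (b # take j v') * shuffle_sum g u (drop j v'))
        + (\<Sum>i\<le>length u'. \<Sum>j\<le>length v'. shuffle_sum ?fb (a # take i u') (take j v') * shuffle_sum g (drop i u') (drop j v'))"
        unfolding u length_Cons by (subst sum.atMost_Suc_shift) simp
      have 4: "?M f u v = (f [] * shuffle_sum g u v + (\<Sum>j\<le>length v'. f (b # take j v') * shuffle_sum g u (drop j v')))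
        + (\<Sum>i\<le>length u'. f (a # take i u') * shuffle_sum g (drop i u') v
          + (\<Sum>j\<le>length v'. (shuffle_sum ?fa (take i u') (b # take j v') + shuffle_sum ?fb (a # take i u') (take j v'))
               * shuffle_sum g (drop i u') (drop j v')))"
        unfolding u v length_Cons by (simp del: sum.atMost_Suc add: sum.atMost_Suc_shift)
      show ?thesis unfolding 1 2 3 4 by (simp add: sum.distrib distrib_right)
    qed
  qed
qed

definition group_like :: "nc_series \<Rightarrow> bool" where
  "group_like F \<longleftrightarrow> F [] = 1 \<and> (\<forall>u v. shuffle_sum F u v = F u * F v)"

lemma group_like_mult:
  assumes "group_like F" "group_like G"
  shows "group_like (nc_mult F G)"
proof -
  have "shuffle_sum (nc_mult F G) u v = nc_mult F G u * nc_mult F G v" for u v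
    using assms unfolding shuffle_sum_mult nc_mult_def sum_product
    by (intro sum.cong refl) (simp add: group_like_def)
  then show ?thesis using assms by (simp add: group_like_def)
qed

lemma group_like_pow:
  assumes "group_like F"
  shows "group_like (nc_pow F n)"
proof (induction n)
  case 0
  have "shuffle_sum nc_one u v = nc_one u * nc_one v" for u v
    by (cases u; cases v) (simp_all add: nc_one_def[abs_def] shuffle_sum_zero)
  then show ?case by (simp add: group_like_def) (simp add: nc_one_def)
qed (simp add: assms group_like_mult)

lemma nc_pow_var: "nc_pow (nc_var x) n w = of_bool (w = replicate n x)"
proof (induction n arbitrary: w)
  case 0
  then show ?case by (simp add: nc_one_def)
next
  case (Suc n)
  show ?case
  proof (cases w)
    case (Cons a v)
    have "nc_mult (\<lambda>u. nc_var x (a # u)) (nc_pow (nc_var x) n) v = of_bool (a = x) * nc_pow (nc_var x) n v"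
    proof -
      have "(\<lambda>u. nc_var x (a # u)) = (\<lambda>u. of_bool (a = x) * nc_one u)"
        by (auto simp: nc_var_def nc_one_def)
      then show ?thesis by (simp only: nc_mult_scale_left nc_mult_one_left)
    qed
    moreover have "nc_var x [] = 0" by (simp add: nc_var_def)
    ultimately show ?thesis by (simp add: Cons nc_mult_Cons Suc)
  qed (simp add: nc_var_def)
qed

lemma nc_exp_var:
  "nc_exp (nc_var x) w = of_bool (set w \<subseteq> {x}) * (1 / fact (length w))"
proof -
  have "nc_pow (nc_var x) n w = of_bool (set w \<subseteq> {x}) * of_bool (n = length w)" for n
    by (auto simp: nc_pow_var replicate_eqI) (metis replicate_eqI singletonD subsetD)
  then have "nc_exp (nc_var x) w
      = (\<Sum>n\<le>length w. if n = length w then of_bool (set w \<subseteq> {x}) / fact (length w) else 0)"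
    unfolding nc_exp_def by (intro sum.cong) auto
  then show ?thesis by simp
qed

text \<open>All shuffles of two words in the single letter x are the same word, occurring binomially
  often. The weight h is arbitrary because stripping a letter shifts it.\<close>

lemma shuffle_sum_monochrome:
  "shuffle_sum (\<lambda>w. of_bool (set w \<subseteq> {x}) * h (length w)) u v
     = of_bool (set u \<subseteq> {x} \<and> set v \<subseteq> {x})
         * (of_nat ((length u + length v) choose length u) * h (length u + length v))"
proof (induction "length u + length v" arbitrary: h u v rule: less_induct)
  case less
  show ?case
  proof (cases u)
    case u: (Cons a u')
    show ?thesis
    proof (cases v)
      case v: (Cons b v')
      have shift: "(\<lambda>w. of_bool (set (c # w) \<subseteq> {x}) * h (length (c # w)))
        = (\<lambda>w. of_bool (c = x) * (of_bool (set w \<subseteq> {x}) * (\<lambda>n. h (Suc n)) (length w)))" for c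
        by auto
      let ?S = "\<lambda>u v. shuffle_sum (\<lambda>w. of_bool (set w \<subseteq> {x}) * h (Suc (length w))) u v"
      have "?S u' v = of_bool (set u' \<subseteq> {x} \<and> set v \<subseteq> {x})
          * (of_nat ((length u' + length v) choose length u') * h (Suc (length u' + length v)))"
        "?S u v' = of_bool (set u \<subseteq> {x} \<and> set v' \<subseteq> {x})
          * (of_nat ((length u + length v') choose length u) * h (Suc (length u + length v')))"
        by (rule less; simp add: u v)+
      moreover have "shuffle_sum (\<lambda>w. of_bool (set w \<subseteq> {x}) * h (length w)) u v
        = of_bool (a = x) * ?S u' v + of_bool (b = x) * ?S u v'"
        unfolding u v shuffle_sum.simps shift shuffle_sum_scale ..
      ultimately show ?thesis
        by (cases "set u \<subseteq> {x} \<and> set v \<subseteq> {x}") (auto simp: u v algebra_simps)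
    qed simp
  qed simp
qed

lemma group_like_exp_var: "group_like (nc_exp (nc_var x))"
proof -
  have *: "nc_exp (nc_var x) = (\<lambda>w. of_bool (set w \<subseteq> {x}) * (1 / fact (length w)))"
    by (rule ext) (rule nc_exp_var)
  have fact: "of_nat ((m + n) choose m) * (1 / fact (m + n)) = (1 / fact m) * (1 / fact n :: rat)" for m n
    by (subst binomial_fact) (auto simp: field_simps)
  show ?thesis
    unfolding group_like_def *
    unfolding shuffle_sum_monochrome[of x "\<lambda>n. 1 / fact n"] fact
    by (simp add: of_bool_conj mult_ac)
qed

text \<open>Applying the group-like law to F^n and letting n be indeterminate gives an identity of
  polynomials. In the linear coefficient of the product on the right, every term contains the value
  of F^0 at u or at v, which is 0 on non-empty words.\<close>

lemma shuffle_sum_log_eq_0: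
  assumes F: "group_like F" and "u \<noteq> []" "v \<noteq> []"
  shows "shuffle_sum (nc_log F) u v = 0"
proof -
  have F_Nil: "F [] = 1" using F by (simp add: group_like_def)
  let ?P = "nc_power_poly F"
  define N where "N = length u + length v"
  \<comment> \<open>Every shuffle of u and v has length \<open>length u + length v\<close>, so only
    the values of f on words of that length matter.\<close>
  have cong: "shuffle_sum f u v = shuffle_sum g u v"
    if "\<And>w. length w = length u + length v \<Longrightarrow> f w = g w" for f g u v
    using that
  proof (induction f u v arbitrary: g rule: shuffle_sum.induct)
    case (3 f a u b v)
    have "shuffle_sum (\<lambda>w. f (a # w)) u (b # v) = shuffle_sum (\<lambda>w. g (a # w)) u (b # v)"
      by (rule 3(1)) (simp add: 3(3))
    moreover have "shuffle_sum (\<lambda>w. f (b # w)) (a # u) v = shuffle_sum (\<lambda>w. g (b # w)) (a # u) v"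
      by (rule 3(2)) (simp add: 3(3))
    ultimately show ?case by simp
  qed simp_all
  \<comment> \<open>\<open>shuffle_sum\<close> takes rational values only, so the shuffle sum of the
    polynomials F^x is formed coefficientwise; N bounds their degrees on all shuffles of u and
    v.\<close>
  define Q where "Q = (\<Sum>j\<le>N. monom (shuffle_sum (\<lambda>w. coeff (?P w) j) u v) j)"
  have Q: "coeff Q i = shuffle_sum (\<lambda>w. coeff (?P w) i) u v" if "i \<le> N" for i
    using that by (simp add: Q_def coeff_sum)
  have "Q = ?P u * ?P v"
  proof (rule poly_eqI_of_nat)
    fix n
    have "poly Q (of_nat n) = (\<Sum>j\<le>N. of_nat n ^ j * shuffle_sum (\<lambda>w. coeff (?P w) j) u v)"
      by (simp add: Q_def poly_sum poly_monom mult.commute)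
    also have "\<dots> = shuffle_sum (\<lambda>w. \<Sum>j\<le>N. of_nat n ^ j * coeff (?P w) j) u v"
      by (simp add: shuffle_sum_sum shuffle_sum_scale)
    also have "\<dots> = shuffle_sum (nc_pow F n) u v"
    proof (rule cong)
      fix w :: "bool list" assume w: "length w = length u + length v"
      have "nc_pow F n w = (\<Sum>j\<le>degree (?P w). coeff (?P w) j * of_nat n ^ j)"
        by (simp add: poly_altdef flip: poly_nc_power_poly[of F, OF F_Nil])
      also have "\<dots> = (\<Sum>j\<le>N. of_nat n ^ j * coeff (?P w) j)"
        using degree_nc_power_poly[of F, OF F_Nil, of w] w
        by (intro sum.mono_neutral_cong_left) (auto simp: N_def coeff_eq_0)
      finally show "(\<Sum>j\<le>N. of_nat n ^ j * coeff (?P w) j) = nc_pow F n w" by simp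
    qed
    also have "\<dots> = nc_pow F n u * nc_pow F n v"
      using group_like_pow[OF F, of n] by (simp add: group_like_def)
    finally show "poly Q (of_nat n) = poly (?P u * ?P v) (of_nat n)"
      by (simp add: poly_nc_power_poly[of F, OF F_Nil])
  qed
  moreover have "coeff (p * q) 1 = coeff p 0 * coeff q 1 + coeff p 1 * coeff q 0" for p q :: "rat poly"
    by (simp add: coeff_mult)
  ultimately have "coeff Q 1 = 0"
    using assms(2,3) by (simp only: coeff_0_nc_power_poly[of F, OF F_Nil] nc_one_def) simp
  moreover have "1 \<le> N" using assms(2) by (cases u) (auto simp: N_def)
  ultimately show ?thesis
    using Q[of 1] by (simp only: coeff_1_nc_power_poly[of F, OF F_Nil])
qed

section \<open>The series log (exp x exp y) and its low-degree coefficients\<close>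

definition exp_exp :: nc_series where
  "exp_exp = nc_mult (nc_exp (nc_var False)) (nc_exp (nc_var True))"

lemma group_like_exp_exp: "group_like exp_exp"
  unfolding exp_exp_def by (intro group_like_mult group_like_exp_var)

lemma bch_series_eq_log: "bch_series = nc_log exp_exp"
  by (simp only: bch_series_def exp_exp_def)

lemma exp_exp_Nil: "exp_exp [] = 1"
  using group_like_exp_exp by (simp add: group_like_def)

lemma nc_exp_bch_series: "nc_exp bch_series = exp_exp"
  unfolding bch_series_eq_log by (rule nc_exp_log) (rule exp_exp_Nil)

lemma shuffle_sum_bch_series: "u \<noteq> [] \<Longrightarrow> v \<noteq> [] \<Longrightarrow> shuffle_sum bch_series u v = 0"
  unfolding bch_series_eq_log by (rule shuffle_sum_log_eq_0[OF group_like_exp_exp])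

lemma bch_series_Nil: "bch_series [] = 0"
  by (simp add: bch_series_def nc_log_def)

lemma nc_log_1:
  assumes "F [] = 1"
  shows "nc_log F [x] = F [x]"
proof -
  have "nc_log F [x] = nc_mult (\<lambda>u. F u - nc_one u) nc_one [x]"
    by (simp add: nc_log_def)
  also have "\<dots> = F [x]"
    using assms by (simp add: nc_mult_Cons nc_one_def)
  finally show ?thesis .
qed

text \<open>The square of F - 1 sees a two-letter word only through its cut in the middle, which
  gives the product \<open>F [x] * F [y]\<close>.\<close>

lemma nc_log_2:
  assumes "F [] = 1"
  shows "nc_log F [x, y] = F [x, y] - F [x] * F [y] / 2"
proof -
  define G where "G = (\<lambda>u. F u - nc_one u)"
  have G: "G [] = 0" "G [x] = F [x]" "G [y] = F [y]" "G [x, y] = F [x, y]"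
    using assms by (simp_all add: G_def nc_one_def)
  have "nc_mult f g [x, y] = f [] * g [x, y] + (f [x] * g [y] + f [x, y] * g [])" for f g
    by (simp add: nc_mult_Cons)
  moreover have "nc_mult f g [y] = f [] * g [y] + f [y] * g []" for f g
    by (simp add: nc_mult_Cons)
  moreover have "{1..length [x, y]} = {1, 2}" by auto
  ultimately show ?thesis
    unfolding nc_log_def G_def[symmetric] by (simp add: G numeral_2_eq_2 nc_one_def)
qed

lemma exp_exp_1: "exp_exp [x] = 1"
  unfolding exp_exp_def nc_mult_Cons nc_mult_Nil nc_exp_var by (cases x) auto

lemma exp_exp_2: "exp_exp [x, y] = (if x = y then 1 / 2 else if y then 1 else 0)"
  unfolding exp_exp_def nc_mult_Cons nc_mult_Nil nc_exp_var by (cases x; cases y) auto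

lemma bch_series_1: "bch_series [x] = 1"
  unfolding bch_series_eq_log by (simp only: nc_log_1[of exp_exp, OF exp_exp_Nil] exp_exp_1)

text \<open>The quadratic part is (xy - yx) / 2; through it the bracket is later recovered from the
  group law.\<close>

lemma bch_series_2: "bch_series [x, y] = (if x = y then 0 else if y then 1 / 2 else - 1 / 2)"
  unfolding bch_series_eq_log nc_log_2[of exp_exp, OF exp_exp_Nil] exp_exp_1 exp_exp_2 by simp

section \<open>Evaluation of series at nilpotent operators\<close>

lemma finite_words [simp]: "finite {w :: bool list. length w = n}"
  using finite_lists_length_eq[of "UNIV :: bool set" n] by simp

lemma finite_words_le [simp]: "finite {w :: bool list. length w \<le> n}"
  using finite_lists_length_le[of "UNIV :: bool set" n] by simp

lemma finite_word_pairs [simp]: "finite {(u :: bool list, v :: bool list). length u + length v \<le> n}"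
  by (rule finite_subset[of _ "{w. length w \<le> n} \<times> {w. length w \<le> n}"]) auto

lemma finite_word_pairs_eq [simp]: "finite {(u :: bool list, v :: bool list). length u + length v = n}"
  by (rule finite_subset[OF _ finite_word_pairs[of n]]) auto

lemma sum_words_le:
  fixes g :: "bool list \<Rightarrow> 'a::comm_monoid_add"
  shows "(\<Sum>w | length w \<le> N. g w) = (\<Sum>n\<le>N. \<Sum>w | length w = n. g w)"
proof (induction N)
  case (Suc N)
  have "{w :: bool list. length w \<le> Suc N} = {w. length w \<le> N} \<union> {w. length w = Suc N}"
    by auto
  then have "(\<Sum>w | length w \<le> Suc N. g w) = (\<Sum>w | length w \<le> N. g w) + (\<Sum>w | length w = Suc N. g w)"
    by (simp only:) (rule sum.union_disjoint; auto)
  then show ?case using Suc by simp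
qed simp

lemma sum_words_Suc:
  fixes g :: "bool list \<Rightarrow> 'a::comm_monoid_add"
  shows "(\<Sum>w | length w = Suc n. g w) = (\<Sum>w | length w = n. g (False # w) + g (True # w))"
proof -
  have "(\<Sum>w | length w = Suc n. g w) = (\<Sum>(a, w)\<in>UNIV \<times> {w. length w = n}. g (a # w))"
    by (rule sum.reindex_bij_witness[of _ "\<lambda>(a, w). a # w" "\<lambda>w. (hd w, tl w)"])
      (auto simp: length_Suc_conv)
  then show ?thesis
    by (simp add: sum.cartesian_product[symmetric] UNIV_bool sum.distrib)
qed

lemma sum_word_pairs_Suc:
  fixes g :: "bool list \<Rightarrow> bool list \<Rightarrow> 'a::comm_monoid_add"
  assumes "\<And>v. g [] v = 0"
  shows "(\<Sum>(u, v) | length u + length v = Suc n. g u v)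
    = (\<Sum>(u, v) | length u + length v = n. g (False # u) v + g (True # u) v)"
proof -
  let ?P = "\<lambda>n. {(u :: bool list, v :: bool list). length u + length v = n}"
  have "(\<Sum>(u, v)\<in>?P (Suc n). g u v) = (\<Sum>(u, v)\<in>?P (Suc n) \<inter> {(u, v). u \<noteq> []}. g u v)"
    using assms by (intro sum.mono_neutral_right) auto
  also have "\<dots> = (\<Sum>(a, u, v)\<in>UNIV \<times> ?P n. g (a # u) v)"
    by (rule sum.reindex_bij_witness[of _ "\<lambda>(a, u, v). (a # u, v)" "\<lambda>(u, v). (hd u, tl u, v)"])
      (auto simp: neq_Nil_conv)
  also have "\<dots> = (\<Sum>(u, v)\<in>?P n. g (False # u) v) + (\<Sum>(u, v)\<in>?P n. g (True # u) v)"
    by (simp add: sum.cartesian_product[symmetric] UNIV_bool)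
  finally show ?thesis
    by (simp add: sum.distrib[symmetric] case_prod_beta)
qed

lemma sum_word_pairs_swap:
  fixes g :: "bool list \<Rightarrow> bool list \<Rightarrow> 'a::comm_monoid_add"
  shows "(\<Sum>(u, v) | length u + length v = n. g u v) = (\<Sum>(v, u) | length v + length u = n. g u v)"
  by (rule sum.reindex_bij_witness[of _ "\<lambda>(u, v). (v, u)" "\<lambda>(u, v). (v, u)"]) auto

text \<open>The coproduct dual to shuffling: each letter goes to one of two subsequences. A list is
  used so that repeated pairs keep their multiplicity.\<close>

primrec unshuffles :: "bool list \<Rightarrow> (bool list \<times> bool list) list" where
  "unshuffles [] = [([], [])]"
| "unshuffles (a # w) =
     map (\<lambda>(u, v). (a # u, v)) (unshuffles w) @ map (\<lambda>(u, v). (u, a # v)) (unshuffles w)"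

primrec word_op :: "('v \<Rightarrow> 'v) \<Rightarrow> ('v \<Rightarrow> 'v) \<Rightarrow> bool list \<Rightarrow> 'v \<Rightarrow> 'v" where
  "word_op X Y [] p = p"
| "word_op X Y (a # w) p = (if a then Y else X) (word_op X Y w p)"

lemma word_op_append: "word_op X Y (u @ v) p = word_op X Y u (word_op X Y v p)"
  by (induction u) simp_all

text \<open>Mirrors \<open>word_bracket\<close>, with commutators of operators in place of
  brackets.\<close>

fun commutator_op :: "('v \<Rightarrow> 'v) \<Rightarrow> ('v \<Rightarrow> 'v) \<Rightarrow> bool list \<Rightarrow> 'v \<Rightarrow> 'v::ab_group_add" where
  "commutator_op X Y [] p = 0"
| "commutator_op X Y [a] p = (if a then Y else X) p"
| "commutator_op X Y (a # b # w) p =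
     (if a then Y else X) (commutator_op X Y (b # w) p) - commutator_op X Y (b # w) ((if a then Y else X) p)"

definition truncated_exp ::
    "(rat \<Rightarrow> 'v \<Rightarrow> 'v) \<Rightarrow> nat \<Rightarrow> ('v \<Rightarrow> 'v) \<Rightarrow> 'v \<Rightarrow> 'v::comm_monoid_add" where
  "truncated_exp scale N Z p = (\<Sum>n\<le>N. scale (1 / fact n) ((Z ^^ n) p))"

text \<open>The default 0 for an empty word makes the recursion symmetric in u and v, as it is for
  \<open>unshuffles\<close>.\<close>

lemma shuffle_sum_rec:
  assumes "u \<noteq> [] \<or> v \<noteq> []"
  shows "shuffle_sum f u v = (case u of [] \<Rightarrow> 0 | a # u' \<Rightarrow> shuffle_sum (\<lambda>w. f (a # w)) u' v)
     + (case v of [] \<Rightarrow> 0 | b # v' \<Rightarrow> shuffle_sum (\<lambda>w. f (b # w)) u v')"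
  using assms by (cases u; cases v) simp_all

text \<open>Vanishing is required of all mixed words beyond N letters, not just of powers of X and
  of Y; this makes evaluation of truncated series multiplicative.\<close>

locale nilpotent_pair = vector_space scale
  for scale :: "rat \<Rightarrow> 'v::ab_group_add \<Rightarrow> 'v" (infixr "*s" 75) +
  fixes X Y :: "'v \<Rightarrow> 'v" and N :: nat
  assumes linear_X: "Vector_Spaces.linear scale scale X"
    and linear_Y: "Vector_Spaces.linear scale scale Y"
    and word_op_vanish: "N < length w \<Longrightarrow> word_op X Y w p = 0"
begin

abbreviation letter :: "bool \<Rightarrow> 'v \<Rightarrow> 'v" where
  "letter a \<equiv> if a then Y else X"

abbreviation op :: "bool list \<Rightarrow> 'v \<Rightarrow> 'v" where
  "op \<equiv> word_op X Y"

definition ev :: "nc_series \<Rightarrow> 'v \<Rightarrow> 'v" where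
  "ev f p = (\<Sum>w | length w \<le> N. f w *s op w p)"

lemma linear_op: "Vector_Spaces.linear scale scale (op w)"
  using linear_X linear_Y by (induction w) (simp_all add: Vector_Spaces.linear_iff)

lemma op_zero: "op w 0 = 0"
  using linear_op[of w] by (simp add: Vector_Spaces.linear_iff) (metis scale_zero_left)

lemma op_sum: "op w (\<Sum>i\<in>A. g i) = (\<Sum>i\<in>A. op w (g i))"
  using linear_op[of w]
  by (induction A rule: infinite_finite_induct) (simp_all add: Vector_Spaces.linear_iff op_zero)

lemma op_scale: "op w (c *s p) = c *s op w p"
  using linear_op[of w] by (simp add: Vector_Spaces.linear_iff)

lemma linear_letter: "Vector_Spaces.linear scale scale (letter a)"
  by (simp add: linear_X linear_Y)

lemma ev_mult: "ev (nc_mult f g) p = ev f (ev g p)"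
proof -
  let ?K = "\<lambda>u v. (f u * g v) *s op (u @ v) p"
  have "ev (nc_mult f g) p
      = (\<Sum>w | length w \<le> N. \<Sum>i\<le>length w. ?K (take i w) (drop i w))"
    by (simp add: ev_def nc_mult_def scale_sum_left)
  also have "\<dots> = (\<Sum>(w, i)\<in>Sigma {w. length w \<le> N} (\<lambda>w. {..length w}). ?K (take i w) (drop i w))"
    by (simp add: sum.Sigma)
  also have "\<dots> = (\<Sum>(u, v) | length u + length v \<le> N. ?K u v)"
    by (rule sum.reindex_bij_witness[of _ "\<lambda>(u, v). (u @ v, length u)" "\<lambda>(w, i). (take i w, drop i w)"])
      auto
  \<comment> \<open>Passing from the triangle of pairs to the square adds only words of more than N
    letters, on which the operator is 0.\<close>
  also have "\<dots> = (\<Sum>(u, v)\<in>{u. length u \<le> N} \<times> {v. length v \<le> N}. ?K u v)"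
    by (rule sum.mono_neutral_left) (auto simp: not_le intro!: word_op_vanish)
  also have "\<dots> = ev f (ev g p)"
    unfolding ev_def
    by (simp add: sum.cartesian_product[symmetric] op_sum scale_sum_right word_op_append
        op_scale)
  finally show ?thesis .
qed

lemma ev_one: "ev nc_one p = p"
proof -
  have "ev nc_one p = (\<Sum>w :: bool list | length w \<le> N. if w = [] then p else 0)"
    unfolding ev_def by (rule sum.cong[OF refl]) (auto simp: nc_one_def)
  then show ?thesis by simp
qed

lemma ev_var: "ev (nc_var a) = letter a"
proof
  fix p
  have "ev (nc_var a) p = (\<Sum>w | length w \<le> N. if w = [a] then letter a p else 0)"
    unfolding ev_def by (rule sum.cong[OF refl]) (auto simp: nc_var_def)
  \<comment> \<open>For N = 0 the word \<open>[a]\<close> lies outside the sum, but then the letter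
    itself is the zero operator.\<close>
  also have "\<dots> = letter a p"
    using word_op_vanish[of "[a]" p] by (cases "N = 0") auto
  finally show "ev (nc_var a) p = letter a p" .
qed

lemma ev_pow: "(ev f ^^ n) p = ev (nc_pow f n) p"
  by (induction n) (simp_all add: ev_one ev_mult)

lemma ev_exp:
  assumes "f [] = 0"
  shows "ev (nc_exp f) p = truncated_exp scale N (ev f) p"
proof -
  have "ev (nc_exp f) p = (\<Sum>w | length w \<le> N. \<Sum>n\<le>N. (1 / fact n) *s nc_pow f n w *s op w p)"
    unfolding ev_def
  proof (rule sum.cong[OF refl])
    fix w :: "bool list" assume "w \<in> {w. length w \<le> N}"
    then have "nc_exp f w = (\<Sum>n\<le>N. nc_pow f n w / fact n)"
      unfolding nc_exp_def using assms
      by (intro sum.mono_neutral_left) (auto intro: nc_pow_eq_0)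
    then show "nc_exp f w *s op w p = (\<Sum>n\<le>N. (1 / fact n) *s nc_pow f n w *s op w p)"
      by (simp add: scale_sum_left)
  qed
  also have "\<dots> = (\<Sum>n\<le>N. \<Sum>w | length w \<le> N. (1 / fact n) *s nc_pow f n w *s op w p)"
    by (rule sum.swap)
  finally show ?thesis
    by (simp only: truncated_exp_def ev_pow ev_def scale_sum_right)
qed

lemma exp_ev_bch:
  "truncated_exp scale N (ev bch_series) p = truncated_exp scale N X (truncated_exp scale N Y p)"
proof -
  have "truncated_exp scale N (ev bch_series) p = ev exp_exp p"
    by (simp add: ev_exp[of bch_series, OF bch_series_Nil, symmetric] nc_exp_bch_series)
  also have "\<dots> = truncated_exp scale N (ev (nc_var False)) (truncated_exp scale N (ev (nc_var True)) p)"
    by (simp add: exp_exp_def ev_mult ev_exp nc_var_def)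
  finally show ?thesis by (simp add: ev_var)
qed

lemma letter_sum_list: "letter a (\<Sum>x\<leftarrow>xs. g x) = (\<Sum>x\<leftarrow>xs. letter a (g x))"
proof (induction xs)
  case Nil
  then show ?case using op_zero[of "[a]"] by simp
next
  case (Cons x xs)
  then show ?case using linear_letter[of a] by (simp only: Vector_Spaces.linear_iff list.map sum_list.Cons)
qed

lemma letter_scale: "letter a (c *s p) = c *s letter a p"
  using linear_letter[of a] by (simp only: Vector_Spaces.linear_iff)

lemma sum_list_minus: "(\<Sum>x\<leftarrow>xs. - g x) = - (\<Sum>x\<leftarrow>xs. g x :: 'v)"
  by (induction xs) simp_all

text \<open>These sums are the convolutions \<open>id * S\<close> and \<open>E * S\<close> in the tensor Hopf algebra, where \<open>S\<close> is the
  antipode and \<open>E\<close> multiplies words by their length. The first is the counit, the second the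
  iterated bracket.\<close>

definition antipode_sum :: "bool list \<Rightarrow> 'v \<Rightarrow> 'v" where
  "antipode_sum w p = (\<Sum>(u, v)\<leftarrow>unshuffles w. (-1) ^ length v *s op (u @ rev v) p)"

definition degree_antipode_sum :: "bool list \<Rightarrow> 'v \<Rightarrow> 'v" where
  "degree_antipode_sum w p =
     (\<Sum>(u, v)\<leftarrow>unshuffles w. (of_nat (length u) * (-1) ^ length v) *s op (u @ rev v) p)"

text \<open>The leading letter either joins u and acts last, or joins v, is reversed to the right
  end and acts first on p, with a sign.\<close>

lemma antipode_sum_Cons:
  "antipode_sum (a # w) p = letter a (antipode_sum w p) - antipode_sum w (letter a p)"
  unfolding antipode_sum_def unshuffles.simps case_prod_unfold
  by (simp only: letter_sum_list map_append sum_list_append map_map o_def case_prod_beta fst_conv snd_conv)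
    (cases a; simp add: letter_scale[of True, simplified] letter_scale[of False, simplified]
      word_op_append sum_list_minus case_prod_beta)

lemma degree_antipode_sum_Cons:
  "degree_antipode_sum (a # w) p
     = letter a (degree_antipode_sum w p) + letter a (antipode_sum w p) - degree_antipode_sum w (letter a p)"
  unfolding antipode_sum_def degree_antipode_sum_def unshuffles.simps case_prod_unfold
  by (simp only: letter_sum_list map_append sum_list_append map_map o_def case_prod_beta fst_conv snd_conv)
    (cases a; simp add: letter_scale[of True, simplified] letter_scale[of False, simplified]
      word_op_append sum_list_minus case_prod_beta distrib_right scale_left_distrib sum_list_addf)

lemma antipode_sum_eq: "antipode_sum w p = (if w = [] then p else 0)"
proof (induction w arbitrary: p)
  case Nil
  then show ?case by (simp add: antipode_sum_def)
next
  case (Cons a w)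
  then show ?case
    using op_zero[of "[a]"] by (cases a) (simp_all add: antipode_sum_Cons)
qed

text \<open>By \<open>antipode_sum_eq\<close> the extra term of
  \<open>degree_antipode_sum_Cons\<close> survives only for a single letter, where it is the base
  case; otherwise both sides satisfy the commutator recursion.\<close>

lemma commutator_op_eq: "commutator_op X Y w p = degree_antipode_sum w p"
proof (induction w arbitrary: p)
  case Nil
  then show ?case by (simp add: degree_antipode_sum_def)
next
  case (Cons a w)
  show ?case
  proof (cases w)
    case Nil
    then show ?thesis
      using op_zero[of "[a]"]
      by (cases a) (simp_all add: degree_antipode_sum_Cons antipode_sum_eq, simp_all add: degree_antipode_sum_def)
  next
    case (Cons b v)
    then have "commutator_op X Y (a # w) p
        = letter a (commutator_op X Y w p) - commutator_op X Y w (letter a p)"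
      by simp
    also have "\<dots> = letter a (degree_antipode_sum w p) - degree_antipode_sum w (letter a p)"
      by (simp only: Cons.IH)
    finally show ?thesis
      using Cons op_zero[of "[a]"] by (cases a) (simp_all add: degree_antipode_sum_Cons antipode_sum_eq)
  qed
qed

text \<open>Shuffling and unshuffling are adjoint: a pair (u, v) arises from w by unshuffling as
  often as w arises by shuffling u and v.\<close>

lemma sum_unshuffles:
  "(\<Sum>w | length w = n. f w *s (\<Sum>(u, v)\<leftarrow>unshuffles w. K u v))
     = (\<Sum>(u, v) | length u + length v = n. shuffle_sum f u v *s K u v)"
proof (induction n arbitrary: f K)
  case 0
  have "{(u :: bool list, v :: bool list). u = [] \<and> v = []} = {([], [])}" by auto
  then show ?case by simp
next
  case (Suc n)
  let ?s = "\<lambda>a w. f (a # w)"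
  let ?P = "\<lambda>n. {(u :: bool list, v :: bool list). length u + length v = n}"
  let ?A = "\<lambda>u v. case u of [] \<Rightarrow> 0 | a # u' \<Rightarrow> shuffle_sum (?s a) u' v"
  let ?B = "\<lambda>u v. case v of [] \<Rightarrow> 0 | b # v' \<Rightarrow> shuffle_sum (?s b) u v'"
  have "(\<Sum>w | length w = Suc n. f w *s (\<Sum>(u, v)\<leftarrow>unshuffles w. K u v))
    = (\<Sum>w | length w = n. \<Sum>a\<in>UNIV. f (a # w) *s (\<Sum>(u, v)\<leftarrow>unshuffles w. K (a # u) v)
        + f (a # w) *s (\<Sum>(u, v)\<leftarrow>unshuffles w. K u (a # v)))"
    unfolding sum_words_Suc UNIV_bool
    by (simp add: o_def case_prod_beta' scale_right_distrib add_ac)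
  also have "\<dots> = (\<Sum>a\<in>UNIV. (\<Sum>w | length w = n. f (a # w) *s (\<Sum>(u, v)\<leftarrow>unshuffles w. K (a # u) v))
        + (\<Sum>w | length w = n. f (a # w) *s (\<Sum>(u, v)\<leftarrow>unshuffles w. K u (a # v))))"
    by (subst sum.swap) (simp add: sum.distrib)
  also have "\<dots> = (\<Sum>a\<in>UNIV. (\<Sum>(u, v)\<in>?P n. shuffle_sum (?s a) u v *s K (a # u) v)
        + (\<Sum>(u, v)\<in>?P n. shuffle_sum (?s a) u v *s K u (a # v)))"
    unfolding Suc[of "?s a" "\<lambda>u. K (a # u)" for a] Suc[of "?s a" "\<lambda>u v. K u (a # v)" for a] ..
  also have "\<dots> = (\<Sum>(u, v)\<in>?P n. \<Sum>a\<in>UNIV. shuffle_sum (?s a) u v *s K (a # u) v)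
        + (\<Sum>(u, v)\<in>?P n. \<Sum>a\<in>UNIV. shuffle_sum (?s a) u v *s K u (a # v))"
    unfolding sum.distrib case_prod_unfold by (intro arg_cong2[where f = "(+)"] sum.swap)
  also have "(\<Sum>(u, v)\<in>?P n. \<Sum>a\<in>UNIV. shuffle_sum (?s a) u v *s K (a # u) v)
      = (\<Sum>(u, v)\<in>?P (Suc n). ?A u v *s K u v)"
    by (subst sum_word_pairs_Suc) (simp_all add: UNIV_bool add.commute)
  also have "(\<Sum>(u, v)\<in>?P n. \<Sum>a\<in>UNIV. shuffle_sum (?s a) u v *s K u (a # v))
      = (\<Sum>(u, v)\<in>?P (Suc n). ?B u v *s K u v)"
    by (subst (1 2) sum_word_pairs_swap, subst sum_word_pairs_Suc) (simp_all add: UNIV_bool add.commute)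
  also have "(\<Sum>(u, v)\<in>?P (Suc n). ?A u v *s K u v)
      + (\<Sum>(u, v)\<in>?P (Suc n). ?B u v *s K u v)
      = (\<Sum>(u, v)\<in>?P (Suc n). shuffle_sum f u v *s K u v)"
    unfolding sum.distrib[symmetric]
  proof (rule sum.cong[OF refl], clarify)
    fix u v :: "bool list" assume "length u + length v = Suc n"
    then have "u \<noteq> [] \<or> v \<noteq> []" by auto
    then show "?A u v *s K u v
        + ?B u v *s K u v = shuffle_sum f u v *s K u v"
      by (simp only: shuffle_sum_rec[of u v f] scale_left_distrib)
  qed
  finally show ?case .
qed

text \<open>By adjointness a primitive f meets only pairs with u or v empty. The weight
  \<open>length u\<close> removes \<open>u = []\<close>, and \<open>v = []\<close> leaves w itself
  with weight n.\<close>

lemma dynkin_specht_wever: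
  assumes primitive: "\<And>u v. u \<noteq> [] \<Longrightarrow> v \<noteq> [] \<Longrightarrow> shuffle_sum f u v = 0"
  shows "(\<Sum>w | length w = n. f w *s commutator_op X Y w p)
     = of_nat n *s (\<Sum>w | length w = n. f w *s op w p)"
proof -
  let ?K = "\<lambda>u v. (of_nat (length u) * (-1) ^ length v) *s op (u @ rev v) p"
  have "(\<Sum>w | length w = n. f w *s commutator_op X Y w p)
      = (\<Sum>(u, v) | length u + length v = n. shuffle_sum f u v *s ?K u v)"
    unfolding commutator_op_eq degree_antipode_sum_def by (rule sum_unshuffles)
  also have "\<dots> = (\<Sum>(u, v)\<in>{u. length u = n} \<times> {[]}. shuffle_sum f u v *s ?K u v)"
  proof (rule sum.mono_neutral_right)
    show "\<forall>x\<in>{(u, v). length u + length v = n} - {u. length u = n} \<times> {[]}.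
        (case x of (u, v) \<Rightarrow> shuffle_sum f u v *s ?K u v) = 0"
    proof
      fix x :: "bool list \<times> bool list"
      assume x: "x \<in> {(u, v). length u + length v = n} - {u. length u = n} \<times> {[]}"
      obtain u v where uv: "x = (u, v)" by (rule prod.exhaust)
      with x have "v \<noteq> []" by auto
      then show "(case x of (u, v) \<Rightarrow> shuffle_sum f u v *s ?K u v) = 0"
        using primitive[of u v] by (cases "u = []") (simp_all add: uv)
    qed
  qed auto
  also have "\<dots> = (\<Sum>w | length w = n. f w *s of_nat n *s op w p)"
    by (simp add: sum.cartesian_product[symmetric])
  finally show ?thesis
    by (simp add: scale_sum_right mult.commute)
qed

lemma ev_bch:
  "ev bch_series p
     = (\<Sum>w | w \<noteq> [] \<and> length w \<le> N. (bch_series w / of_nat (length w)) *s commutator_op X Y w p)"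
proof -
  have "ev bch_series p = (\<Sum>n\<le>N. \<Sum>w | length w = n. bch_series w *s op w p)"
    unfolding ev_def by (rule sum_words_le)
  also have "\<dots> = (\<Sum>n\<le>N. \<Sum>w | length w = n. (bch_series w / of_nat (length w)) *s commutator_op X Y w p)"
  proof (rule sum.cong[OF refl])
    fix n
    have *: "(\<Sum>w | length w = n. bch_series w *s commutator_op X Y w p)
        = of_nat n *s (\<Sum>w | length w = n. bch_series w *s op w p)"
      by (rule dynkin_specht_wever) (rule shuffle_sum_bch_series)
    have "(\<Sum>w | length w = n. bch_series w *s op w p)
      = (1 / of_nat n) *s (\<Sum>w | length w = n. bch_series w *s commutator_op X Y w p)"
      \<comment> \<open>In degree 0 both sides are 0: the series has no constant term, and 1 / 0 =
        0.\<close>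
      unfolding * by (cases "n = 0") (simp_all add: bch_series_Nil)
    then show "(\<Sum>w | length w = n. bch_series w *s op w p)
      = (\<Sum>w | length w = n. (bch_series w / of_nat (length w)) *s commutator_op X Y w p)"
      by (simp add: scale_sum_right)
  qed
  also have "\<dots> = (\<Sum>w | length w \<le> N. (bch_series w / of_nat (length w)) *s commutator_op X Y w p)"
    by (rule sum_words_le[symmetric])
  also have "\<dots> = (\<Sum>w | w \<noteq> [] \<and> length w \<le> N. (bch_series w / of_nat (length w)) *s commutator_op X Y w p)"
    by (rule sum.mono_neutral_right) auto
  finally show ?thesis .
qed

end

section \<open>Isomorphisms of Lie algebras\<close>

context lie_algebra
begin

lemma bracket_span_closed: "bracket_span A B \<subseteq> carrier L" if "A \<subseteq> carrier L" "B \<subseteq> carrier L"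
  unfolding bracket_span_def by (rule span_is_subset2) (use that bracket_closed in auto)

lemma bracket_span_submodule:
  "submodule K (bracket_span A B) L" if "A \<subseteq> carrier L" "B \<subseteq> carrier L"
  unfolding bracket_span_def by (rule span_is_submodule) (use that bracket_closed in auto)

lemma bracket_in_bracket_span:
  assumes "A \<subseteq> carrier L" "B \<subseteq> carrier L" "x \<in> A" "y \<in> B"
  shows "bracket L x y \<in> bracket_span A B"
proof -
  have "{bracket L x y | x y. x \<in> A \<and> y \<in> B} \<subseteq> carrier L"
    using assms(1,2) bracket_closed by auto
  from in_own_span[OF this] show ?thesis
    unfolding bracket_span_def using assms(3,4) by auto
qed

lemma bracket_span_subset:
  assumes "submodule K S L" "\<And>x y. x \<in> A \<Longrightarrow> y \<in> B \<Longrightarrow> bracket L x y \<in> S"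
  shows "bracket_span A B \<subseteq> S"
  unfolding bracket_span_def by (rule span_is_subset) (use assms in auto)

lemma carrier_submodule: "submodule K (carrier L) L"
  by (simp add: submodule_def module_axioms)

lemma lower_central_series_submodule: "submodule K (lower_central_series n) L"
proof (induction n)
  case 0
  then show ?case by (simp add: carrier_submodule)
next
  case (Suc n)
  then show ?case
    by (simp add: bracket_span_submodule submodule.subset)
qed

lemmas lower_central_series_closed = submodule.subset[OF lower_central_series_submodule]

lemma derived_series_closed: "derived_series n \<subseteq> carrier L"
  by (induction n) (simp_all add: bracket_span_closed)

lemma bracket_zero_left: "y \<in> carrier L \<Longrightarrow> bracket L \<zero>\<^bsub>L\<^esub> y = \<zero>\<^bsub>L\<^esub>"
  using bracket_smult_left[of "\<zero>\<^bsub>K\<^esub>" "\<zero>\<^bsub>L\<^esub>" y] by (simp add: bracket_closed)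

lemma bracket_zero_right: "x \<in> carrier L \<Longrightarrow> bracket L x \<zero>\<^bsub>L\<^esub> = \<zero>\<^bsub>L\<^esub>"
  using bracket_smult_right[of "\<zero>\<^bsub>K\<^esub>" x "\<zero>\<^bsub>L\<^esub>"] by (simp add: bracket_closed)

lemma bracket_skew:
  assumes "x \<in> carrier L" "y \<in> carrier L"
  shows "bracket L y x = \<ominus>\<^bsub>L\<^esub> bracket L x y"
proof -
  have "\<zero>\<^bsub>L\<^esub> = bracket L (x \<oplus>\<^bsub>L\<^esub> y) (x \<oplus>\<^bsub>L\<^esub> y)"
    using assms by (simp add: bracket_self)
  also have "\<dots> = bracket L y x \<oplus>\<^bsub>L\<^esub> bracket L x y"
    using assms
    by (simp add: bracket_add_left bracket_add_right bracket_closed) (simp add: bracket_self bracket_closed)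
  finally show ?thesis
    using assms by (simp add: bracket_closed M.minus_equality)
qed

end

locale lie_isomorphism = L1: lie_algebra K L1 + L2: lie_algebra K L2
  for K :: "('a, 'k) ring_scheme" and L1 :: "('a, 'b, 'l) lie_alg_scheme"
    and L2 :: "('a, 'c, 'm) lie_alg_scheme" +
  fixes h :: "'b \<Rightarrow> 'c"
  assumes bij: "bij_betw h (carrier L1) (carrier L2)"
    and hom_add: "\<lbrakk>x \<in> carrier L1; y \<in> carrier L1\<rbrakk> \<Longrightarrow> h (x \<oplus>\<^bsub>L1\<^esub> y) = h x \<oplus>\<^bsub>L2\<^esub> h y"
    and hom_smult: "\<lbrakk>a \<in> carrier K; x \<in> carrier L1\<rbrakk> \<Longrightarrow> h (a \<odot>\<^bsub>L1\<^esub> x) = a \<odot>\<^bsub>L2\<^esub> h x"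
    and hom_bracket:
      "\<lbrakk>x \<in> carrier L1; y \<in> carrier L1\<rbrakk> \<Longrightarrow> h (bracket L1 x y) = bracket L2 (h x) (h y)"
begin

lemma closed: "x \<in> carrier L1 \<Longrightarrow> h x \<in> carrier L2"
  using bij by (auto simp: bij_betw_def)

lemma image_carrier: "h ` carrier L1 = carrier L2"
  using bij by (auto simp: bij_betw_def)

lemma hom_zero: "h \<zero>\<^bsub>L1\<^esub> = \<zero>\<^bsub>L2\<^esub>"
  using hom_smult[of "\<zero>\<^bsub>K\<^esub>" "\<zero>\<^bsub>L1\<^esub>"] by (simp add: closed)

lemma hom_finsum:
  "g \<in> A \<rightarrow> carrier L1 \<Longrightarrow> h (\<Oplus>\<^bsub>L1\<^esub>i\<in>A. g i) = (\<Oplus>\<^bsub>L2\<^esub>i\<in>A. h (g i))"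
proof (induction A rule: infinite_finite_induct)
  case (insert x A)
  then have "(\<lambda>i. h (g i)) \<in> A \<rightarrow> carrier L2" "h (g x) \<in> carrier L2"
    using closed by auto
  with insert show ?case by (simp add: hom_add Pi_iff)
qed (simp_all add: hom_zero)

lemma inverse: "lie_isomorphism K L2 L1 (inv_into (carrier L1) h)"
proof
  let ?k = "inv_into (carrier L1) h"
  show bij': "bij_betw ?k (carrier L2) (carrier L1)"
    by (rule bij_betw_inv_into[OF bij])
  have hk: "?k u \<in> carrier L1" "h (?k u) = u" if "u \<in> carrier L2" for u
    using that bij' bij by (auto simp: bij_betw_def f_inv_into_f)
  have kh: "?k (h x) = x" if "x \<in> carrier L1" for x
    using that bij by (auto simp: bij_betw_def)
  show "?k (u \<oplus>\<^bsub>L2\<^esub> v) = ?k u \<oplus>\<^bsub>L1\<^esub> ?k v" if "u \<in> carrier L2" "v \<in> carrier L2" for u v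
    using kh[of "?k u \<oplus>\<^bsub>L1\<^esub> ?k v"] that by (simp add: hk hom_add)
  show "?k (a \<odot>\<^bsub>L2\<^esub> u) = a \<odot>\<^bsub>L1\<^esub> ?k u" if "a \<in> carrier K" "u \<in> carrier L2" for a u
    using kh[of "a \<odot>\<^bsub>L1\<^esub> ?k u"] that by (simp add: hk hom_smult)
  show "?k (bracket L2 u v) = bracket L1 (?k u) (?k v)" if "u \<in> carrier L2" "v \<in> carrier L2" for u v
    using kh[of "bracket L1 (?k u) (?k v)"] that by (simp add: hk hom_bracket L1.bracket_closed)
qed

text \<open>Spans are least submodules; the preimage of the span on the right and the image of the
  span on the left are submodules.\<close>

lemma image_span:
  assumes "A \<subseteq> carrier L1"
  shows "h ` L1.span A = L2.span (h ` A)"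
proof
  have A': "h ` A \<subseteq> carrier L2" using assms closed by auto
  interpret S: submodule K "L1.span A" L1
    by (rule L1.span_is_submodule[OF assms])
  interpret T: submodule K "L2.span (h ` A)" L2
    by (rule L2.span_is_submodule[OF A'])
  have "submodule K {x \<in> carrier L1. h x \<in> L2.span (h ` A)} L1"
    by unfold_locales (auto simp: hom_add hom_zero hom_smult)
  from L1.span_is_subset[OF _ this, of A] show "h ` L1.span A \<subseteq> L2.span (h ` A)"
    using assms L2.in_own_span[OF A'] by auto
  have "submodule K (h ` L1.span A) L2"
  proof unfold_locales
    show "h ` L1.span A \<subseteq> carrier L2" using S.subset closed by auto
    show "\<zero>\<^bsub>L2\<^esub> \<in> h ` L1.span A" using S.zero_closed hom_zero by (metis imageI)
    show "v \<oplus>\<^bsub>L2\<^esub> w \<in> h ` L1.span A" if vw: "v \<in> h ` L1.span A" "w \<in> h ` L1.span A" for v w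
    proof -
      from vw obtain x y where "x \<in> L1.span A" "v = h x" "y \<in> L1.span A" "w = h y" by auto
      moreover from this have "v \<oplus>\<^bsub>L2\<^esub> w = h (x \<oplus>\<^bsub>L1\<^esub> y)" using S.subset by (subst hom_add) auto
      ultimately show ?thesis by auto
    qed
    show "c \<odot>\<^bsub>L2\<^esub> v \<in> h ` L1.span A" if cv: "c \<in> carrier K" "v \<in> h ` L1.span A" for c v
    proof -
      from cv obtain x where "x \<in> L1.span A" "v = h x" by auto
      moreover from this have "c \<odot>\<^bsub>L2\<^esub> v = h (c \<odot>\<^bsub>L1\<^esub> x)" using cv S.subset by (subst hom_smult) auto
      ultimately show ?thesis using cv by auto
    qed
  qed
  from L2.span_is_subset[OF _ this, of "h ` A"] show "L2.span (h ` A) \<subseteq> h ` L1.span A"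
    using L1.in_own_span[OF assms] by (simp add: image_mono)
qed

lemma image_bracket_span:
  assumes "A \<subseteq> carrier L1" "B \<subseteq> carrier L1"
  shows "h ` L1.bracket_span A B = L2.bracket_span (h ` A) (h ` B)"
proof -
  have "h ` {bracket L1 x y | x y. x \<in> A \<and> y \<in> B} = {bracket L2 u v | u v. u \<in> h ` A \<and> v \<in> h ` B}"
    (is "?l = ?r")
  proof
    show "?l \<subseteq> ?r" using assms hom_bracket by blast
    show "?r \<subseteq> ?l"
    proof
      fix z assume "z \<in> ?r"
      then obtain x y where "x \<in> A" "y \<in> B" "z = bracket L2 (h x) (h y)" by auto
      moreover from this have "z = h (bracket L1 x y)" using assms by (subst hom_bracket) auto
      ultimately show "z \<in> ?l" by blast
    qed
  qed
  moreover have "{bracket L1 x y | x y. x \<in> A \<and> y \<in> B} \<subseteq> carrier L1"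
    using assms L1.bracket_closed by auto
  ultimately show ?thesis
    unfolding L1.bracket_span_def L2.bracket_span_def by (simp add: image_span)
qed

lemma image_lower_central_series: "h ` L1.lower_central_series n = L2.lower_central_series n"
  by (induction n) (simp_all add: image_carrier image_bracket_span L1.lower_central_series_closed)

lemma image_derived_series: "h ` L1.derived_series n = L2.derived_series n"
  by (induction n) (simp_all add: image_carrier image_bracket_span L1.derived_series_closed)

lemma image_eq_zero_iff:
  assumes "S \<subseteq> carrier L1"
  shows "h ` S = {\<zero>\<^bsub>L2\<^esub>} \<longleftrightarrow> S = {\<zero>\<^bsub>L1\<^esub>}"
proof
  assume *: "h ` S = {\<zero>\<^bsub>L2\<^esub>}"
  have "x = \<zero>\<^bsub>L1\<^esub>" if "x \<in> S" for x
  proof -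
    have "h x = h \<zero>\<^bsub>L1\<^esub>" using * that hom_zero by auto
    then show ?thesis using that assms bij by (auto simp: bij_betw_def inj_on_def)
  qed
  then show "S = {\<zero>\<^bsub>L1\<^esub>}" using * by auto
qed (simp add: hom_zero)

lemma lower_central_series_eq_zero_iff:
  "L2.lower_central_series n = {\<zero>\<^bsub>L2\<^esub>} \<longleftrightarrow> L1.lower_central_series n = {\<zero>\<^bsub>L1\<^esub>}"
  using image_eq_zero_iff[OF L1.lower_central_series_closed] by (simp add: image_lower_central_series)

lemma derived_series_eq_zero_iff:
  "L2.derived_series n = {\<zero>\<^bsub>L2\<^esub>} \<longleftrightarrow> L1.derived_series n = {\<zero>\<^bsub>L1\<^esub>}"
  using image_eq_zero_iff[OF L1.derived_series_closed] by (simp add: image_derived_series)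

lemma nilpotent_iff: "L2.nilpotent \<longleftrightarrow> L1.nilpotent"
  by (simp add: L1.nilpotent_def L2.nilpotent_def lower_central_series_eq_zero_iff)

lemma nilpotency_class_eq: "L2.nilpotency_class = L1.nilpotency_class"
  by (simp add: L1.nilpotency_class_def L2.nilpotency_class_def lower_central_series_eq_zero_iff)

lemma solvable_iff: "L2.solvable \<longleftrightarrow> L1.solvable"
  by (simp add: L1.solvable_def L2.solvable_def derived_series_eq_zero_iff)

lemma derived_length_eq: "L2.derived_length = L1.derived_length"
  by (simp add: L1.derived_length_def L2.derived_length_def derived_series_eq_zero_iff)

lemma generating_set_transfer:
  assumes "finite A" "card A = n" "A \<subseteq> carrier L1" "L1.span A = carrier L1"
  shows "\<exists>B. finite B \<and> card B = n \<and> B \<subseteq> carrier L2 \<and> L2.span B = carrier L2"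
proof (intro exI conjI)
  have "inj_on h A" using bij assms(3) by (auto simp: bij_betw_def intro: inj_on_subset)
  then show "card (h ` A) = n" using assms(2) by (simp add: card_image)
  show "L2.span (h ` A) = carrier L2"
    using image_span[OF assms(3)] assms(4) image_carrier by simp
qed (use assms closed in auto)

end

text \<open>\<open>dim\<close> is the least size of a finite generating set, so this equivalence
  transports it without bases; one direction comes from the inverse isomorphism.\<close>

lemma (in lie_isomorphism) generating_set_iff:
  "(\<exists>B. finite B \<and> card B = n \<and> B \<subseteq> carrier L2 \<and> L2.span B = carrier L2)
     \<longleftrightarrow> (\<exists>A. finite A \<and> card A = n \<and> A \<subseteq> carrier L1 \<and> L1.span A = carrier L1)"
  using generating_set_transfer[of _ n]
    lie_isomorphism.generating_set_transfer[OF inverse, of _ n] by blast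

lemma (in lie_isomorphism) dim_eq: "L2.dim = L1.dim"
  unfolding L1.dim_def L2.dim_def generating_set_iff ..

lemma (in lie_isomorphism) fin_dim_iff: "L2.fin_dim \<longleftrightarrow> L1.fin_dim"
proof -
  have "L2.fin_dim \<longleftrightarrow> (\<exists>n B. finite B \<and> card B = n \<and> B \<subseteq> carrier L2 \<and> L2.span B = carrier L2)"
    "L1.fin_dim \<longleftrightarrow> (\<exists>n A. finite A \<and> card A = n \<and> A \<subseteq> carrier L1 \<and> L1.span A = carrier L1)"
    by (simp_all add: L1.fin_dim_def L2.fin_dim_def)
  then show ?thesis by (simp only: generating_set_iff)
qed

lemma (in lie_isomorphism) filiform_iff: "L2.filiform \<longleftrightarrow> L1.filiform"
  by (simp add: L1.filiform_def L2.filiform_def nilpotent_iff nilpotency_class_eq dim_eq fin_dim_iff)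

text \<open>A Malcev Lie algebra must live on the very elements of its group, here maps of residue
  classes, so a convenient model is relabelled along h.\<close>

definition transport_lie_alg ::
    "('a, 'b, 'l) lie_alg_scheme \<Rightarrow> ('b \<Rightarrow> 'c) \<Rightarrow> ('a, 'c) lie_alg" where
  "transport_lie_alg L h = (let k = inv_into (carrier L) h in
     \<lparr>carrier = h ` carrier L, monoid.mult = undefined, one = undefined, zero = h \<zero>\<^bsub>L\<^esub>,
      add = (\<lambda>u v. h (k u \<oplus>\<^bsub>L\<^esub> k v)), module.smult = (\<lambda>a u. h (a \<odot>\<^bsub>L\<^esub> k u)),
      bracket = (\<lambda>u v. h (bracket L (k u) (k v)))\<rparr>)"

lemma (in lie_algebra) transport_lie_alg:
  assumes inj: "inj_on h (carrier L)"
  shows "lie_isomorphism K L (transport_lie_alg L h) h"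
proof -
  let ?L = "transport_lie_alg L h"
  have carrier: "carrier ?L = h ` carrier L" and zero: "\<zero>\<^bsub>?L\<^esub> = h \<zero>\<^bsub>L\<^esub>"
    by (simp_all add: transport_lie_alg_def Let_def)
  have ops: "h x \<oplus>\<^bsub>?L\<^esub> h y = h (x \<oplus>\<^bsub>L\<^esub> y)" "bracket ?L (h x) (h y) = h (bracket L x y)"
    "a \<odot>\<^bsub>?L\<^esub> h x = h (a \<odot>\<^bsub>L\<^esub> x)" if "x \<in> carrier L" "y \<in> carrier L" for x y a
    using that inj by (simp_all add: transport_lie_alg_def Let_def)
  have "vectorspace K ?L"
  proof (rule vs_criteria)
    show "field K" by (rule field_axioms)
    show "\<forall>v\<in>carrier ?L. \<exists>w\<in>carrier ?L. v \<oplus>\<^bsub>?L\<^esub> w = \<zero>\<^bsub>?L\<^esub>"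
    proof
      fix v assume "v \<in> carrier ?L"
      then obtain x where x: "x \<in> carrier L" "v = h x" by (auto simp: carrier)
      then show "\<exists>w\<in>carrier ?L. v \<oplus>\<^bsub>?L\<^esub> w = \<zero>\<^bsub>?L\<^esub>"
        by (intro bexI[of _ "h (\<ominus>\<^bsub>L\<^esub> x)"]) (simp_all add: ops zero carrier r_neg)
    qed
  qed (auto simp: carrier zero ops smult_r_distr smult_l_distr smult_assoc1 M.a_assoc M.a_comm M.add.m_lcomm)
  then interpret V: vectorspace K ?L .
  interpret L2: lie_algebra K ?L
    by unfold_locales
      (auto simp: carrier zero ops bracket_closed bracket_add_left bracket_add_right
        bracket_smult_left bracket_smult_right bracket_self jacobi)
  show ?thesis
    by unfold_locales (auto simp: carrier ops inj bij_betw_def)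
qed

section \<open>The Baker--Campbell--Hausdorff operation\<close>

context rational_lie_algebra
begin

lemma
  shows smult_rat_closed: "x \<in> carrier L \<Longrightarrow> a \<odot>\<^bsub>L\<^esub> x \<in> carrier L"
    and smult_rat_add_left: "x \<in> carrier L \<Longrightarrow> (a + b) \<odot>\<^bsub>L\<^esub> x = a \<odot>\<^bsub>L\<^esub> x \<oplus>\<^bsub>L\<^esub> b \<odot>\<^bsub>L\<^esub> x"
    and smult_rat_mult: "x \<in> carrier L \<Longrightarrow> (a * b) \<odot>\<^bsub>L\<^esub> x = a \<odot>\<^bsub>L\<^esub> (b \<odot>\<^bsub>L\<^esub> x)"
    and smult_rat_one: "x \<in> carrier L \<Longrightarrow> 1 \<odot>\<^bsub>L\<^esub> x = x"
    and smult_rat_zero: "x \<in> carrier L \<Longrightarrow> 0 \<odot>\<^bsub>L\<^esub> x = \<zero>\<^bsub>L\<^esub>"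
    and smult_rat_zero_right: "a \<odot>\<^bsub>L\<^esub> \<zero>\<^bsub>L\<^esub> = \<zero>\<^bsub>L\<^esub>"
    and smult_rat_add_right:
      "x \<in> carrier L \<Longrightarrow> y \<in> carrier L \<Longrightarrow> a \<odot>\<^bsub>L\<^esub> (x \<oplus>\<^bsub>L\<^esub> y) = a \<odot>\<^bsub>L\<^esub> x \<oplus>\<^bsub>L\<^esub> a \<odot>\<^bsub>L\<^esub> y"
    and smult_rat_minus_one: "x \<in> carrier L \<Longrightarrow> (- 1) \<odot>\<^bsub>L\<^esub> x = \<ominus>\<^bsub>L\<^esub> x"
    and bracket_smult_rat_left:
      "x \<in> carrier L \<Longrightarrow> y \<in> carrier L \<Longrightarrow> bracket L (a \<odot>\<^bsub>L\<^esub> x) y = a \<odot>\<^bsub>L\<^esub> bracket L x y"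
    and bracket_smult_rat_right:
      "x \<in> carrier L \<Longrightarrow> y \<in> carrier L \<Longrightarrow> bracket L x (a \<odot>\<^bsub>L\<^esub> y) = a \<odot>\<^bsub>L\<^esub> bracket L x y"
  using smult_closed[of a x] smult_l_distr[of a b x] smult_assoc1[of a b x] smult_one[of x]
    lmult_0[of x] rmult_0[of a] smult_r_distr[of a x y] smult_minus_1[of x]
    bracket_smult_left[of a x y] bracket_smult_right[of a x y]
  by (simp_all add: class_ring_simps)

lemmas smult_rat_simps = smult_rat_closed smult_rat_mult[symmetric] smult_rat_one smult_rat_zero
  smult_rat_zero_right smult_rat_add_right bracket_smult_rat_left bracket_smult_rat_right

abbreviation bch_term :: "'b \<Rightarrow> 'b \<Rightarrow> bool list \<Rightarrow> 'b" where
  "bch_term x y w \<equiv> (bch_series w / of_nat (length w)) \<odot>\<^bsub>L\<^esub> word_bracket x y w"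

lemma smult_rat_cancel:
  assumes "a \<noteq> 0" "x \<in> carrier L" "y \<in> carrier L" "a \<odot>\<^bsub>L\<^esub> x = a \<odot>\<^bsub>L\<^esub> y"
  shows "x = y"
proof -
  have "inverse a \<odot>\<^bsub>L\<^esub> (a \<odot>\<^bsub>L\<^esub> x) = inverse a \<odot>\<^bsub>L\<^esub> (a \<odot>\<^bsub>L\<^esub> y)"
    using assms(4) by simp
  then show ?thesis
    using assms(1-3) by (simp add: smult_rat_simps)
qed

lemma word_bracket_closed:
  "x \<in> carrier L \<Longrightarrow> y \<in> carrier L \<Longrightarrow> word_bracket x y w \<in> carrier L"
  by (induction x y w rule: word_bracket.induct) (simp_all add: bracket_closed)

lemma word_bracket_smult:
  assumes "x \<in> carrier L" "y \<in> carrier L"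
  shows "word_bracket (a \<odot>\<^bsub>L\<^esub> x) (a \<odot>\<^bsub>L\<^esub> y) w = a ^ length w \<odot>\<^bsub>L\<^esub> word_bracket x y w"
proof (induction w)
  case (Cons c w)
  then show ?case
    using assms by (cases w) (simp_all add: smult_rat_simps word_bracket_closed bracket_closed mult_ac)
qed (simp add: smult_rat_simps)

lemma word_bracket_lower_central_series:
  assumes "x \<in> carrier L" "y \<in> carrier L"
  shows "w \<noteq> [] \<Longrightarrow> word_bracket x y w \<in> lower_central_series (length w - 1)"
proof (induction w)
  case (Cons a w)
  show ?case
  proof (cases w)
    case (Cons b u)
    let ?z = "if a then y else x" and ?S = "lower_central_series (length w - 1)"
    have z: "?z \<in> carrier L" using assms by simp
    have wb: "word_bracket x y w \<in> ?S" using Cons.IH Cons by simp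
    interpret S: submodule class_ring "lower_central_series (length w)" L
      by (rule lower_central_series_submodule)
    \<comment> \<open>The series is built with brackets by \<open>carrier L\<close> on the right,
      while \<open>word_bracket\<close> adds letters on the left; a factor -1 reconciles
      them.\<close>
    have "bracket L (word_bracket x y w) ?z \<in> bracket_span ?S (carrier L)"
      by (rule bracket_in_bracket_span[OF lower_central_series_closed _ wb z]) simp
    then have *: "bracket L (word_bracket x y w) ?z \<in> lower_central_series (length w)"
      using Cons by simp
    have wb': "word_bracket x y w \<in> carrier L" using assms by (rule word_bracket_closed)
    have "bracket L ?z (word_bracket x y w) = (- 1) \<odot>\<^bsub>L\<^esub> bracket L (word_bracket x y w) ?z"
      using bracket_skew[OF wb' z] bracket_closed[OF wb' z] by (simp only: smult_rat_minus_one)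
    also have "\<dots> \<in> lower_central_series (length w)"
      using S.smult_closed[OF _ *] by simp
    finally show ?thesis using Cons by simp
  qed (use assms in simp)
qed simp

lemma lower_central_series_decreasing:
  "lower_central_series (Suc n) \<subseteq> lower_central_series n"
proof (induction n)
  case 0
  then show ?case using lower_central_series_closed[of 1] by simp
next
  case (Suc n)
  have "bracket_span (lower_central_series (Suc n)) (carrier L)
      \<subseteq> bracket_span (lower_central_series n) (carrier L)"
    by (rule bracket_span_subset[OF bracket_span_submodule[OF lower_central_series_closed]])
      (use Suc bracket_in_bracket_span[OF lower_central_series_closed] in auto)
  then show ?case by simp
qed

lemma lower_central_series_antimono: "m \<le> n \<Longrightarrow> lower_central_series n \<subseteq> lower_central_series m"
  by (rule lift_Suc_antimono_le[of lower_central_series]) (rule lower_central_series_decreasing)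

lemma lower_central_series_eq_zero:
  assumes nilpotent "nilpotency_class \<le> n"
  shows "lower_central_series n = {\<zero>\<^bsub>L\<^esub>}"
proof -
  have "lower_central_series nilpotency_class = {\<zero>\<^bsub>L\<^esub>}"
    unfolding nilpotency_class_def using assms(1) unfolding nilpotent_def by (rule LeastI_ex)
  then have "lower_central_series n \<subseteq> {\<zero>\<^bsub>L\<^esub>}"
    using lower_central_series_antimono[OF assms(2)] by simp
  moreover have "\<zero>\<^bsub>L\<^esub> \<in> lower_central_series n"
    by (rule submodule.zero_closed[OF lower_central_series_submodule])
  ultimately show ?thesis by auto
qed

lemma word_bracket_vanish:
  assumes nilpotent "x \<in> carrier L" "y \<in> carrier L" "nilpotency_class < length w"
  shows "word_bracket x y w = \<zero>\<^bsub>L\<^esub>"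
proof -
  have "word_bracket x y w \<in> lower_central_series (length w - 1)"
    using assms by (intro word_bracket_lower_central_series) auto
  also have "lower_central_series (length w - 1) = {\<zero>\<^bsub>L\<^esub>}"
    using assms by (intro lower_central_series_eq_zero) auto
  finally show ?thesis by simp
qed

text \<open>Longer brackets are 0, so the cut-off can be raised. The room serves to isolate words of
  one or two letters, and to match the cut-off used for operators.\<close>

lemma bch_eq:
  assumes nilpotent "x \<in> carrier L" "y \<in> carrier L" "nilpotency_class \<le> N"
  shows "bch x y = (\<Oplus>\<^bsub>L\<^esub>w\<in>{w. w \<noteq> [] \<and> length w \<le> N}.
     bch_term x y w)"
  unfolding bch_def
proof (rule M.add.finprod_mono_neutral_cong_left)
  show "finite {w :: bool list. w \<noteq> [] \<and> length w \<le> N}"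
    by (rule finite_subset[OF _ finite_words_le[of N]]) auto
  show "bch_term x y w = \<zero>\<^bsub>L\<^esub>"
    if "w \<in> {w. w \<noteq> [] \<and> length w \<le> N} - {w. w \<noteq> [] \<and> length w \<le> nilpotency_class}" for w
  proof -
    have "nilpotency_class < length w" using that by auto
    then show ?thesis using assms by (simp add: word_bracket_vanish smult_rat_zero_right)
  qed
qed (use assms in \<open>auto simp: smult_rat_closed word_bracket_closed\<close>)

lemma bch_split:
  assumes "nilpotent" "x \<in> carrier L" "y \<in> carrier L" "nilpotency_class \<le> N" "1 \<le> N"
  shows "bch x y = (x \<oplus>\<^bsub>L\<^esub> y) \<oplus>\<^bsub>L\<^esub> (\<Oplus>\<^bsub>L\<^esub>w\<in>{w. 2 \<le> length w \<and> length w \<le> N}.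
     bch_term x y w)"
proof -
  let ?f = "\<lambda>w. bch_term x y w"
  let ?A = "{w :: bool list. 2 \<le> length w \<and> length w \<le> N}"
  have f: "?f w \<in> carrier L" for w
    using assms by (simp add: smult_rat_closed word_bracket_closed)
  have fin: "finite ?A"
    by (rule finite_subset[OF _ finite_words_le[of N]]) auto
  have "{w :: bool list. w \<noteq> [] \<and> length w \<le> N} = {[False], [True]} \<union> ?A"
  proof (rule Set.set_eqI)
    fix w :: "bool list"
    have "length w = 1 \<longleftrightarrow> w \<in> {[False], [True]}"
      by (auto simp: length_Suc_conv)
    moreover have "w \<noteq> [] \<longleftrightarrow> length w = 1 \<or> 2 \<le> length w" by (cases w) (auto simp: Suc_le_eq)
    ultimately show "w \<in> {w. w \<noteq> [] \<and> length w \<le> N} \<longleftrightarrow> w \<in> {[False], [True]} \<union> ?A"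
      using assms(5) by auto
  qed
  then have "bch x y = (\<Oplus>\<^bsub>L\<^esub>w\<in>{[False], [True]} \<union> ?A. ?f w)"
    using bch_eq[OF assms(1-4)] by simp
  also have "\<dots> = (\<Oplus>\<^bsub>L\<^esub>w\<in>{[False], [True]}. ?f w) \<oplus>\<^bsub>L\<^esub> (\<Oplus>\<^bsub>L\<^esub>w\<in>?A. ?f w)"
    by (rule M.finsum_Un_disjoint[OF _ fin _ Pi_I[OF f] Pi_I[OF f]]) auto
  also have "(\<Oplus>\<^bsub>L\<^esub>w\<in>{[False], [True]}. ?f w) = ?f [False] \<oplus>\<^bsub>L\<^esub> ?f [True]"
    using assms by (simp add: M.finsum_insert Pi_iff smult_rat_closed)
  finally show ?thesis
    using assms by (simp add: bch_series_1 smult_rat_one)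
qed

lemma bch_split_2:
  assumes "nilpotent" "x \<in> carrier L" "y \<in> carrier L" "nilpotency_class \<le> N" "2 \<le> N"
  shows "bch x y = (x \<oplus>\<^bsub>L\<^esub> y) \<oplus>\<^bsub>L\<^esub> ((1 / 2) \<odot>\<^bsub>L\<^esub> bracket L x y \<oplus>\<^bsub>L\<^esub>
     (\<Oplus>\<^bsub>L\<^esub>w\<in>{w. 3 \<le> length w \<and> length w \<le> N}.
       bch_term x y w))"
proof -
  let ?f = "\<lambda>w. bch_term x y w"
  let ?A = "{w :: bool list. 2 \<le> length w \<and> length w \<le> N}"
  let ?B = "{w :: bool list. 3 \<le> length w \<and> length w \<le> N}"
  let ?C = "{[False, False], [False, True], [True, False], [True, True]}"
  have f: "?f w \<in> carrier L" for w
    using assms by (simp add: smult_rat_closed word_bracket_closed)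
  have fin: "finite ?B"
    by (rule finite_subset[OF _ finite_words_le[of N]]) auto
  have "?A = ?C \<union> ?B"
  proof (rule Set.set_eqI)
    fix w :: "bool list"
    have "length w = 2 \<longleftrightarrow> w \<in> ?C"
      by (auto simp: length_Suc_conv numeral_2_eq_2)
    moreover have "2 \<le> length w \<longleftrightarrow> length w = 2 \<or> 3 \<le> length w" by auto
    ultimately show "w \<in> ?A \<longleftrightarrow> w \<in> ?C \<union> ?B"
      using assms(5) by auto
  qed
  then have "(\<Oplus>\<^bsub>L\<^esub>w\<in>?A. ?f w) = (\<Oplus>\<^bsub>L\<^esub>w\<in>?C \<union> ?B. ?f w)" by simp
  also have "\<dots> = (\<Oplus>\<^bsub>L\<^esub>w\<in>?C. ?f w) \<oplus>\<^bsub>L\<^esub> (\<Oplus>\<^bsub>L\<^esub>w\<in>?B. ?f w)"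
    by (rule M.finsum_Un_disjoint[OF _ fin _ Pi_I[OF f] Pi_I[OF f]]) auto
  also have "(\<Oplus>\<^bsub>L\<^esub>w\<in>?C. ?f w)
      = ?f [False, False] \<oplus>\<^bsub>L\<^esub> (?f [False, True] \<oplus>\<^bsub>L\<^esub> (?f [True, False] \<oplus>\<^bsub>L\<^esub> ?f [True, True]))"
    using assms by (simp add: M.finsum_insert Pi_iff smult_rat_closed bracket_closed)
  \<comment> \<open>The words xy and yx contribute 1/4 each: a coefficient 1/2 or -1/2 divided by
    the length 2, the minus sign being absorbed by skew symmetry. The words xx and yy give
    0.\<close>
  also have "\<dots> = (1 / 4) \<odot>\<^bsub>L\<^esub> bracket L x y \<oplus>\<^bsub>L\<^esub> (1 / 4) \<odot>\<^bsub>L\<^esub> bracket L x y"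
    using assms bracket_skew[of x y]
    by (simp add: bch_series_2 bracket_closed smult_rat_simps smult_rat_minus_one[symmetric] bracket_self)
  also have "\<dots> = (1 / 2) \<odot>\<^bsub>L\<^esub> bracket L x y"
    using assms by (simp add: bracket_closed smult_rat_add_left[symmetric])
  finally show ?thesis using bch_split[OF assms(1-4)] assms(5) by simp
qed

text \<open>Multiples of x commute, so the innermost bracket of every word of two or more letters
  vanishes. These are the one-parameter subgroups.\<close>

lemma bch_collinear:
  assumes "nilpotent" "x \<in> carrier L"
  shows "bch (a \<odot>\<^bsub>L\<^esub> x) (b \<odot>\<^bsub>L\<^esub> x) = (a + b) \<odot>\<^bsub>L\<^esub> x"
proof -
  have wb: "word_bracket (a \<odot>\<^bsub>L\<^esub> x) (b \<odot>\<^bsub>L\<^esub> x) w = \<zero>\<^bsub>L\<^esub>" if "2 \<le> length w" for w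
    using that
  proof (induction w)
    case (Cons c w)
    show ?case
    proof (cases "2 \<le> length w")
      case True
      then obtain d u where "w = d # u" by (cases w) auto
      then show ?thesis using Cons True assms by (simp add: bracket_zero_right smult_rat_closed)
    next
      case False
      then obtain d where "w = [d]" using Cons.prems by (cases w) (auto simp: Suc_le_eq)
      then show ?thesis using assms by (simp add: smult_rat_simps bracket_self)
    qed
  qed simp
  have "bch (a \<odot>\<^bsub>L\<^esub> x) (b \<odot>\<^bsub>L\<^esub> x) = (a \<odot>\<^bsub>L\<^esub> x \<oplus>\<^bsub>L\<^esub> b \<odot>\<^bsub>L\<^esub> x) \<oplus>\<^bsub>L\<^esub> (\<Oplus>\<^bsub>L\<^esub>w\<in>{w. 2 \<le> length w \<and> length w \<le> Suc nilpotency_class}.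
     bch_term (a \<odot>\<^bsub>L\<^esub> x) (b \<odot>\<^bsub>L\<^esub> x) w)"
    using assms by (intro bch_split) (auto simp: smult_rat_closed)
  also have "(\<Oplus>\<^bsub>L\<^esub>w\<in>{w. 2 \<le> length w \<and> length w \<le> Suc nilpotency_class}.
     bch_term (a \<odot>\<^bsub>L\<^esub> x) (b \<odot>\<^bsub>L\<^esub> x) w) = \<zero>\<^bsub>L\<^esub>"
    by (rule M.finsum_all0) (simp add: wb smult_rat_zero_right)
  finally show ?thesis
    using assms by (simp add: smult_rat_closed smult_rat_add_left)
qed

end

locale rational_lie_isomorphism = lie_isomorphism "class_ring :: rat ring" L1 L2 h
  for L1 :: "(rat, 'b, 'l) lie_alg_scheme" and L2 :: "(rat, 'c, 'm) lie_alg_scheme" and h :: "'b \<Rightarrow> 'c"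
begin

sublocale R1: rational_lie_algebra L1 ..
sublocale R2: rational_lie_algebra L2 ..

lemma hom_word_bracket:
  "x \<in> carrier L1 \<Longrightarrow> y \<in> carrier L1 \<Longrightarrow> h (R1.word_bracket x y w) = R2.word_bracket (h x) (h y) w"
  by (induction x y w rule: R1.word_bracket.induct)
    (simp_all add: hom_zero hom_bracket R1.word_bracket_closed)

lemma hom_bch:
  assumes "x \<in> carrier L1" "y \<in> carrier L1"
  shows "h (R1.bch x y) = R2.bch (h x) (h y)"
  unfolding R1.bch_def R2.bch_def nilpotency_class_eq using assms
  by (subst hom_finsum) (auto simp: R1.smult_rat_closed R1.word_bracket_closed hom_smult hom_word_bracket)

end

section \<open>Uniqueness of the Malcev Lie algebra\<close>

context rational_lie_algebra
begin

text \<open>A curve of degree below d with coefficients in S, kept as a function of t: two Lie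
  algebra structures on one set can then be compared on the same curve.\<close>

inductive poly_curve :: "'b set \<Rightarrow> nat \<Rightarrow> (rat \<Rightarrow> 'b) \<Rightarrow> bool" for S where
  zero: "poly_curve S 0 (\<lambda>t. \<zero>\<^bsub>L\<^esub>)"
| step: "poly_curve S d p \<Longrightarrow> v \<in> S \<Longrightarrow> poly_curve S (Suc d) (\<lambda>t. p t \<oplus>\<^bsub>L\<^esub> t ^ d \<odot>\<^bsub>L\<^esub> v)"

definition polynomial :: "'b set \<Rightarrow> (rat \<Rightarrow> 'b) \<Rightarrow> bool" where
  "polynomial S p \<longleftrightarrow> (\<exists>d. poly_curve S d p)"

lemma poly_curve_SucE:
  assumes "poly_curve S (Suc d) p"
  obtains q v where "poly_curve S d q" "v \<in> S" "p = (\<lambda>t. q t \<oplus>\<^bsub>L\<^esub> t ^ d \<odot>\<^bsub>L\<^esub> v)"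
  using assms by (cases rule: poly_curve.cases) auto

lemma poly_curve_0D: "poly_curve S 0 p \<Longrightarrow> p = (\<lambda>t. \<zero>\<^bsub>L\<^esub>)"
  by (cases rule: poly_curve.cases) auto

lemma submodule_smult_rat:
  "submodule class_ring S L \<Longrightarrow> v \<in> S \<Longrightarrow> a \<odot>\<^bsub>L\<^esub> v \<in> S"
  using submodule.smult_closed[of class_ring S L a v] by simp

context
  fixes S :: "'b set"
  assumes S: "submodule class_ring S L"
begin

interpretation S: submodule class_ring S L by (rule S)

lemma in_carrier: "v \<in> S \<Longrightarrow> v \<in> carrier L"
  using S.subset by auto

lemma poly_curve_closed: "poly_curve S d p \<Longrightarrow> p t \<in> S"
  by (induction rule: poly_curve.induct) (simp_all add: submodule_smult_rat[OF S])

lemma poly_curve_carrier: "poly_curve S d p \<Longrightarrow> p t \<in> carrier L"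
  by (rule in_carrier) (rule poly_curve_closed)

lemma polynomial_closed: "polynomial S p \<Longrightarrow> p t \<in> S"
  unfolding polynomial_def using poly_curve_closed by blast

lemma polynomial_carrier: "polynomial S p \<Longrightarrow> p t \<in> carrier L"
  by (rule in_carrier) (rule polynomial_closed)

lemma poly_curve_add:
  "poly_curve S d p \<Longrightarrow> poly_curve S d q \<Longrightarrow> poly_curve S d (\<lambda>t. p t \<oplus>\<^bsub>L\<^esub> q t)"
proof (induction d p arbitrary: q rule: poly_curve.induct)
  case zero
  then show ?case using poly_curve_0D[of S q] poly_curve.zero[of S] by simp
next
  case (step d p v)
  from step.prems obtain q' w where q: "poly_curve S d q'" "w \<in> S" "q = (\<lambda>t. q' t \<oplus>\<^bsub>L\<^esub> t ^ d \<odot>\<^bsub>L\<^esub> w)"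
    by (rule poly_curve_SucE)
  have "(\<lambda>t. (p t \<oplus>\<^bsub>L\<^esub> t ^ d \<odot>\<^bsub>L\<^esub> v) \<oplus>\<^bsub>L\<^esub> q t)
      = (\<lambda>t. (p t \<oplus>\<^bsub>L\<^esub> q' t) \<oplus>\<^bsub>L\<^esub> t ^ d \<odot>\<^bsub>L\<^esub> (v \<oplus>\<^bsub>L\<^esub> w))"
    using step.hyps q by (auto simp: smult_rat_simps in_carrier poly_curve_carrier M.a_assoc M.a_comm M.add.m_lcomm)
  then show ?case
    using poly_curve.step[OF step.IH[OF q(1)], of "v \<oplus>\<^bsub>L\<^esub> w"] step.hyps q by simp
qed

lemma poly_curve_Suc:
  assumes "poly_curve S d p"
  shows "poly_curve S (Suc d) p"
proof -
  have "(\<lambda>t. p t \<oplus>\<^bsub>L\<^esub> t ^ d \<odot>\<^bsub>L\<^esub> \<zero>\<^bsub>L\<^esub>) = p"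
    using poly_curve_carrier[OF assms] by (simp add: smult_rat_zero_right)
  then show ?thesis
    using poly_curve.step[OF assms, of "\<zero>\<^bsub>L\<^esub>"] by simp
qed

lemma poly_curve_mono: "poly_curve S d p \<Longrightarrow> d \<le> e \<Longrightarrow> poly_curve S e p"
  by (induction e) (auto simp: le_Suc_eq intro: poly_curve_Suc)

lemma polynomial_add:
  assumes "polynomial S p" "polynomial S q"
  shows "polynomial S (\<lambda>t. p t \<oplus>\<^bsub>L\<^esub> q t)"
proof -
  from assms obtain d e where "poly_curve S d p" "poly_curve S e q" by (auto simp: polynomial_def)
  then have "poly_curve S (max d e) (\<lambda>t. p t \<oplus>\<^bsub>L\<^esub> q t)"
    by (intro poly_curve_add poly_curve_mono[of d _ "max d e"] poly_curve_mono[of e _ "max d e"]) auto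
  then show ?thesis by (auto simp: polynomial_def)
qed

lemma polynomial_zero: "polynomial S (\<lambda>t. \<zero>\<^bsub>L\<^esub>)"
  using poly_curve.zero polynomial_def by auto

lemma polynomial_monomial:
  assumes "v \<in> S"
  shows "polynomial S (\<lambda>t. t ^ k \<odot>\<^bsub>L\<^esub> v)"
proof -
  have "poly_curve S (Suc k) (\<lambda>t. \<zero>\<^bsub>L\<^esub> \<oplus>\<^bsub>L\<^esub> t ^ k \<odot>\<^bsub>L\<^esub> v)"
    by (intro poly_curve.step assms poly_curve_mono[OF poly_curve.zero]) simp
  then show ?thesis
    using assms by (auto simp: polynomial_def smult_rat_closed in_carrier)
qed

lemma polynomial_const: "v \<in> S \<Longrightarrow> polynomial S (\<lambda>t. v)"
  using polynomial_monomial[of v 0] by (simp add: smult_rat_one in_carrier)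

lemma polynomial_induct [consumes 1, case_names zero step]:
  assumes "polynomial S p" "P (\<lambda>t. \<zero>\<^bsub>L\<^esub>)"
    and "\<And>p v d. polynomial S p \<Longrightarrow> P p \<Longrightarrow> v \<in> S \<Longrightarrow> P (\<lambda>t. p t \<oplus>\<^bsub>L\<^esub> t ^ d \<odot>\<^bsub>L\<^esub> v)"
  shows "P p"
proof -
  from assms(1) obtain d where "poly_curve S d p" by (auto simp: polynomial_def)
  then show ?thesis
    by (induction rule: poly_curve.induct) (use assms(2,3) in \<open>auto simp: polynomial_def\<close>)
qed

lemma polynomial_times:
  assumes "polynomial S p"
  shows "polynomial S (\<lambda>t. (a * t ^ k) \<odot>\<^bsub>L\<^esub> p t)"
  using assms
proof (induction rule: polynomial_induct)
  case zero
  then show ?case by (simp add: smult_rat_zero_right polynomial_zero)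
next
  case (step p v d)
  have "(\<lambda>t. (a * t ^ k) \<odot>\<^bsub>L\<^esub> (p t \<oplus>\<^bsub>L\<^esub> t ^ d \<odot>\<^bsub>L\<^esub> v))
      = (\<lambda>t. (a * t ^ k) \<odot>\<^bsub>L\<^esub> p t \<oplus>\<^bsub>L\<^esub> t ^ (k + d) \<odot>\<^bsub>L\<^esub> (a \<odot>\<^bsub>L\<^esub> v))"
    using step by (auto simp: smult_rat_simps in_carrier polynomial_carrier power_add mult_ac)
  then show ?case
    using step by (simp add: polynomial_add polynomial_monomial submodule_smult_rat[OF S])
qed

lemma polynomial_smult: "polynomial S p \<Longrightarrow> polynomial S (\<lambda>t. a \<odot>\<^bsub>L\<^esub> p t)"
  using polynomial_times[of p a 0] by simp

lemma polynomial_times_power: "polynomial S p \<Longrightarrow> polynomial S (\<lambda>t. t ^ k \<odot>\<^bsub>L\<^esub> p t)"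
  using polynomial_times[of p 1 k] by simp

lemma polynomial_finsum:
  assumes "finite A" "\<And>i. i \<in> A \<Longrightarrow> polynomial S (p i)"
  shows "polynomial S (\<lambda>t. \<Oplus>\<^bsub>L\<^esub>i\<in>A. p i t)"
  using assms
proof (induction A rule: finite_induct)
  case empty
  then show ?case by (simp add: polynomial_zero)
next
  case (insert i A)
  then have "(\<lambda>t. \<Oplus>\<^bsub>L\<^esub>i\<in>insert i A. p i t) = (\<lambda>t. p i t \<oplus>\<^bsub>L\<^esub> (\<Oplus>\<^bsub>L\<^esub>i\<in>A. p i t))"
    by (intro ext M.finsum_insert) (auto intro!: polynomial_carrier)
  then show ?case
    using insert by (simp add: polynomial_add)
qed

lemma poly_curve_rescale: "poly_curve S d p \<Longrightarrow> poly_curve S d (\<lambda>t. p (a * t))"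
proof (induction rule: poly_curve.induct)
  case zero
  then show ?case by (rule poly_curve.zero)
next
  case (step d p v)
  have "(\<lambda>t. p (a * t) \<oplus>\<^bsub>L\<^esub> (a * t) ^ d \<odot>\<^bsub>L\<^esub> v) = (\<lambda>t. p (a * t) \<oplus>\<^bsub>L\<^esub> t ^ d \<odot>\<^bsub>L\<^esub> (a ^ d \<odot>\<^bsub>L\<^esub> v))"
    using step by (simp add: smult_rat_simps in_carrier power_mult_distrib mult.commute)
  then show ?case
    using poly_curve.step[OF step.IH, of "a ^ d \<odot>\<^bsub>L\<^esub> v"] step by (simp add: submodule_smult_rat[OF S])
qed

lemma poly_curve_smult: "poly_curve S d p \<Longrightarrow> poly_curve S d (\<lambda>t. a \<odot>\<^bsub>L\<^esub> p t)"
proof (induction rule: poly_curve.induct)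
  case zero
  then show ?case using poly_curve.zero by (simp add: smult_rat_zero_right)
next
  case (step d p v)
  have "(\<lambda>t. a \<odot>\<^bsub>L\<^esub> (p t \<oplus>\<^bsub>L\<^esub> t ^ d \<odot>\<^bsub>L\<^esub> v)) = (\<lambda>t. a \<odot>\<^bsub>L\<^esub> p t \<oplus>\<^bsub>L\<^esub> t ^ d \<odot>\<^bsub>L\<^esub> (a \<odot>\<^bsub>L\<^esub> v))"
    using step by (auto simp: smult_rat_simps in_carrier poly_curve_carrier mult.commute)
  then show ?case
    using poly_curve.step[OF step.IH, of "a \<odot>\<^bsub>L\<^esub> v"] step by (simp add: submodule_smult_rat[OF S])
qed

text \<open>The combination \<open>p(2t) - 2\<^sup>d p(t)\<close> removes the leading term and multiplies \<open>p(0)\<close>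
  by \<open>1 - 2\<^sup>d\<close>.\<close>

lemma poly_curve_vanish:
  assumes "poly_curve S d p" "\<And>t. t \<noteq> 0 \<Longrightarrow> p t = \<zero>\<^bsub>L\<^esub>"
  shows "p 0 = \<zero>\<^bsub>L\<^esub>"
  using assms
proof (induction d arbitrary: p)
  case 0
  then show ?case using poly_curve_0D by auto
next
  case (Suc d)
  from Suc.prems(1) obtain q v where q: "poly_curve S d q" and v: "v \<in> S"
    and p: "p = (\<lambda>t. q t \<oplus>\<^bsub>L\<^esub> t ^ d \<odot>\<^bsub>L\<^esub> v)"
    by (rule poly_curve_SucE)
  note [simp] = in_carrier[OF v] poly_curve_carrier[OF q] smult_rat_closed
  show ?case
  \<comment> \<open>For d = 0 the multiplier 1 - 2^d would be 0; there the curve is constant and its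
    value at t = 1 decides.\<close>
  proof (cases "d = 0")
    case True
    then have "p t = v" for t
      using q poly_curve_0D[of S q] by (simp add: p smult_rat_one)
    then show ?thesis using Suc.prems(2)[of 1] by simp
  next
    case False
    define \<eta> where "\<eta> = (\<lambda>t. q (2 * t) \<oplus>\<^bsub>L\<^esub> (- (2 ^ d)) \<odot>\<^bsub>L\<^esub> q t)"
    have vanish: "\<eta> t = \<zero>\<^bsub>L\<^esub>" if "t \<noteq> 0" for t
    proof -
      have "q s = \<ominus>\<^bsub>L\<^esub> (s ^ d \<odot>\<^bsub>L\<^esub> v)" if "s \<noteq> 0" for s
        using Suc.prems(2)[OF that] unfolding p by (intro M.minus_equality[symmetric]) simp_all
      then have *: "q s = (- (s ^ d)) \<odot>\<^bsub>L\<^esub> v" if "s \<noteq> 0" for s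
        using that smult_rat_minus_one[of "s ^ d \<odot>\<^bsub>L\<^esub> v"] by (simp add: smult_rat_mult[symmetric])
      have "2 * t \<noteq> 0" using that by simp
      from *[OF this] *[OF that] show ?thesis
        by (simp add: \<eta>_def smult_rat_mult[symmetric] smult_rat_add_left[symmetric] power_mult_distrib smult_rat_zero)
    qed
    have "poly_curve S d \<eta>"
      unfolding \<eta>_def by (intro poly_curve_add poly_curve_smult poly_curve_rescale q)
    then have "\<eta> 0 = \<zero>\<^bsub>L\<^esub>" using vanish by (rule Suc.IH)
    then have "(1 - 2 ^ d) \<odot>\<^bsub>L\<^esub> q 0 = (1 - 2 ^ d) \<odot>\<^bsub>L\<^esub> \<zero>\<^bsub>L\<^esub>"
      using smult_rat_add_left[of "q 0" 1 "- (2 ^ d)"] by (simp add: \<eta>_def smult_rat_one smult_rat_zero_right)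
    moreover have "(1 - 2 ^ d :: rat) \<noteq> 0"
    proof -
      have "(1 :: rat) < 2 ^ d" using False by (intro one_less_power) auto
      then show ?thesis by linarith
    qed
    ultimately have "q 0 = \<zero>\<^bsub>L\<^esub>"
      using smult_rat_cancel[of "1 - 2 ^ d" "q 0" "\<zero>\<^bsub>L\<^esub>"] by simp
    then show ?thesis using False by (simp add: p power_0_left smult_rat_zero)
  qed
qed

text \<open>The algebraic substitute for letting t tend to 0.\<close>

lemma polynomial_eq_at_0:
  assumes p: "polynomial S p" and q: "polynomial S q" and eq: "\<And>t. t \<noteq> 0 \<Longrightarrow> p t = q t"
  shows "p 0 = q 0"
proof -
  note [simp] = polynomial_carrier[OF p] polynomial_carrier[OF q]
  have "polynomial S (\<lambda>t. p t \<oplus>\<^bsub>L\<^esub> (- 1) \<odot>\<^bsub>L\<^esub> q t)"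
    by (intro polynomial_add polynomial_smult assms)
  then obtain d where "poly_curve S d (\<lambda>t. p t \<oplus>\<^bsub>L\<^esub> (- 1) \<odot>\<^bsub>L\<^esub> q t)"
    by (auto simp: polynomial_def)
  then have "p 0 \<oplus>\<^bsub>L\<^esub> (- 1) \<odot>\<^bsub>L\<^esub> q 0 = \<zero>\<^bsub>L\<^esub>"
    by (rule poly_curve_vanish) (simp add: eq smult_rat_minus_one M.r_neg)
  then have "\<ominus>\<^bsub>L\<^esub> (\<ominus>\<^bsub>L\<^esub> q 0) = p 0"
    by (intro M.minus_equality) (simp_all add: smult_rat_minus_one)
  then show ?thesis by simp
qed

end

lemma polynomial_mono:
  assumes "S \<subseteq> T" "polynomial S p"
  shows "polynomial T p"
proof -
  from assms(2) obtain d where "poly_curve S d p" by (auto simp: polynomial_def)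
  then have "poly_curve T d p"
    by (induction rule: poly_curve.induct) (use assms(1) in \<open>auto intro: poly_curve.intros\<close>)
  then show ?thesis by (auto simp: polynomial_def)
qed

text \<open>Coefficients are tracked through three submodules because the descent along the lower
  central series has to know where brackets land.\<close>

lemma polynomial_bracket:
  assumes S: "submodule class_ring S L" and T: "submodule class_ring T L"
    and R: "submodule class_ring R L"
    and ST: "\<And>x y. x \<in> S \<Longrightarrow> y \<in> T \<Longrightarrow> bracket L x y \<in> R"
    and p: "polynomial S p" and q: "polynomial T q"
  shows "polynomial R (\<lambda>t. bracket L (p t) (q t))"
  using S p
proof (induction rule: polynomial_induct[consumes 2])
  case zero
  have "(\<lambda>t. bracket L \<zero>\<^bsub>L\<^esub> (q t)) = (\<lambda>t. \<zero>\<^bsub>L\<^esub>)"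
    using polynomial_carrier[OF T q] by (simp add: bracket_zero_left)
  then show ?case by (simp add: polynomial_zero[OF R])
next
  case (step p v d)
  note v = in_carrier[OF S step.hyps(2)]
  have *: "polynomial R (\<lambda>t. bracket L v (q t))"
    using T q
  proof (induction rule: polynomial_induct[consumes 2])
    case zero
    then show ?case using v by (simp add: bracket_zero_right polynomial_zero[OF R])
  next
    case (step q w e)
    have "(\<lambda>t. bracket L v (q t \<oplus>\<^bsub>L\<^esub> t ^ e \<odot>\<^bsub>L\<^esub> w)) = (\<lambda>t. bracket L v (q t) \<oplus>\<^bsub>L\<^esub> t ^ e \<odot>\<^bsub>L\<^esub> bracket L v w)"
      using polynomial_carrier[OF T step.hyps(1)] v in_carrier[OF T step.hyps(2)]
      by (simp add: bracket_add_right smult_rat_simps)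
    moreover have "bracket L v w \<in> R" using ST \<open>v \<in> S\<close> step.hyps(2) by blast
    ultimately show ?case using step
      by (simp add: polynomial_add[OF R] polynomial_monomial[OF R])
  qed
  have "(\<lambda>t. bracket L (p t \<oplus>\<^bsub>L\<^esub> t ^ d \<odot>\<^bsub>L\<^esub> v) (q t))
      = (\<lambda>t. bracket L (p t) (q t) \<oplus>\<^bsub>L\<^esub> t ^ d \<odot>\<^bsub>L\<^esub> bracket L v (q t))"
    using polynomial_carrier[OF S step.hyps(1)] v polynomial_carrier[OF T q]
    by (simp add: bracket_add_left smult_rat_simps)
  then show ?case
    using step * by (simp add: polynomial_add[OF R] polynomial_times_power[OF R])
qed

lemma polynomial_word_bracket:
  assumes S: "submodule class_ring S L" and R: "submodule class_ring R L"
    and SS: "\<And>x y. x \<in> S \<Longrightarrow> y \<in> S \<Longrightarrow> bracket L x y \<in> R" and RS: "R \<subseteq> S"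
    and p: "polynomial S p" and q: "polynomial S q"
  shows "w \<noteq> [] \<Longrightarrow> polynomial S (\<lambda>t. word_bracket (p t) (q t) w)"
    and "2 \<le> length w \<Longrightarrow> polynomial R (\<lambda>t. word_bracket (p t) (q t) w)"
proof -
  have "(w \<noteq> [] \<longrightarrow> polynomial S (\<lambda>t. word_bracket (p t) (q t) w)) \<and>
    (2 \<le> length w \<longrightarrow> polynomial R (\<lambda>t. word_bracket (p t) (q t) w))"
  proof (induction w)
    case (Cons a w)
    have a: "polynomial S (\<lambda>t. if a then q t else p t)" using p q by (cases a) simp_all
    show ?case
    proof (cases w)
      case Nil
      then show ?thesis using a by simp
    next
      case (Cons b u)
      then have "polynomial R (\<lambda>t. word_bracket (p t) (q t) (a # w))"
        using polynomial_bracket[OF S S R SS a] Cons.IH by simp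
      then show ?thesis using polynomial_mono[OF RS] by blast
    qed
  qed simp
  then show "w \<noteq> [] \<Longrightarrow> polynomial S (\<lambda>t. word_bracket (p t) (q t) w)"
    and "2 \<le> length w \<Longrightarrow> polynomial R (\<lambda>t. word_bracket (p t) (q t) w)"
    by auto
qed

text \<open>Every word of two or more letters involves a bracket, so its value stays in R. With
  consecutive terms of the lower central series as S and R, group multiplication is addition up to a
  deeper error.\<close>

lemma polynomial_bch_rest:
  assumes nilpotent
    and S: "submodule class_ring S L" and R: "submodule class_ring R L"
    and SS: "\<And>x y. x \<in> S \<Longrightarrow> y \<in> S \<Longrightarrow> bracket L x y \<in> R" and RS: "R \<subseteq> S"
    and p: "polynomial S p" and q: "polynomial S q"
  obtains r where "polynomial R r" "\<And>t. bch (p t) (q t) = (p t \<oplus>\<^bsub>L\<^esub> q t) \<oplus>\<^bsub>L\<^esub> r t"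
proof
  let ?N = "Suc nilpotency_class"
  let ?r = "\<lambda>t. \<Oplus>\<^bsub>L\<^esub>w\<in>{w. 2 \<le> length w \<and> length w \<le> ?N}.
     bch_term (p t) (q t) w"
  show "bch (p t) (q t) = (p t \<oplus>\<^bsub>L\<^esub> q t) \<oplus>\<^bsub>L\<^esub> ?r t" for t
    by (rule bch_split) (use assms(1) polynomial_carrier[OF S] p q in auto)
  show "polynomial R ?r"
  proof (rule polynomial_finsum[OF R])
    show "finite {w :: bool list. 2 \<le> length w \<and> length w \<le> ?N}"
      by (rule finite_subset[OF _ finite_words_le[of ?N]]) auto
    show "polynomial R (\<lambda>t. bch_term (p t) (q t) w)"
      if "w \<in> {w. 2 \<le> length w \<and> length w \<le> ?N}" for w
      using that by (intro polynomial_smult[OF R] polynomial_word_bracket(2)[OF S R SS RS p q]) auto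
  qed
qed

lemma polynomial_bch:
  assumes nilpotent "polynomial (carrier L) p" "polynomial (carrier L) q"
  shows "polynomial (carrier L) (\<lambda>t. bch (p t) (q t))"
proof -
  note C = carrier_submodule
  obtain r where "polynomial (carrier L) r" "\<And>t. bch (p t) (q t) = (p t \<oplus>\<^bsub>L\<^esub> q t) \<oplus>\<^bsub>L\<^esub> r t"
    using polynomial_bch_rest[OF assms(1) C C _ _ assms(2,3)] bracket_closed by blast
  then show ?thesis
    using assms by (simp add: polynomial_add[OF C])
qed

text \<open>Scaling x and y by t multiplies a word of n letters by t^n, so everything after x + y
  and [x, y] / 2 carries t^3 or more.\<close>

lemma bch_expansion:
  assumes nilpotent and x: "x \<in> carrier L" and y: "y \<in> carrier L"
  obtains r where "polynomial (carrier L) r" "r 0 = (1 / 2) \<odot>\<^bsub>L\<^esub> bracket L x y"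
    "\<And>t. bch (t \<odot>\<^bsub>L\<^esub> x) (t \<odot>\<^bsub>L\<^esub> y) = t \<odot>\<^bsub>L\<^esub> ((x \<oplus>\<^bsub>L\<^esub> y) \<oplus>\<^bsub>L\<^esub> t \<odot>\<^bsub>L\<^esub> r t)"
proof -
  \<comment> \<open>Two more than the class, so that all words of two letters are covered.\<close>
  let ?N = "Suc (Suc nilpotency_class)"
  let ?A = "{w :: bool list. 3 \<le> length w \<and> length w \<le> ?N}"
  let ?f = "\<lambda>w. bch_term x y w"
  define \<sigma> where "\<sigma> = (\<lambda>t. \<Oplus>\<^bsub>L\<^esub>w\<in>?A. t ^ (length w - 3) \<odot>\<^bsub>L\<^esub> ?f w)"
  define r where "r = (\<lambda>t. (1 / 2) \<odot>\<^bsub>L\<^esub> bracket L x y \<oplus>\<^bsub>L\<^esub> t \<odot>\<^bsub>L\<^esub> \<sigma> t)"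
  note C = carrier_submodule
  have f: "?f w \<in> carrier L" for w
    using x y by (simp add: smult_rat_closed word_bracket_closed)
  have \<sigma>: "polynomial (carrier L) \<sigma>"
    unfolding \<sigma>_def
  proof (rule polynomial_finsum[OF C])
    show "finite ?A" by (rule finite_subset[OF _ finite_words_le[of ?N]]) auto
  qed (rule polynomial_monomial[OF C f])
  note \<sigma>_closed = polynomial_carrier[OF C \<sigma>]
  have xy: "bracket L x y \<in> carrier L" using x y by (rule bracket_closed)
  show ?thesis
  proof
    show "polynomial (carrier L) r"
      unfolding r_def using polynomial_times_power[OF C \<sigma>, of 1] xy
      by (intro polynomial_add[OF C] polynomial_const[OF C]) (simp_all add: smult_rat_closed)
    show "r 0 = (1 / 2) \<odot>\<^bsub>L\<^esub> bracket L x y"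
      using xy \<sigma>_closed by (simp add: r_def smult_rat_simps)
    fix t
    have "bch (t \<odot>\<^bsub>L\<^esub> x) (t \<odot>\<^bsub>L\<^esub> y) = (t \<odot>\<^bsub>L\<^esub> x \<oplus>\<^bsub>L\<^esub> t \<odot>\<^bsub>L\<^esub> y) \<oplus>\<^bsub>L\<^esub> ((1 / 2) \<odot>\<^bsub>L\<^esub> bracket L (t \<odot>\<^bsub>L\<^esub> x) (t \<odot>\<^bsub>L\<^esub> y) \<oplus>\<^bsub>L\<^esub>
     (\<Oplus>\<^bsub>L\<^esub>w\<in>?A. bch_term (t \<odot>\<^bsub>L\<^esub> x) (t \<odot>\<^bsub>L\<^esub> y) w))"
      by (rule bch_split_2) (use assms in \<open>auto simp: smult_rat_closed\<close>)
    also have "(\<Oplus>\<^bsub>L\<^esub>w\<in>?A. bch_term (t \<odot>\<^bsub>L\<^esub> x) (t \<odot>\<^bsub>L\<^esub> y) w)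
        = (\<Oplus>\<^bsub>L\<^esub>w\<in>?A. t ^ 3 \<odot>\<^bsub>L\<^esub> (t ^ (length w - 3) \<odot>\<^bsub>L\<^esub> ?f w))"
    proof (rule M.finsum_cong'[OF refl])
      fix w :: "bool list" assume "w \<in> ?A"
      then have "t ^ length w = t ^ 3 * t ^ (length w - 3)" by (simp flip: power_add)
      then show "bch_term (t \<odot>\<^bsub>L\<^esub> x) (t \<odot>\<^bsub>L\<^esub> y) w
          = t ^ 3 \<odot>\<^bsub>L\<^esub> (t ^ (length w - 3) \<odot>\<^bsub>L\<^esub> ?f w)"
        using x y by (simp add: word_bracket_smult word_bracket_closed smult_rat_simps mult_ac)
    qed (use f in \<open>auto simp: smult_rat_closed\<close>)
    also have "\<dots> = t ^ 3 \<odot>\<^bsub>L\<^esub> \<sigma> t"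
      unfolding \<sigma>_def using f by (subst finsum_smult) (auto simp: smult_rat_closed)
    finally show "bch (t \<odot>\<^bsub>L\<^esub> x) (t \<odot>\<^bsub>L\<^esub> y) = t \<odot>\<^bsub>L\<^esub> ((x \<oplus>\<^bsub>L\<^esub> y) \<oplus>\<^bsub>L\<^esub> t \<odot>\<^bsub>L\<^esub> r t)"
      using x y xy \<sigma>_closed by (simp add: r_def smult_rat_simps power3_eq_cube mult_ac)
  qed
qed

end

text \<open>Two structures with the same group law and the same scalars, whose sums and brackets are
  to be compared. \<open>bch_cancel\<close> says that (-1) x is the group inverse of x.\<close>

locale common_bch_group = L1: rational_lie_algebra L1 + L2: rational_lie_algebra L2
  for L1 L2 :: "(rat, 'b) lie_alg" +
  assumes nilpotent_1: "L1.nilpotent" and nilpotent_2: "L2.nilpotent"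
    and carrier_eq: "carrier L2 = carrier L1"
    and bch_eq: "\<lbrakk>x \<in> carrier L1; y \<in> carrier L1\<rbrakk> \<Longrightarrow> L2.bch x y = L1.bch x y"
    and smult_eq: "x \<in> carrier L1 \<Longrightarrow> a \<odot>\<^bsub>L2\<^esub> x = a \<odot>\<^bsub>L1\<^esub> x"
    and bch_cancel: "\<lbrakk>x \<in> carrier L1; y \<in> carrier L1\<rbrakk> \<Longrightarrow> L1.bch x (L1.bch ((- 1) \<odot>\<^bsub>L1\<^esub> x) y) = y"
begin

lemma zero_eq: "\<zero>\<^bsub>L2\<^esub> = \<zero>\<^bsub>L1\<^esub>"
  using smult_eq[of "\<zero>\<^bsub>L1\<^esub>" 0] L1.smult_rat_zero L2.smult_rat_zero[of "\<zero>\<^bsub>L1\<^esub>"] carrier_eq by simp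

text \<open>A polynomial curve of \<open>L1\<close> is a product of curves \<open>t\<^sup>d v\<close> with respect to the group operation;
  the corrections lie further down in the lower central series.\<close>

lemma polynomial_transfer_step:
  assumes IH: "\<And>\<epsilon>. L1.polynomial (L1.lower_central_series (Suc j)) \<epsilon> \<Longrightarrow> L2.polynomial (carrier L1) \<epsilon>"
    and "L1.poly_curve (L1.lower_central_series j) d p" "L1.polynomial (L1.lower_central_series (Suc j)) \<epsilon>"
  shows "L2.polynomial (carrier L1) (\<lambda>t. p t \<oplus>\<^bsub>L1\<^esub> \<epsilon> t)"
  using assms(2,3)
proof (induction arbitrary: \<epsilon> rule: L1.poly_curve.induct)
  note R = L1.lower_central_series_submodule[of "Suc j"]
  case zero
  then show ?case using IH[OF zero] L1.polynomial_carrier[OF R zero] by simp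
next
  let ?S = "L1.lower_central_series j" and ?R = "L1.lower_central_series (Suc j)"
  note S = L1.lower_central_series_submodule[of j]
  note R = L1.lower_central_series_submodule[of "Suc j"]
  case (step d p v)
  note v = L1.in_carrier[OF S \<open>v \<in> ?S\<close>]
  have RS: "?R \<subseteq> ?S" by (rule L1.lower_central_series_decreasing)
  have SS: "bracket L1 x y \<in> ?R" if "x \<in> ?S" "y \<in> ?S" for x y
    using that L1.bracket_in_bracket_span[of ?S "carrier L1" x y] L1.lower_central_series_closed by auto
  have p: "L1.polynomial ?S p" using step.hyps by (auto simp: L1.polynomial_def)
  \<comment> \<open>The deeper error \<epsilon> is part of the claim because removing t^d v by group
    multiplication from the left creates a further error r of the same depth.\<close>
  define \<kappa> where "\<kappa> = (\<lambda>t. (p t \<oplus>\<^bsub>L1\<^esub> t ^ d \<odot>\<^bsub>L1\<^esub> v) \<oplus>\<^bsub>L1\<^esub> \<epsilon> t)"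
  have \<kappa>: "L1.polynomial ?S \<kappa>"
    unfolding \<kappa>_def using L1.polynomial_mono[OF RS] step
    by (intro L1.polynomial_add[OF S] p L1.polynomial_monomial[OF S]) auto
  have x: "L1.polynomial ?S (\<lambda>t. (- 1) \<odot>\<^bsub>L1\<^esub> (t ^ d \<odot>\<^bsub>L1\<^esub> v))"
    using step by (intro L1.polynomial_smult[OF S] L1.polynomial_monomial[OF S]) auto
  obtain r where r: "L1.polynomial ?R r"
    "\<And>t. L1.bch ((- 1) \<odot>\<^bsub>L1\<^esub> (t ^ d \<odot>\<^bsub>L1\<^esub> v)) (\<kappa> t)
       = ((- 1) \<odot>\<^bsub>L1\<^esub> (t ^ d \<odot>\<^bsub>L1\<^esub> v) \<oplus>\<^bsub>L1\<^esub> \<kappa> t) \<oplus>\<^bsub>L1\<^esub> r t"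
    using L1.polynomial_bch_rest[OF nilpotent_1 S R SS RS x \<kappa>] by blast
  note closed = L1.polynomial_carrier[OF S p] L1.polynomial_carrier[OF R r(1)]
    L1.polynomial_carrier[OF R step.prems] L1.polynomial_carrier[OF S \<kappa>] v L1.smult_rat_closed
  define \<kappa>' where "\<kappa>' = (\<lambda>t. p t \<oplus>\<^bsub>L1\<^esub> (\<epsilon> t \<oplus>\<^bsub>L1\<^esub> r t))"
  have \<kappa>': "L2.polynomial (carrier L1) \<kappa>'"
    unfolding \<kappa>'_def by (intro step.IH L1.polynomial_add[OF R] step.prems r)
  have bch: "L1.bch ((- 1) \<odot>\<^bsub>L1\<^esub> (t ^ d \<odot>\<^bsub>L1\<^esub> v)) (\<kappa> t) = \<kappa>' t" for t
  proof -
    let ?x = "t ^ d \<odot>\<^bsub>L1\<^esub> v"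
    have "((- 1) \<odot>\<^bsub>L1\<^esub> ?x \<oplus>\<^bsub>L1\<^esub> \<kappa> t) = (\<ominus>\<^bsub>L1\<^esub> ?x \<oplus>\<^bsub>L1\<^esub> ?x) \<oplus>\<^bsub>L1\<^esub> (p t \<oplus>\<^bsub>L1\<^esub> \<epsilon> t)"
      using closed
      by (simp add: \<kappa>_def L1.smult_rat_minus_one L1.M.a_assoc L1.M.a_comm L1.M.add.m_lcomm del: L1.M.r_neg1)
    then show ?thesis
      using closed by (simp add: r(2) \<kappa>'_def L1.M.l_neg L1.M.a_assoc)
  qed
  \<comment> \<open>Multiplying back with \<open>L2.bch\<close> exhibits the curve as a group
    product of two curves that are polynomial for \<open>L2\<close>.\<close>
  have "\<kappa> t = L2.bch (t ^ d \<odot>\<^bsub>L2\<^esub> v) (\<kappa>' t)" for t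
  proof -
    have "\<kappa>' t \<in> carrier L1" using closed by (simp add: \<kappa>'_def)
    moreover have "\<kappa> t = L1.bch (t ^ d \<odot>\<^bsub>L1\<^esub> v) (\<kappa>' t)"
      unfolding bch[symmetric] using closed by (simp add: bch_cancel)
    ultimately show ?thesis using closed by (simp add: smult_eq bch_eq)
  qed
  moreover have "L2.polynomial (carrier L1) (\<lambda>t. L2.bch (t ^ d \<odot>\<^bsub>L2\<^esub> v) (\<kappa>' t))"
    using L2.polynomial_bch[OF nilpotent_2] L2.polynomial_monomial[OF L2.carrier_submodule] \<kappa>' v
    by (simp add: carrier_eq)
  ultimately show ?case by (simp add: \<kappa>_def fun_eq_iff)
qed

lemma polynomial_transfer:
  assumes "L1.polynomial (carrier L1) p"
  shows "L2.polynomial (carrier L1) p"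
proof -
  obtain n where n: "L1.lower_central_series n = {\<zero>\<^bsub>L1\<^esub>}"
    using nilpotent_1 by (auto simp: L1.nilpotent_def)
  have "L1.polynomial (L1.lower_central_series j) p \<Longrightarrow> L2.polynomial (carrier L1) p" if "j \<le> n" for j p
    using that
  proof (induction j arbitrary: p rule: inc_induct)
    case base
    have "p t = \<zero>\<^bsub>L2\<^esub>" for t
      using L1.polynomial_closed[OF L1.lower_central_series_submodule base, of t] n zero_eq by simp
    then have "p = (\<lambda>t. \<zero>\<^bsub>L2\<^esub>)" by auto
    then show ?case
      using L2.polynomial_zero[OF L2.carrier_submodule] carrier_eq by simp
  next
    case (step j)
    note S = L1.lower_central_series_submodule[of j]
    note R = L1.lower_central_series_submodule[of "Suc j"]
    from step.prems obtain d where "L1.poly_curve (L1.lower_central_series j) d p"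
      by (auto simp: L1.polynomial_def)
    from polynomial_transfer_step[OF step.IH this L1.polynomial_zero[OF R]]
    show ?case using L1.polynomial_carrier[OF S step.prems] by simp
  qed
  from this[of 0] assms show ?thesis by simp
qed

lemma bch_expansions:
  assumes x: "x \<in> carrier L1" and y: "y \<in> carrier L1"
  obtains r1 r2 where "L1.polynomial (carrier L1) r1" "r1 0 = (1 / 2) \<odot>\<^bsub>L1\<^esub> bracket L1 x y"
    "L2.polynomial (carrier L2) r2" "r2 0 = (1 / 2) \<odot>\<^bsub>L2\<^esub> bracket L2 x y"
    "\<And>t. t \<noteq> 0 \<Longrightarrow>
       (x \<oplus>\<^bsub>L1\<^esub> y) \<oplus>\<^bsub>L1\<^esub> t \<odot>\<^bsub>L1\<^esub> r1 t = (x \<oplus>\<^bsub>L2\<^esub> y) \<oplus>\<^bsub>L2\<^esub> t \<odot>\<^bsub>L2\<^esub> r2 t"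
proof -
  have x2: "x \<in> carrier L2" and y2: "y \<in> carrier L2" using x y carrier_eq by auto
  note C1 = L1.carrier_submodule and C2 = L2.carrier_submodule
  obtain r1 where r1: "L1.polynomial (carrier L1) r1" "r1 0 = (1 / 2) \<odot>\<^bsub>L1\<^esub> bracket L1 x y"
    "\<And>t. L1.bch (t \<odot>\<^bsub>L1\<^esub> x) (t \<odot>\<^bsub>L1\<^esub> y) = t \<odot>\<^bsub>L1\<^esub> ((x \<oplus>\<^bsub>L1\<^esub> y) \<oplus>\<^bsub>L1\<^esub> t \<odot>\<^bsub>L1\<^esub> r1 t)"
    using L1.bch_expansion[OF nilpotent_1 x y] by blast
  obtain r2 where r2: "L2.polynomial (carrier L2) r2" "r2 0 = (1 / 2) \<odot>\<^bsub>L2\<^esub> bracket L2 x y"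
    "\<And>t. L2.bch (t \<odot>\<^bsub>L2\<^esub> x) (t \<odot>\<^bsub>L2\<^esub> y) = t \<odot>\<^bsub>L2\<^esub> ((x \<oplus>\<^bsub>L2\<^esub> y) \<oplus>\<^bsub>L2\<^esub> t \<odot>\<^bsub>L2\<^esub> r2 t)"
    using L2.bch_expansion[OF nilpotent_2 x2 y2] by blast
  note closed = L1.polynomial_carrier[OF C1 r1(1)] L2.polynomial_carrier[OF C2 r2(1)]
    L1.smult_rat_closed L2.smult_rat_closed x y x2 y2
  let ?p1 = "\<lambda>t. (x \<oplus>\<^bsub>L1\<^esub> y) \<oplus>\<^bsub>L1\<^esub> t \<odot>\<^bsub>L1\<^esub> r1 t" and ?p2 = "\<lambda>t. (x \<oplus>\<^bsub>L2\<^esub> y) \<oplus>\<^bsub>L2\<^esub> t \<odot>\<^bsub>L2\<^esub> r2 t"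
  have p1: "?p1 t \<in> carrier L1" and p2: "?p2 t \<in> carrier L1" for t
    using closed by (simp_all add: carrier_eq[symmetric]) (simp_all add: carrier_eq)
  have "?p1 t = ?p2 t" if "t \<noteq> 0" for t
  proof (rule L1.smult_rat_cancel[OF that p1 p2])
    have "t \<odot>\<^bsub>L1\<^esub> ?p1 t = L1.bch (t \<odot>\<^bsub>L1\<^esub> x) (t \<odot>\<^bsub>L1\<^esub> y)" by (rule r1(3)[symmetric])
    also have "\<dots> = L2.bch (t \<odot>\<^bsub>L2\<^esub> x) (t \<odot>\<^bsub>L2\<^esub> y)"
      using x y by (simp add: bch_eq smult_eq L1.smult_rat_closed)
    also have "\<dots> = t \<odot>\<^bsub>L2\<^esub> ?p2 t" by (rule r2(3))
    also have "\<dots> = t \<odot>\<^bsub>L1\<^esub> ?p2 t" by (rule smult_eq[OF p2])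
    finally show "t \<odot>\<^bsub>L1\<^esub> ?p1 t = t \<odot>\<^bsub>L1\<^esub> ?p2 t" .
  qed
  with that r1 r2 show ?thesis by blast
qed

text \<open>For t different from 0, dividing the group product of tx and ty by t gives the same
  element in both algebras. Both expansions are polynomial for \<open>L2\<close>, so they also agree
  at t = 0.\<close>

lemma add_eq:
  assumes x: "x \<in> carrier L1" and y: "y \<in> carrier L1"
  shows "x \<oplus>\<^bsub>L2\<^esub> y = x \<oplus>\<^bsub>L1\<^esub> y"
proof -
  have x2: "x \<in> carrier L2" and y2: "y \<in> carrier L2" using x y carrier_eq by auto
  note C1 = L1.carrier_submodule and C2 = L2.carrier_submodule
  obtain r1 r2 where r1: "L1.polynomial (carrier L1) r1" and r2: "L2.polynomial (carrier L2) r2"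
    and eq: "\<And>t. t \<noteq> 0 \<Longrightarrow>
       (x \<oplus>\<^bsub>L1\<^esub> y) \<oplus>\<^bsub>L1\<^esub> t \<odot>\<^bsub>L1\<^esub> r1 t = (x \<oplus>\<^bsub>L2\<^esub> y) \<oplus>\<^bsub>L2\<^esub> t \<odot>\<^bsub>L2\<^esub> r2 t"
    using bch_expansions[OF x y] by metis
  have p1: "L1.polynomial (carrier L1) (\<lambda>t. (x \<oplus>\<^bsub>L1\<^esub> y) \<oplus>\<^bsub>L1\<^esub> t \<odot>\<^bsub>L1\<^esub> r1 t)"
    using x y L1.polynomial_times_power[OF C1 r1, of 1]
    by (intro L1.polynomial_add[OF C1] L1.polynomial_const[OF C1]) simp_all
  have p2: "L2.polynomial (carrier L2) (\<lambda>t. (x \<oplus>\<^bsub>L2\<^esub> y) \<oplus>\<^bsub>L2\<^esub> t \<odot>\<^bsub>L2\<^esub> r2 t)"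
    using x2 y2 L2.polynomial_times_power[OF C2 r2, of 1]
    by (intro L2.polynomial_add[OF C2] L2.polynomial_const[OF C2]) simp_all
  have "(x \<oplus>\<^bsub>L1\<^esub> y) \<oplus>\<^bsub>L1\<^esub> 0 \<odot>\<^bsub>L1\<^esub> r1 0 = (x \<oplus>\<^bsub>L2\<^esub> y) \<oplus>\<^bsub>L2\<^esub> 0 \<odot>\<^bsub>L2\<^esub> r2 0"
    by (rule L2.polynomial_eq_at_0[OF C2 _ p2 eq])
      (use polynomial_transfer[OF p1] carrier_eq in simp_all)
  then show ?thesis
    using x y x2 y2 L1.polynomial_carrier[OF C1 r1] L2.polynomial_carrier[OF C2 r2]
    by (simp add: L1.smult_rat_zero L2.smult_rat_zero)
qed

text \<open>Once the sums are known to agree they cancel, and a further division by t leaves curves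
  whose value at 0 is half the bracket.\<close>

lemma bracket_eq:
  assumes x: "x \<in> carrier L1" and y: "y \<in> carrier L1"
  shows "bracket L2 x y = bracket L1 x y"
proof -
  have x2: "x \<in> carrier L2" and y2: "y \<in> carrier L2" using x y carrier_eq by auto
  note C1 = L1.carrier_submodule and C2 = L2.carrier_submodule
  obtain r1 r2 where r1: "L1.polynomial (carrier L1) r1" "r1 0 = (1 / 2) \<odot>\<^bsub>L1\<^esub> bracket L1 x y"
    and r2: "L2.polynomial (carrier L2) r2" "r2 0 = (1 / 2) \<odot>\<^bsub>L2\<^esub> bracket L2 x y"
    and eq: "\<And>t. t \<noteq> 0 \<Longrightarrow>
       (x \<oplus>\<^bsub>L1\<^esub> y) \<oplus>\<^bsub>L1\<^esub> t \<odot>\<^bsub>L1\<^esub> r1 t = (x \<oplus>\<^bsub>L2\<^esub> y) \<oplus>\<^bsub>L2\<^esub> t \<odot>\<^bsub>L2\<^esub> r2 t"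
    using bch_expansions[OF x y] by metis
  have c1: "r1 t \<in> carrier L1" and c2: "r2 t \<in> carrier L1" for t
    using L1.polynomial_carrier[OF C1 r1(1)] L2.polynomial_carrier[OF C2 r2(1)] carrier_eq by auto
  have eq': "r1 t = r2 t" if "t \<noteq> 0" for t
  proof (rule L1.smult_rat_cancel[OF that c1 c2])
    show "t \<odot>\<^bsub>L1\<^esub> r1 t = t \<odot>\<^bsub>L1\<^esub> r2 t"
      using eq[OF that] x y c1[of t] c2[of t] by (simp add: add_eq smult_eq L1.smult_rat_closed)
  qed
  have b: "bracket L1 x y \<in> carrier L1" "bracket L2 x y \<in> carrier L1"
    using x y x2 y2 L1.bracket_closed L2.bracket_closed carrier_eq by auto
  have "r1 0 = r2 0"
    by (rule L2.polynomial_eq_at_0[OF C2 _ r2(1) eq'])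
      (use polynomial_transfer[OF r1(1)] carrier_eq in simp_all)
  then have "(1 / 2) \<odot>\<^bsub>L1\<^esub> bracket L2 x y = (1 / 2) \<odot>\<^bsub>L1\<^esub> bracket L1 x y"
    using b by (simp add: r1(2) r2(2) smult_eq)
  then show ?thesis using L1.smult_rat_cancel[of "1 / 2" "bracket L2 x y" "bracket L1 x y"] b by simp
qed

lemma lie_isomorphism_id: "lie_isomorphism (class_ring :: rat ring) L1 L2 id"
  by unfold_locales (simp_all add: carrier_eq add_eq bracket_eq smult_eq bij_betw_def)

end

section \<open>Truncated polynomial vector fields\<close>

text \<open>A sequence \<open>f\<close> supported in \<open>{a..<c}\<close> stands for the vector field
  \<open>\<Sum>f\<^sub>i t\<^sup>i\<^sup>+\<^sup>1 d/dt\<close> modulo \<open>t\<^sup>c\<^sup>+\<^sup>1\<close>. The bracket is the negative of the commutator of derivations, since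
  composition of substitutions corresponds to the reversed composition of the induced algebra
  homomorphisms.\<close>

definition field_space :: "nat \<Rightarrow> nat \<Rightarrow> (nat \<Rightarrow> rat) set" where
  "field_space a c = {f. \<forall>i. f i \<noteq> 0 \<longrightarrow> a \<le> i \<and> i < c}"

definition field_bracket :: "nat \<Rightarrow> (nat \<Rightarrow> rat) \<Rightarrow> (nat \<Rightarrow> rat) \<Rightarrow> nat \<Rightarrow> rat" where
  "field_bracket c f g n =
     (if n < c then \<Sum>i\<le>n. (of_nat i - of_nat (n - i)) * f i * g (n - i) else 0)"

definition field_alg :: "nat \<Rightarrow> nat \<Rightarrow> (rat, nat \<Rightarrow> rat) lie_alg" where
  "field_alg a c = \<lparr>carrier = field_space a c, monoid.mult = undefined, one = undefined, zero = (\<lambda>i. 0),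
     add = (\<lambda>f g i. f i + g i), module.smult = (\<lambda>q f i. q * f i), bracket = field_bracket c\<rparr>"

definition field_poly :: "nat \<Rightarrow> (nat \<Rightarrow> rat) \<Rightarrow> rat poly" where
  "field_poly c f = (\<Sum>i<c. monom (f i) (Suc i))"

lemma field_space_eq_0: "f \<in> field_space a c \<Longrightarrow> \<not> (a \<le> i \<and> i < c) \<Longrightarrow> f i = 0"
  unfolding field_space_def by blast

lemma field_space_add:
  assumes "f \<in> field_space a c" "g \<in> field_space a c"
  shows "(\<lambda>i. f i + g i) \<in> field_space a c"
  unfolding field_space_def
proof (intro CollectI allI impI)
  fix i assume "f i + g i \<noteq> 0"
  then have "f i \<noteq> 0 \<or> g i \<noteq> 0" by auto
  then show "a \<le> i \<and> i < c" using assms by (auto simp: field_space_def)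
qed

lemma field_space_smult: "f \<in> field_space a c \<Longrightarrow> (\<lambda>i. q * f i) \<in> field_space a c"
  by (auto simp: field_space_def)

lemma field_space_zero: "(\<lambda>i. 0) \<in> field_space a c"
  by (simp add: field_space_def)

lemma field_alg_simps [simp]:
  "carrier (field_alg a c) = field_space a c" "\<zero>\<^bsub>field_alg a c\<^esub> = (\<lambda>i. 0)"
  "f \<oplus>\<^bsub>field_alg a c\<^esub> g = (\<lambda>i. f i + g i)" "q \<odot>\<^bsub>field_alg a c\<^esub> f = (\<lambda>i. q * f i)"
  "bracket (field_alg a c) = field_bracket c"
  by (simp_all add: field_alg_def)

lemma coeff_field_poly: "coeff (field_poly c f) n = (if 1 \<le> n \<and> n \<le> c then f (n - 1) else 0)"
proof -
  have "coeff (field_poly c f) n = (\<Sum>i<c. if Suc i = n then f i else 0)"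
    by (simp add: field_poly_def coeff_sum)
  also have "\<dots> = (\<Sum>i<c. if i = n - 1 then (if 1 \<le> n then f i else 0) else 0)"
    by (intro sum.cong) auto
  finally show ?thesis by (cases n) auto
qed

lemma field_poly_add: "field_poly c (\<lambda>i. f i + g i) = field_poly c f + field_poly c g"
  by (simp add: field_poly_def add_monom[symmetric] sum.distrib)

lemma field_poly_smult: "field_poly c (\<lambda>i. q * f i) = Polynomial.smult q (field_poly c f)"
  by (rule poly_eqI) (simp add: coeff_field_poly)

lemma field_poly_zero: "field_poly c (\<lambda>i. 0) = 0"
  by (simp add: field_poly_def)

lemma field_poly_inj:
  assumes "f \<in> field_space a c" "g \<in> field_space b c" "field_poly c f = field_poly c g"
  shows "f = g"
proof
  fix i
  have "coeff (field_poly c f) (Suc i) = coeff (field_poly c g) (Suc i)" using assms(3) by simp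
  then show "f i = g i"
    using field_space_eq_0[OF assms(1), of i] field_space_eq_0[OF assms(2), of i]
    by (cases "i < c") (auto simp: coeff_field_poly)
qed

text \<open>The commutator of the derivations F d/dt and G d/dt is minus this polynomial times
  d/dt.\<close>

definition wronskian :: "rat poly \<Rightarrow> rat poly \<Rightarrow> rat poly" where
  "wronskian F G = pderiv F * G - F * pderiv G"

lemma field_bracket_eq_coeff:
  assumes "n < c"
  shows "field_bracket c f g n = coeff (wronskian (field_poly c f) (field_poly c g)) (Suc n)"
proof -
  have coeff: "coeff (pderiv (field_poly c f) * field_poly c g) (Suc n)
      = (\<Sum>i\<le>n. of_nat (Suc i) * f i * g (n - i))" for f g
    \<comment> \<open>The last index \<open>Suc n\<close> of the convolution meets the vanishing
      constant term of the second factor.\<close>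
    unfolding coeff_mult using assms
    by (subst sum.atMost_Suc) (auto simp: coeff_pderiv coeff_field_poly Suc_diff_le intro!: sum.cong)
  have "(\<Sum>i\<le>n. of_nat (Suc i) * g i * f (n - i)) = (\<Sum>i\<le>n. of_nat (Suc (n - i)) * g (n - i) * f i)"
    by (rule sum.reindex_bij_witness[of _ "\<lambda>i. n - i" "\<lambda>i. n - i"]) auto
  then have "coeff (wronskian (field_poly c f) (field_poly c g)) (Suc n)
      = (\<Sum>i\<le>n. of_nat (Suc i) * f i * g (n - i)) - (\<Sum>i\<le>n. of_nat (Suc (n - i)) * g (n - i) * f i)"
    unfolding wronskian_def coeff_diff mult.commute[of "field_poly c f" "pderiv (field_poly c g)"]
    by (simp only: coeff)
  also have "\<dots> = (\<Sum>i\<le>n. (of_nat i - of_nat (n - i)) * f i * g (n - i))"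
    unfolding sum_subtractf[symmetric] by (intro sum.cong refl) (simp add: left_diff_distrib distrib_right)
  finally show ?thesis using assms by (simp only: field_bracket_def if_True)
qed

lemma monom_dvd_pderiv:
  fixes p :: "rat poly"
  shows "monom 1 (Suc n) dvd p \<Longrightarrow> monom 1 n dvd pderiv p"
  by (simp add: monom_1_dvd_iff' coeff_pderiv)

abbreviation tpow :: "nat \<Rightarrow> rat poly" where
  "tpow c \<equiv> monom 1 (Suc c)"

lemma cong_tpow_iff: "[p = q] (mod tpow c) \<longleftrightarrow> (\<forall>i\<le>c. coeff p i = coeff q i)"
  by (auto simp: cong_iff_dvd_diff monom_1_dvd_iff' less_Suc_eq_le)

text \<open>Differentiation loses one power of t; a factor F without constant term restores
  it.\<close>

lemma cong_mult_pderiv: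
  assumes "[p = q] (mod tpow c)" "coeff F 0 = 0"
  shows "[F * pderiv p = F * pderiv q] (mod tpow c)"
proof -
  have "monom 1 1 dvd F" using assms(2) by (simp add: monom_1_dvd_iff')
  moreover have "monom 1 c dvd pderiv (p - q)"
    using assms(1) by (intro monom_dvd_pderiv) (simp add: cong_iff_dvd_diff)
  ultimately have "monom 1 1 * monom 1 c dvd F * pderiv (p - q)" by (rule mult_dvd_mono)
  then show ?thesis
    by (simp add: cong_iff_dvd_diff mult_monom pderiv_diff right_diff_distrib)
qed

lemma cong_wronskian:
  assumes "[F = F'] (mod tpow c)" "[G = G'] (mod tpow c)" "coeff F 0 = 0" "coeff G' 0 = 0"
  shows "[wronskian F G = wronskian F' G'] (mod tpow c)"
proof -
  have "[G * pderiv F = G' * pderiv F] (mod tpow c)" "[G' * pderiv F = G' * pderiv F'] (mod tpow c)"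
    "[F * pderiv G = F * pderiv G'] (mod tpow c)" "[F * pderiv G' = F' * pderiv G'] (mod tpow c)"
    using assms by (auto intro: cong_mult cong_mult_pderiv)
  then show ?thesis
    unfolding wronskian_def mult.commute[of "pderiv F"] mult.commute[of "pderiv F'"]
    by (intro cong_diff) (blast intro: cong_trans)+
qed

lemma coeff_0_field_poly [simp]: "coeff (field_poly c f) 0 = 0"
  by (simp add: coeff_field_poly)

lemma coeff_0_wronskian: "coeff F 0 = 0 \<Longrightarrow> coeff G 0 = 0 \<Longrightarrow> coeff (wronskian F G) 0 = 0"
  by (simp add: wronskian_def coeff_mult)

lemma cong_field_poly_bracket:
  "[field_poly c (field_bracket c f g) = wronskian (field_poly c f) (field_poly c g)] (mod tpow c)"
  unfolding cong_tpow_iff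
proof (intro allI impI)
  fix i assume "i \<le> c"
  then show "coeff (field_poly c (field_bracket c f g)) i
      = coeff (wronskian (field_poly c f) (field_poly c g)) i"
    by (cases i) (auto simp: coeff_0_wronskian coeff_field_poly field_bracket_eq_coeff)
qed

lemma cong_field_poly_bracket2:
  "[field_poly c (field_bracket c f (field_bracket c g h))
     = wronskian (field_poly c f) (wronskian (field_poly c g) (field_poly c h))] (mod tpow c)"
  using cong_field_poly_bracket
  by (rule cong_trans) (auto intro!: cong_wronskian cong_field_poly_bracket coeff_0_wronskian)

lemma wronskian_jacobi:
  "wronskian F (wronskian G H) + wronskian G (wronskian H F) + wronskian H (wronskian F G) = 0"
  by (simp add: wronskian_def pderiv_diff pderiv_mult algebra_simps)

text \<open>Degrees add. For x = y the degree 2x could come only from i = n - i = x, where the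
  factor i - (n - i) vanishes; hence 2x + 1.\<close>

lemma field_space_bracket:
  assumes "f \<in> field_space x c" "g \<in> field_space y c"
  shows "field_bracket c f g \<in> field_space (if x = y then 2 * x + 1 else x + y) c"
  unfolding field_space_def
proof (intro CollectI allI impI)
  fix n assume *: "field_bracket c f g n \<noteq> 0"
  then have n: "n < c" and "(\<Sum>i\<le>n. (of_nat i - of_nat (n - i)) * f i * g (n - i)) \<noteq> 0"
    by (auto simp: field_bracket_def split: if_splits)
  then obtain i where "i \<le> n" "(of_nat i - of_nat (n - i)) * f i * g (n - i) \<noteq> 0"
    by (meson atMost_iff sum.neutral)
  then have "i \<le> n" "i \<noteq> n - i" "f i \<noteq> 0" "g (n - i) \<noteq> 0" by auto
  then have "x \<le> i" "y \<le> n - i" "i \<le> n" "i \<noteq> n - i" using assms by (auto simp: field_space_def)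
  then show "(if x = y then 2 * x + 1 else x + y) \<le> n \<and> n < c" using n by auto
qed

lemma field_space_mono: "a \<le> b \<Longrightarrow> field_space b c \<subseteq> field_space a c"
  by (auto simp: field_space_def)

lemma field_space_bracket_closed:
  assumes "f \<in> field_space a c" "g \<in> field_space a c"
  shows "field_bracket c f g \<in> field_space a c"
  using field_space_bracket[OF assms] field_space_mono[of a "2 * a + 1" c] by auto

lemma lie_algebra_field_alg: "lie_algebra (class_ring :: rat ring) (field_alg a c)"
proof -
  have "vectorspace (class_ring :: rat ring) (field_alg a c)"
  proof (rule vs_criteria)
    show "field (class_ring :: rat ring)" by (rule class_field)
    show "\<forall>v\<in>carrier (field_alg a c). \<exists>w\<in>carrier (field_alg a c). v \<oplus>\<^bsub>field_alg a c\<^esub> w = \<zero>\<^bsub>field_alg a c\<^esub>"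
    proof
      fix v assume "v \<in> carrier (field_alg a c)"
      then have "(\<lambda>i. - v i) \<in> field_space a c" by (simp add: field_space_def)
      then show "\<exists>w\<in>carrier (field_alg a c). v \<oplus>\<^bsub>field_alg a c\<^esub> w = \<zero>\<^bsub>field_alg a c\<^esub>"
        by (intro bexI[of _ "\<lambda>i. - v i"]) simp_all
    qed
  qed (auto simp: field_space_add field_space_smult field_space_zero algebra_simps)
  then interpret vectorspace "class_ring :: rat ring" "field_alg a c" .
  show ?thesis
  proof unfold_locales
    fix f g h and q :: rat
    assume f: "f \<in> carrier (field_alg a c)"
    show "bracket (field_alg a c) f f = \<zero>\<^bsub>field_alg a c\<^esub>"
    proof
      fix n show "bracket (field_alg a c) f f n = \<zero>\<^bsub>field_alg a c\<^esub> n"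
        by (cases "n < c") (simp_all add: field_bracket_eq_coeff wronskian_def, simp add: field_bracket_def)
    qed
    assume g: "g \<in> carrier (field_alg a c)"
    show "bracket (field_alg a c) f g \<in> carrier (field_alg a c)"
      using f g by (simp add: field_space_bracket_closed)
    assume h: "h \<in> carrier (field_alg a c)"
    let ?b = "field_bracket c"
    let ?J = "\<lambda>i. ?b f (?b g h) i + ?b g (?b h f) i + ?b h (?b f g) i"
    \<comment> \<open>The Jacobi identity holds exactly for \<open>wronskian\<close> and passes to
      the truncation by congruence; \<open>field_poly\<close> has no coefficients above c.\<close>
    have "[field_poly c ?J = 0] (mod tpow c)"
      unfolding field_poly_add
      by (rule cong_trans[OF cong_add[OF cong_add]]; (rule cong_field_poly_bracket2)?)
        (simp add: wronskian_jacobi)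
    then have "coeff (field_poly c ?J) i = 0" for i
      by (cases "i \<le> c") (auto simp: cong_tpow_iff coeff_field_poly)
    then have "field_poly c ?J = field_poly c (\<lambda>i. 0)"
      by (simp add: poly_eq_iff field_poly_zero)
    moreover have "?J \<in> field_space a c"
      using f g h by (simp add: field_space_add field_space_bracket_closed)
    ultimately have "?J = (\<lambda>i. 0)" using field_space_zero by (intro field_poly_inj)
    then show "bracket (field_alg a c) f (bracket (field_alg a c) g h)
        \<oplus>\<^bsub>field_alg a c\<^esub> bracket (field_alg a c) g (bracket (field_alg a c) h f)
        \<oplus>\<^bsub>field_alg a c\<^esub> bracket (field_alg a c) h (bracket (field_alg a c) f g) = \<zero>\<^bsub>field_alg a c\<^esub>"
      by simp
  qed (auto simp: field_bracket_def fun_eq_iff algebra_simps sum.distrib sum_distrib_left sum_subtractf)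
qed

lemma rational_lie_algebra_field_alg: "rational_lie_algebra (field_alg a c)"
  by (simp add: rational_lie_algebra_def lie_algebra_field_alg)

section \<open>The basis vectors e_i and the derived and lower central series\<close>

definition unit_field :: "nat \<Rightarrow> nat \<Rightarrow> rat" where
  "unit_field i n = of_bool (n = i)"

lemma unit_field_in_space: "a \<le> i \<Longrightarrow> i < c \<Longrightarrow> unit_field i \<in> field_space a c"
  by (simp add: unit_field_def field_space_def)

lemma field_bracket_unit:
  assumes "i + j < c"
  shows "field_bracket c (unit_field i) (unit_field j) = (\<lambda>n. (of_nat i - of_nat j) * unit_field (i + j) n)"
proof
  fix n
  have "(\<Sum>k\<le>n. (of_nat k - of_nat (n - k)) * unit_field i k * unit_field j (n - k))
      = (\<Sum>k\<le>n. if k = i then (if n = i + j then of_nat i - of_nat j else 0) else 0)"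
    by (intro sum.cong refl) (auto simp: unit_field_def)
  also have "\<dots> = (of_nat i - of_nat j) * unit_field (i + j) n"
    by (auto simp: unit_field_def)
  finally show "field_bracket c (unit_field i) (unit_field j) n = (of_nat i - of_nat j) * unit_field (i + j) n"
    using assms by (auto simp: field_bracket_def unit_field_def)
qed

lemma field_space_eq_zero_iff: "field_space x c = {\<lambda>i. 0} \<longleftrightarrow> c \<le> x"
proof
  assume "field_space x c = {\<lambda>i. 0}"
  moreover have "unit_field x \<noteq> (\<lambda>i. 0)" by (auto simp: unit_field_def fun_eq_iff)
  ultimately show "c \<le> x" using unit_field_in_space[of x x c] by (metis le_refl not_le singletonD)
next
  assume "c \<le> x"
  then show "field_space x c = {\<lambda>i. 0}" by (auto simp: field_space_def fun_eq_iff) force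
qed

text \<open>The lowest coefficient is removed with a multiple of a basis vector, by downward
  induction on the lower bound of the support.\<close>

lemma field_space_subset_submodule:
  assumes S: "submodule (class_ring :: rat ring) S (field_alg a c)"
    and unit: "\<And>i. b \<le> i \<Longrightarrow> i < c \<Longrightarrow> unit_field i \<in> S"
  shows "field_space b c \<subseteq> S"
proof (cases "b \<le> c")
  case True
  interpret S: submodule "class_ring :: rat ring" S "field_alg a c" by (rule S)
  have "f \<in> field_space x c \<Longrightarrow> b \<le> x \<Longrightarrow> f \<in> S" if "x \<le> c" for f x
    using that
  proof (induction x arbitrary: f rule: inc_induct)
    case base
    then have "f = (\<lambda>i. 0)" using field_space_eq_zero_iff[of c c] by auto
    then show ?case using S.zero_closed by simp
  next
    case (step x)
    let ?g = "\<lambda>i. f i - f x * unit_field x i"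
    have "?g \<in> field_space (Suc x) c"
      using step.prems by (auto simp: field_space_def unit_field_def le_less Suc_le_eq)
    then have "?g \<in> S" using step by simp
    moreover have "(\<lambda>i. f x * unit_field x i) \<in> S"
      using S.smult_closed[of "f x" "unit_field x"] unit[of x] step by simp
    ultimately have "(\<lambda>i. ?g i + f x * unit_field x i) \<in> S"
      using S.m_closed[of ?g "\<lambda>i. f x * unit_field x i"] by (simp only: field_alg_simps)
    moreover have "(\<lambda>i. ?g i + f x * unit_field x i) = f" by auto
    ultimately show ?case by (simp only:)
  qed
  then show ?thesis using True by auto
next
  case False
  then have "field_space b c = {\<lambda>i. 0}" by (simp add: field_space_eq_zero_iff)
  then show ?thesis
    using submodule.zero_closed[OF S] by simp
qed

context
  fixes a c :: nat
begin

interpretation F: rational_lie_algebra "field_alg a c"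
  by (rule rational_lie_algebra_field_alg)

lemma field_space_submodule:
  "a \<le> b \<Longrightarrow> submodule (class_ring :: rat ring) (field_space b c) (field_alg a c)"
  unfolding submodule_def
  using F.module_axioms field_space_mono[of a b c] 
  by (auto intro: field_space_add field_space_smult field_space_zero)

text \<open>The bracket of e_i and e_j is (i - j) times the wanted vector, and i - j is
  invertible.\<close>

lemma unit_field_in_bracket_span:
  assumes "field_space x c \<subseteq> field_space a c" "field_space y c \<subseteq> field_space a c"
    and "x \<le> i" "y \<le> j" "i \<noteq> j" "i + j < c"
  shows "unit_field (i + j) \<in> F.bracket_span (field_space x c) (field_space y c)"
proof -
  let ?B = "F.bracket_span (field_space x c) (field_space y c)"
  interpret B: submodule "class_ring :: rat ring" ?B "field_alg a c"
    by (rule F.bracket_span_submodule) (use assms in auto)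
  have "field_bracket c (unit_field i) (unit_field j) \<in> ?B"
    using F.bracket_in_bracket_span[of "field_space x c" "field_space y c" "unit_field i" "unit_field j"] assms
    by (simp add: unit_field_in_space)
  from B.smult_closed[OF _ this, of "1 / (of_nat i - of_nat j)"]
  show ?thesis
    using assms by (simp add: field_bracket_unit)
qed

lemma bracket_span_field_space:
  assumes "a \<le> x"
  shows "F.bracket_span (field_space x c) (field_space x c) = field_space (2 * x + 1) c"
proof
  note x = field_space_mono[OF assms, of c]
  show "F.bracket_span (field_space x c) (field_space x c) \<subseteq> field_space (2 * x + 1) c"
    by (rule F.bracket_span_subset[OF field_space_submodule])
      (use assms field_space_bracket[of _ x c _ x] in auto)
  show "field_space (2 * x + 1) c \<subseteq> F.bracket_span (field_space x c) (field_space x c)"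
  proof (rule field_space_subset_submodule[of _ a])
    show "submodule (class_ring :: rat ring)
        (F.bracket_span (field_space x c) (field_space x c)) (field_alg a c)"
      by (rule F.bracket_span_submodule) (use x in auto)
    fix i assume "2 * x + 1 \<le> i" "i < c"
    \<comment> \<open>The vector e_i comes from e_x and e_(i - x); the bound 2x + 1 keeps the two
      indices distinct.\<close>
    then show "unit_field i \<in> F.bracket_span (field_space x c) (field_space x c)"
      using unit_field_in_bracket_span[OF x x, of x "i - x"] by simp
  qed
qed

text \<open>Each step sends the lower bound x to 2x + 1, that is, doubles x + 1.\<close>

lemma derived_series_field_alg:
  "F.derived_series n = field_space (2 ^ n * (a + 1) - 1) c"
proof (induction n)
  case (Suc n)
  have "1 * (a + 1) \<le> 2 ^ n * (a + 1)" by (rule mult_right_mono) simp_all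
  then have "a \<le> 2 ^ n * (a + 1) - 1"
    and "2 * (2 ^ n * (a + 1) - 1) + 1 = 2 * (2 ^ n * (a + 1)) - 1" by auto
  then show ?case
    using bracket_span_field_space[of "2 ^ n * (a + 1) - 1"] Suc by (simp add: mult.assoc)
qed simp

lemma dim_field_alg: "a \<le> c \<Longrightarrow> F.fin_dim \<and> F.dim = c - a"
proof -
  assume "a \<le> c"
  let ?E = "unit_field ` {a..<c}"
  have E: "?E \<subseteq> carrier (field_alg a c)" by (auto simp: unit_field_in_space)
  have inj: "inj_on unit_field A" for A
  proof (rule inj_onI)
    fix i j assume "unit_field i = unit_field j"
    then have "unit_field i i = unit_field j i" by simp
    then show "i = j" by (simp add: unit_field_def)
  qed
  have gen: "F.span ?E = carrier (field_alg a c)"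
  proof
    show "F.span ?E \<subseteq> carrier (field_alg a c)" by (rule F.span_is_subset2[OF E])
    have "field_space a c \<subseteq> F.span ?E"
    proof (rule field_space_subset_submodule[OF F.span_is_submodule[OF E]])
      show "unit_field i \<in> F.span ?E" if "a \<le> i" "i < c" for i
        using F.in_own_span[OF E] that by auto
    qed
    then show "carrier (field_alg a c) \<subseteq> F.span ?E" by simp
  qed
  have apply_finsum: "(\<Oplus>\<^bsub>field_alg a c\<^esub>f\<in>A. g f) n = (\<Sum>f\<in>A. g f n)"
    if "g \<in> A \<rightarrow> field_space a c" for A n and g :: "(nat \<Rightarrow> rat) \<Rightarrow> nat \<Rightarrow> rat"
    using that by (induction A rule: infinite_finite_induct) (auto simp: Pi_iff)
  have indpt: "F.lin_indpt ?E"
  proof (rule F.finite_lin_indpt2)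
    fix q assume "F.lincomb q ?E = \<zero>\<^bsub>field_alg a c\<^esub>"
    then have *: "(\<Oplus>\<^bsub>field_alg a c\<^esub>f\<in>?E. q f \<odot>\<^bsub>field_alg a c\<^esub> f) n = 0" for n
      by (simp add: F.lincomb_def fun_eq_iff)
    have "q (unit_field i) = 0" if "i \<in> {a..<c}" for i
    proof -
      have "0 = (\<Sum>f\<in>?E. (q f \<odot>\<^bsub>field_alg a c\<^esub> f) i)"
        by (subst apply_finsum[symmetric]) (use E *[of i] in \<open>auto simp: field_space_def\<close>)
      also have "\<dots> = (\<Sum>j\<in>{a..<c}. if j = i then q (unit_field j) else 0)"
      proof (subst sum.reindex[OF inj], rule sum.cong[OF refl])
        show "((\<lambda>f. (q f \<odot>\<^bsub>field_alg a c\<^esub> f) i) \<circ> unit_field) j = (if j = i then q (unit_field j) else 0)" for j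
        proof (cases "j = i")
          case True
          then show ?thesis using unit_field_def[of i i] by simp
        next
          case False
          then show ?thesis using unit_field_def[of j i] by simp
        qed
      qed
      finally show ?thesis using that by simp
    qed
    then show "\<forall>v\<in>?E. q v = \<zero>\<^bsub>class_ring\<^esub>" by simp
  qed (use E in auto)
  have "F.basis ?E" using gen indpt E by (simp add: F.basis_def)
  then have "F.dim = card ?E" by (intro F.dim_basis) auto
  moreover have "F.fin_dim" using gen E by (auto simp: F.fin_dim_def)
  ultimately show ?thesis by (simp add: card_image[OF inj])
qed

lemma solvable_field_alg:
  assumes "c \<le> 2 ^ n * (a + 1) - 1" "\<And>m. m < n \<Longrightarrow> 2 ^ m * (a + 1) - 1 < c"
  shows "F.solvable \<and> F.derived_length = n"
proof -
  have iff: "F.derived_series m = {\<zero>\<^bsub>field_alg a c\<^esub>} \<longleftrightarrow> c \<le> 2 ^ m * (a + 1) - 1" for m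
    by (simp add: derived_series_field_alg field_space_eq_zero_iff)
  have "F.derived_length = n"
    unfolding F.derived_length_def iff
    by (rule Least_equality) (use assms in \<open>auto simp: not_le[symmetric]\<close>)
  then show ?thesis using assms(1) iff by (auto simp: F.solvable_def)
qed

end

text \<open>The first step loses e_2 together with e_1, because only [e_1, e_1] = 0 could produce
  it. Afterwards [e_(i-1), e_1] = (i - 2) e_i raises the bound by exactly one.\<close>

lemma lower_central_series_field_alg:
  "lie_algebra.lower_central_series class_ring (field_alg 1 c) (Suc n) = field_space (n + 3) c"
proof -
  interpret F: rational_lie_algebra "field_alg 1 c"
    by (rule rational_lie_algebra_field_alg)
  show ?thesis
  proof (induction n)
    case 0
    show ?case using bracket_span_field_space[of 1 1 c] by (simp del: One_nat_def)
  next
    case (Suc n)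
    have x: "field_space (n + 3) c \<subseteq> field_space 1 c" by (rule field_space_mono) simp
    have "F.bracket_span (field_space (n + 3) c) (field_space 1 c) = field_space (n + 4) c"
    proof
      show "F.bracket_span (field_space (n + 3) c) (field_space 1 c) \<subseteq> field_space (n + 4) c"
        by (rule F.bracket_span_subset[OF field_space_submodule])
          (use field_space_bracket[of _ "n + 3" c _ 1] in \<open>auto simp: add.commute simp del: One_nat_def\<close>)
      show "field_space (n + 4) c \<subseteq> F.bracket_span (field_space (n + 3) c) (field_space 1 c)"
      proof (rule field_space_subset_submodule[of _ 1])
        show "submodule (class_ring :: rat ring)
            (F.bracket_span (field_space (n + 3) c) (field_space 1 c)) (field_alg 1 c)"
          by (rule F.bracket_span_submodule) (use x in auto)
        fix i assume i: "n + 4 \<le> i" "i < c"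
        then show "unit_field i \<in> F.bracket_span (field_space (n + 3) c) (field_space 1 c)"
          using unit_field_in_bracket_span[OF x order.refl, of "i - 1" 1] by simp
      qed
    qed
    then show ?case using Suc by (simp add: add.commute del: One_nat_def)
  qed
qed

text \<open>Term n of the series starts at e_(n+2) for n >= 1, so it first vanishes at n = c - 2,
  one less than the dimension c - 1.\<close>

lemma
  assumes "4 \<le> c"
  shows nilpotent_field_alg: "lie_algebra.nilpotent class_ring (field_alg 1 c)"
    and filiform_field_alg: "lie_algebra.filiform class_ring (field_alg 1 c)"
proof -
  interpret F: rational_lie_algebra "field_alg 1 c"
    by (rule rational_lie_algebra_field_alg)
  have iff: "F.lower_central_series n = {\<zero>\<^bsub>field_alg 1 c\<^esub>} \<longleftrightarrow> c - 2 \<le> n" for n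
  proof (cases n)
    case 0
    have "\<not> c \<le> 1" using assms by simp
    then show ?thesis using assms 0 by (simp add: field_space_eq_zero_iff del: One_nat_def)
  next
    case (Suc m)
    show ?thesis
      unfolding Suc lower_central_series_field_alg using assms by (auto simp: field_space_eq_zero_iff)
  qed
  show nil: F.nilpotent unfolding F.nilpotent_def iff by blast
  have "F.nilpotency_class = c - 2"
    unfolding F.nilpotency_class_def iff by (rule Least_equality) auto
  then show F.filiform
    using nil dim_field_alg[of 1 c] assms unfolding F.filiform_def by linarith
qed

section \<open>Exponentials of polynomial vector fields\<close>

text \<open>Remainders modulo t^(c+1) serve as representatives, so that nilpotency and exponentials
  are statements about polynomials rather than residue classes.\<close>

definition field_op :: "nat \<Rightarrow> (nat \<Rightarrow> rat) \<Rightarrow> rat poly \<Rightarrow> rat poly" where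
  "field_op c f p = (field_poly c f * pderiv p) mod tpow c"

lemma cong_field_op: "[field_op c f p = field_poly c f * pderiv p] (mod tpow c)"
  by (simp add: field_op_def)

lemma field_op_add: "field_op c f (p + q) = field_op c f p + field_op c f q"
  by (simp add: field_op_def pderiv_add distrib_left poly_mod_add_left)

lemma field_op_smult: "field_op c f (Polynomial.smult a p) = Polynomial.smult a (field_op c f p)"
  by (simp add: field_op_def pderiv_smult mod_smult_left)

lemma field_op_add_field: "field_op c (\<lambda>i. f i + g i) p = field_op c f p + field_op c g p"
  by (simp add: field_op_def field_poly_add distrib_right poly_mod_add_left)

lemma field_op_smult_field: "field_op c (\<lambda>i. a * f i) p = Polynomial.smult a (field_op c f p)"
  by (simp add: field_op_def field_poly_smult mod_smult_left)

lemma field_op_minus_field: "field_op c (\<lambda>i. - f i) p = - field_op c f p"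
  using field_op_smult_field[of c "- 1" f p] by simp

lemma field_op_zero_field: "field_op c (\<lambda>i. 0) p = 0"
  by (simp add: field_op_def field_poly_zero)

lemma field_op_zero: "field_op c f 0 = 0"
  by (simp add: field_op_def)

lemma field_op_sum: "field_op c f (\<Sum>i\<in>A. p i) = (\<Sum>i\<in>A. field_op c f (p i))"
  by (induction A rule: infinite_finite_induct) (simp_all add: field_op_add field_op_zero)

lemma field_op_cong: "[p = q] (mod tpow c) \<Longrightarrow> field_op c f p = field_op c f q"
  using cong_mult_pderiv[of p q c "field_poly c f"] by (simp add: field_op_def cong_def)

lemma field_op_commutator:
  "field_op c f (field_op c g p) - field_op c g (field_op c f p) = - field_op c (field_bracket c f g) p"
proof -
  let ?F = "field_poly c f" and ?G = "field_poly c g"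
  have *: "field_op c f (field_op c g p) = (field_poly c f * pderiv (field_poly c g * pderiv p)) mod tpow c"
    for f g
    using field_op_cong[OF cong_field_op] by (simp add: field_op_def)
  have "field_op c f (field_op c g p) - field_op c g (field_op c f p)
      = (?F * pderiv (?G * pderiv p) - ?G * pderiv (?F * pderiv p)) mod tpow c"
    by (simp add: * poly_mod_diff_left)
  also have "?F * pderiv (?G * pderiv p) - ?G * pderiv (?F * pderiv p) = - (wronskian ?F ?G * pderiv p)"
    by (simp add: wronskian_def pderiv_mult algebra_simps)
  also have "\<dots> mod tpow c = - ((wronskian ?F ?G * pderiv p) mod tpow c)"
    by (simp add: poly_mod_minus_left)
  also have "(wronskian ?F ?G * pderiv p) mod tpow c = field_op c (field_bracket c f g) p"
    using cong_mult[OF cong_field_poly_bracket cong_refl, of c f g "pderiv p"]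
    by (simp add: field_op_def cong_def)
  finally show ?thesis .
qed

lemma tpow_dvd_field_poly: "f \<in> field_space 1 c \<Longrightarrow> monom 1 2 dvd field_poly c f"
  by (auto simp: monom_1_dvd_iff' coeff_field_poly less_2_cases_iff intro: field_space_eq_0)

lemma monom_dvd_monom: "m \<le> n \<Longrightarrow> monom (1 :: rat) m dvd monom 1 n"
  by (metis le_add_diff_inverse mult_monom dvd_triv_left mult_1)

text \<open>The field is divisible by t^2 and differentiation costs one power, a net gain of one.
  The minimum with \<open>Suc c\<close> appears because orders are visible only up to the
  modulus.\<close>

lemma field_op_raises:
  assumes "f \<in> field_space 1 c" "monom 1 (min m (Suc c)) dvd p"
  shows "monom 1 (min (Suc m) (Suc c)) dvd field_op c f p"
proof -
  let ?k = "min m c"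
  have "monom 1 ?k dvd monom (1 :: rat) (min m (Suc c))" by (rule monom_dvd_monom) auto
  then have p: "monom 1 ?k dvd p" using assms(2) by (rule dvd_trans)
  have "monom 1 (Suc ?k) dvd field_poly c f * pderiv p"
  proof (cases ?k)
    case 0
    have "monom (1 :: rat) 1 dvd monom 1 2" by (rule monom_dvd_monom) simp
    then have "monom 1 1 dvd field_poly c f"
      using tpow_dvd_field_poly[OF assms(1)] by (rule dvd_trans)
    then show ?thesis using 0 by (simp add: dvd_mult2)
  next
    case (Suc j)
    then have "monom 1 j dvd pderiv p" using p by (intro monom_dvd_pderiv) simp
    from mult_dvd_mono[OF tpow_dvd_field_poly[OF assms(1)] this]
    show ?thesis by (simp add: mult_monom Suc)
  qed
  moreover have "monom 1 (Suc ?k) dvd monom (1 :: rat) (Suc c)" by (rule monom_dvd_monom) simp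
  ultimately show ?thesis
    unfolding field_op_def by (simp add: dvd_mod)
qed

lemma field_op_iterate_dvd:
  assumes "f \<in> field_space 1 c" "monom 1 k dvd p"
  shows "monom 1 (min (n + k) (Suc c)) dvd (field_op c f ^^ n) p"
proof (induction n)
  case 0
  have "monom (1 :: rat) (min k (Suc c)) dvd monom 1 k" by (rule monom_dvd_monom) simp
  then show ?case using assms(2) by (auto intro: dvd_trans)
next
  case (Suc n)
  then show ?case using field_op_raises[OF assms(1), of "n + k"] by simp
qed

lemma nilpotent_pair_field_op:
  assumes "f \<in> field_space 1 c" "g \<in> field_space 1 c"
  shows "nilpotent_pair Polynomial.smult (field_op c f) (field_op c g) c"
proof -
  interpret V: vector_space "Polynomial.smult :: rat \<Rightarrow> rat poly \<Rightarrow> rat poly"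
    by unfold_locales (simp_all add: smult_add_right smult_add_left)
  have dvd: "monom 1 (min (length w) (Suc c)) dvd word_op (field_op c f) (field_op c g) w p" for w p
    by (induction w) (use assms field_op_raises in auto)
  have "word_op (field_op c f) (field_op c g) w p = 0" if w: "c < length w" for w p
  proof -
    let ?q = "word_op (field_op c f) (field_op c g) w p"
    \<comment> \<open>A non-empty word yields a remainder modulo t^(c+1), and a remainder divisible
      by the modulus is 0.\<close>
    have "?q mod tpow c = ?q" using w by (cases w) (simp_all add: field_op_def)
    moreover have "min (length w) (Suc c) = Suc c" using w by simp
    then have "tpow c dvd ?q" using dvd[of w p] by simp
    ultimately show ?thesis by (simp add: mod_eq_0_iff_dvd[symmetric])
  qed
  then show ?thesis
    by unfold_locales (simp_all add: field_op_add field_op_smult)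
qed

definition field_exp :: "nat \<Rightarrow> (nat \<Rightarrow> rat) \<Rightarrow> rat poly \<Rightarrow> rat poly" where
  "field_exp c f p = truncated_exp Polynomial.smult c (field_op c f) p"

context
  fixes c :: nat
  assumes c: "4 \<le> c"
  notes [simp del] = One_nat_def
begin

interpretation F: rational_lie_algebra "field_alg 1 c"
  by (rule rational_lie_algebra_field_alg)

text \<open>\<open>field_op_commutator\<close> takes the bracket to minus the commutator; negating
  the fields turns this into a homomorphism.\<close>

lemma commutator_field_op:
  "commutator_op (field_op c (\<lambda>i. - f i)) (field_op c (\<lambda>i. - g i)) w p
     = field_op c (\<lambda>i. - F.word_bracket f g w i) p"
proof (induction w arbitrary: p)
  case Nil
  then show ?case by (simp add: field_op_zero_field)
next
  case (Cons a w)
  show ?case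
  proof (cases w)
    case Nil
    then show ?thesis by (cases a) simp_all
  next
    case (Cons b v)
    let ?z = "if a then g else f" and ?y = "F.word_bracket f g w"
    have "commutator_op (field_op c (\<lambda>i. - f i)) (field_op c (\<lambda>i. - g i)) (a # w) p
        = field_op c (\<lambda>i. - ?z i) (field_op c (\<lambda>i. - ?y i) p) - field_op c (\<lambda>i. - ?y i) (field_op c (\<lambda>i. - ?z i) p)"
      using Cons.IH Cons by (cases a) simp_all
    also have "\<dots> = field_op c ?z (field_op c ?y p) - field_op c ?y (field_op c ?z p)"
      using field_op_smult[of c _ "- 1"] by (simp add: field_op_minus_field)
    also have "\<dots> = field_op c (\<lambda>i. - field_bracket c ?z ?y i) p"
      by (simp add: field_op_commutator field_op_minus_field)
    finally show ?thesis using Cons by (cases a) simp_all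
  qed
qed

lemma field_op_finsum:
  assumes "h \<in> A \<rightarrow> field_space 1 c"
  shows "field_op c (\<Oplus>\<^bsub>field_alg 1 c\<^esub>w\<in>A. h w) p = (\<Sum>w\<in>A. field_op c (h w) p)"
  using assms
proof (induction A rule: infinite_finite_induct)
  case (insert w A)
  then have "(\<Oplus>\<^bsub>field_alg 1 c\<^esub>w\<in>insert w A. h w) = (\<lambda>i. h w i + (\<Oplus>\<^bsub>field_alg 1 c\<^esub>w\<in>A. h w) i)"
    by (subst F.M.finsum_insert) auto
  then have "field_op c (\<Oplus>\<^bsub>field_alg 1 c\<^esub>w\<in>insert w A. h w) p
      = field_op c (h w) p + field_op c (\<Oplus>\<^bsub>field_alg 1 c\<^esub>w\<in>A. h w) p"
    by (simp only: field_op_add_field)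
  then show ?case
    using insert by (simp add: Pi_iff)
qed (simp_all add: field_op_zero_field)

lemma bch_closed:
  assumes "f \<in> field_space 1 c" "g \<in> field_space 1 c"
  shows "F.bch f g \<in> field_space 1 c"
proof -
  have "F.bch f g \<in> carrier (field_alg 1 c)"
    unfolding F.bch_def
    by (intro F.M.finsum_closed Pi_I F.smult_rat_closed F.word_bracket_closed) (use assms in simp_all)
  then show ?thesis by simp
qed

lemma field_space_minus: "f \<in> field_space a c \<Longrightarrow> (\<lambda>i. - f i) \<in> field_space a c"
  by (simp add: field_space_def)

text \<open>Sending f to the operator of -f respects brackets, so Dynkin's form of the series for f
  and g becomes the evaluation of log (exp x exp y) at two operators, whose exponential is the
  product of theirs.\<close>

lemma field_exp_bch_minus:
  assumes f: "f \<in> field_space 1 c" and g: "g \<in> field_space 1 c"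
  shows "field_exp c (\<lambda>i. - F.bch f g i) p = field_exp c (\<lambda>i. - f i) (field_exp c (\<lambda>i. - g i) p)"
proof -
  let ?X = "field_op c (\<lambda>i. - f i)" and ?Y = "field_op c (\<lambda>i. - g i)"
  let ?W = "{w. w \<noteq> [] \<and> length w \<le> c}"
  interpret P: nilpotent_pair Polynomial.smult ?X ?Y c
    by (rule nilpotent_pair_field_op) (use f g in \<open>simp_all only: field_space_minus\<close>)
  \<comment> \<open>The operator sums run over words of up to c letters, so the sum defining
    \<open>bch\<close> is extended from the class to c.\<close>
  have "F.nilpotency_class \<le> c"
  proof -
    have "F.nilpotency_class = F.dim - 1" using filiform_field_alg[OF c] by (simp only: F.filiform_def)
    also have "\<dots> \<le> c" using dim_field_alg[of 1 c] c by (simp)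
    finally show ?thesis .
  qed
  then have bch: "F.bch f g = (\<Oplus>\<^bsub>field_alg 1 c\<^esub>w\<in>?W.
      (bch_series w / of_nat (length w)) \<odot>\<^bsub>field_alg 1 c\<^esub> F.word_bracket f g w)"
    using f g nilpotent_field_alg[OF c] by (intro F.bch_eq) simp_all
  have "P.ev bch_series q = field_op c (\<lambda>i. - F.bch f g i) q" for q
  proof -
    have "P.ev bch_series q
        = (\<Sum>w\<in>?W. Polynomial.smult (bch_series w / of_nat (length w)) (commutator_op ?X ?Y w q))"
      by (rule P.ev_bch)
    also have "\<dots> = - (\<Sum>w\<in>?W. field_op c ((bch_series w / of_nat (length w)) \<odot>\<^bsub>field_alg 1 c\<^esub> F.word_bracket f g w) q)"
      by (simp only: field_alg_simps field_op_minus_field field_op_smult_field commutator_field_op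
          smult_minus_right sum_negf)
    also have "(\<Sum>w\<in>?W. field_op c ((bch_series w / of_nat (length w)) \<odot>\<^bsub>field_alg 1 c\<^esub> F.word_bracket f g w) q)
        = field_op c (F.bch f g) q"
      unfolding bch
    proof (rule field_op_finsum[symmetric], rule Pi_I)
      show "a \<odot>\<^bsub>field_alg 1 c\<^esub> F.word_bracket f g w \<in> field_space 1 c" for a w
        using F.smult_rat_closed[OF F.word_bracket_closed, of f g a w] f g by (simp only: field_alg_simps(1))
    qed
    also have "- \<dots> = field_op c (\<lambda>i. - F.bch f g i) q"
      by (simp only: field_op_minus_field)
    finally show ?thesis .
  qed
  then have "P.ev bch_series = field_op c (\<lambda>i. - F.bch f g i)" by auto
  then show ?thesis using P.exp_ev_bch[of p] by (simp only: field_exp_def)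
qed

lemma field_exp_zero_field: "field_exp c (\<lambda>i. 0) p = p"
proof -
  have "(field_op c (\<lambda>i. 0) ^^ n) p = (if n = 0 then p else 0)" for n
    by (cases n) (simp_all add: field_op_zero_field)
  then have "field_exp c (\<lambda>i. 0) p = (\<Sum>n\<le>c. if n = 0 then p else 0)"
    unfolding field_exp_def truncated_exp_def by (intro sum.cong) auto
  then show ?thesis by simp
qed

lemma bch_minus_self:
  assumes "f \<in> field_space 1 c"
  shows "F.bch (\<lambda>i. - f i) f = (\<lambda>i. 0)"
  using F.bch_collinear[OF nilpotent_field_alg[OF c], of f "- 1" 1] assms by simp

lemma field_exp_minus_cancel:
  assumes "f \<in> field_space 1 c"
  shows "field_exp c f (field_exp c (\<lambda>i. - f i) p) = p"
  using field_exp_bch_minus[OF field_space_minus[OF assms] assms, of p]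
  by (simp add: bch_minus_self assms field_exp_zero_field)

text \<open>Taking inverses in the identity for -f and -g reverses the order of the exponentials, as
  composition of substitutions requires.\<close>

lemma field_exp_bch:
  assumes f: "f \<in> field_space 1 c" and g: "g \<in> field_space 1 c"
  shows "field_exp c (F.bch f g) p = field_exp c g (field_exp c f p)"
proof -
  let ?q = "field_exp c g (field_exp c f p)"
  have "field_exp c (\<lambda>i. - F.bch f g i) ?q
      = field_exp c (\<lambda>i. - f i) (field_exp c (\<lambda>i. - g i) ?q)"
    by (rule field_exp_bch_minus[OF f g])
  also have "field_exp c (\<lambda>i. - g i) ?q = field_exp c f p"
    using field_exp_minus_cancel[OF field_space_minus[OF g]] by simp
  also have "field_exp c (\<lambda>i. - f i) (field_exp c f p) = p"
    using field_exp_minus_cancel[OF field_space_minus[OF f]] by simp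
  finally show ?thesis
    using field_exp_minus_cancel[OF bch_closed[OF f g], of ?q] by simp
qed

end

subsection \<open>Exponentials are algebra homomorphisms\<close>

lemma cong_smult: "[p = q] (mod tpow c) \<Longrightarrow> [Polynomial.smult a p = Polynomial.smult a q] (mod tpow c)"
  by (simp add: cong_tpow_iff)

lemma smult_sum_right: "Polynomial.smult a (\<Sum>i\<in>A. p i) = (\<Sum>i\<in>A. Polynomial.smult a (p i))"
  by (induction A rule: infinite_finite_induct) (simp_all add: smult_add_right)

text \<open>With the factorials absorbed, the Leibniz rule is a convolution without binomial
  coefficients.\<close>

definition divided_power :: "nat \<Rightarrow> (nat \<Rightarrow> rat) \<Rightarrow> nat \<Rightarrow> rat poly \<Rightarrow> rat poly" where
  "divided_power c f n p = Polynomial.smult (1 / fact n) ((field_op c f ^^ n) p)"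

lemma field_exp_eq: "field_exp c f p = (\<Sum>n\<le>c. divided_power c f n p)"
  by (simp add: field_exp_def truncated_exp_def divided_power_def)

lemma field_op_divided_power:
  "field_op c f (divided_power c f n p) = Polynomial.smult (of_nat (Suc n)) (divided_power c f (Suc n) p)"
  by (simp add: divided_power_def field_op_smult field_simps del: of_nat_Suc)

lemma cong_field_op_mult:
  "[field_op c f (p * q) = field_op c f p * q + p * field_op c f q] (mod tpow c)"
proof -
  have "[field_op c f (p * q) = field_poly c f * pderiv (p * q)] (mod tpow c)"
    by (rule cong_field_op)
  also have "field_poly c f * pderiv (p * q) = (field_poly c f * pderiv p) * q + p * (field_poly c f * pderiv q)"
    by (simp add: pderiv_mult algebra_simps)
  also have "[\<dots> = field_op c f p * q + p * field_op c f q] (mod tpow c)"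
    by (intro cong_add cong_mult cong_refl cong_sym[OF cong_field_op])
  finally show ?thesis .
qed

lemma cong_divided_power_mult:
  "[divided_power c f n (p * q) = (\<Sum>i\<le>n. divided_power c f i p * divided_power c f (n - i) q)] (mod tpow c)"
proof (induction n)
  case 0
  then show ?case by (simp add: divided_power_def)
next
  case (Suc n)
  let ?d = "divided_power c f"
  let ?U = "\<Sum>i\<le>n. field_op c f (?d i p * ?d (n - i) q)"
  let ?T = "\<Sum>i\<le>n. field_op c f (?d i p) * ?d (n - i) q + ?d i p * field_op c f (?d (n - i) q)"
  let ?C = "\<Sum>i\<le>n. Polynomial.smult (of_nat (Suc i)) (?d (Suc i) p * ?d (Suc n - Suc i) q)"
  let ?D = "\<Sum>i\<le>n. Polynomial.smult (of_nat (Suc n - i)) (?d i p * ?d (Suc n - i) q)"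
  let ?C' = "\<Sum>i\<le>Suc n. Polynomial.smult (of_nat i) (?d i p * ?d (Suc n - i) q)"
  let ?D' = "\<Sum>i\<le>Suc n. Polynomial.smult (of_nat (Suc n - i)) (?d i p * ?d (Suc n - i) q)"
  let ?S = "\<Sum>i\<le>Suc n. ?d i p * ?d (Suc n - i) q"
  have "Polynomial.smult (of_nat (Suc n)) (?d (Suc n) (p * q)) = field_op c f (?d n (p * q))"
    by (simp only: field_op_divided_power)
  also have "\<dots> = ?U"
    by (simp only: field_op_cong[OF Suc] field_op_sum)
  finally have 1: "Polynomial.smult (of_nat (Suc n)) (?d (Suc n) (p * q))
      = ?U" .
  have 2: "[?U = ?T] (mod tpow c)"
    by (intro cong_sum cong_field_op_mult)
  \<comment> \<open>The aim is the factor n + 1 = i + (n + 1 - i): the part i collects the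
    derivatives falling on p, the other part those falling on q.\<close>
  have "?T
      = ?C
      + ?D"
    unfolding sum.distrib[symmetric]
    by (intro sum.cong refl)
      (simp only: atMost_iff field_op_divided_power mult_smult_left mult_smult_right diff_Suc_Suc Suc_diff_le)
  also have "?C
      = ?C'"
    by (subst sum.atMost_Suc_shift) simp
  also have "?D
      = ?D'"
    by (subst sum.atMost_Suc) simp
  also have "?C'
      + ?D'
      = (\<Sum>i\<le>Suc n. Polynomial.smult (of_nat (Suc n)) (?d i p * ?d (Suc n - i) q))"
    unfolding sum.distrib[symmetric] smult_add_left[symmetric]
    by (intro sum.cong refl arg_cong2[where f = Polynomial.smult]) (simp add: of_nat_diff)
  also have "\<dots> = Polynomial.smult (of_nat (Suc n)) ?S"
    by (rule smult_sum_right[symmetric])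
  finally have "[Polynomial.smult (of_nat (Suc n)) (?d (Suc n) (p * q)) = Polynomial.smult (of_nat (Suc n)) ?S] (mod tpow c)"
    using 2 by (simp only: 1)
  then have "[Polynomial.smult (1 / of_nat (Suc n)) (Polynomial.smult (of_nat (Suc n)) (?d (Suc n) (p * q)))
      = Polynomial.smult (1 / of_nat (Suc n)) (Polynomial.smult (of_nat (Suc n)) ?S)] (mod tpow c)"
    by (rule cong_smult)
  then show ?case by (simp del: of_nat_Suc sum.atMost_Suc)
qed

lemma divided_power_dvd:
  assumes "f \<in> field_space 1 c" "monom 1 k dvd p"
  shows "monom 1 (min (n + k) (Suc c)) dvd divided_power c f n p"
  unfolding divided_power_def by (rule dvd_smult) (rule field_op_iterate_dvd[OF assms])

lemma cong_field_exp_mult: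
  assumes f: "f \<in> field_space 1 c"
  shows "[field_exp c f (p * q) = field_exp c f p * field_exp c f q] (mod tpow c)"
proof -
  let ?d = "divided_power c f"
  let ?A = "{..c} \<times> {..c}" and ?B = "{(i, j). i + j \<le> c}"
  have BA: "?B \<subseteq> ?A" by auto
  have "[field_exp c f (p * q) = (\<Sum>n\<le>c. \<Sum>i\<le>n. ?d i p * ?d (n - i) q)] (mod tpow c)"
    unfolding field_exp_eq by (intro cong_sum cong_divided_power_mult)
  also have "(\<Sum>n\<le>c. \<Sum>i\<le>n. ?d i p * ?d (n - i) q) = (\<Sum>(i, j)\<in>?B. ?d i p * ?d j q)"
    by (rule sum.triangle_reindex_eq[symmetric])
  \<comment> \<open>Pairs with i + j > c contribute multiples of t^(c+1), since the i-th divided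
    power is divisible by t^i; so triangle and square agree modulo t^(c+1).\<close>
  also have "[\<dots> = (\<Sum>(i, j)\<in>?A. ?d i p * ?d j q)] (mod tpow c)"
  proof -
    have "tpow c dvd (\<Sum>(i, j)\<in>?A - ?B. ?d i p * ?d j q)"
    proof (rule dvd_sum)
      fix x assume x: "x \<in> ?A - ?B"
      obtain i j where ij: "x = (i, j)" by (rule prod.exhaust)
      with x have "i \<le> c" "j \<le> c" "\<not> i + j \<le> c" by auto
      have "monom 1 i dvd ?d i p" "monom 1 j dvd ?d j q"
        using divided_power_dvd[OF f, of 0 _ i] divided_power_dvd[OF f, of 0 _ j] \<open>i \<le> c\<close> \<open>j \<le> c\<close>
        by (simp_all add: min_def)
      then have "monom 1 (i + j) dvd ?d i p * ?d j q"
        using mult_dvd_mono[of "monom 1 i" "?d i p" "monom 1 j" "?d j q"] by (simp add: mult_monom)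
      moreover have "monom (1 :: rat) (Suc c) dvd monom 1 (i + j)"
        using \<open>\<not> i + j \<le> c\<close> by (intro monom_dvd_monom) simp
      ultimately have "tpow c dvd ?d i p * ?d j q" by (rule dvd_trans[rotated])
      then show "tpow c dvd (case x of (i, j) \<Rightarrow> ?d i p * ?d j q)" by (simp add: ij)
    qed
    then show ?thesis
      using sum.subset_diff[OF BA, of "\<lambda>(i, j). ?d i p * ?d j q"]
      by (simp add: cong_iff_dvd_diff dvd_diff_commute)
  qed
  also have "(\<Sum>(i, j)\<in>?A. ?d i p * ?d j q) = field_exp c f p * field_exp c f q"
    unfolding field_exp_eq sum_product by (rule sum.cartesian_product[symmetric])
  finally show ?thesis .
qed

lemma field_exp_add: "field_exp c f (p + q) = field_exp c f p + field_exp c f q"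
proof -
  have "(field_op c f ^^ n) (p + q) = (field_op c f ^^ n) p + (field_op c f ^^ n) q" for n
    by (induction n) (simp_all add: field_op_add)
  then show ?thesis
    by (simp add: field_exp_eq divided_power_def smult_add_right sum.distrib)
qed

lemma field_exp_const: "field_exp c f [:a:] = [:a:]"
proof -
  have "(field_op c f ^^ n) [:a:] = (if n = 0 then [:a:] else 0)" for n
    by (induction n) (auto simp: field_op_def pderiv_pCons)
  then have "field_exp c f [:a:] = (\<Sum>n\<le>c. if n = 0 then [:a:] else 0)"
    unfolding field_exp_eq divided_power_def by (intro sum.cong) auto
  then show ?thesis by simp
qed

definition flow :: "nat \<Rightarrow> (nat \<Rightarrow> rat) \<Rightarrow> rat poly" where
  "flow c f = field_exp c f [:0, 1:]"

text \<open>An algebra homomorphism on polynomials is determined by the image of t, which is the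
  flow; the induction follows Horner's scheme.\<close>

lemma cong_field_exp_pcompose:
  assumes f: "f \<in> field_space 1 c"
  shows "[field_exp c f p = pcompose p (flow c f)] (mod tpow c)"
proof (induction p)
  case 0
  then show ?case using field_exp_const[of c f 0] by simp
next
  case (pCons a p)
  have "pCons a p = [:a:] + [:0, 1:] * p" by simp
  then have "field_exp c f (pCons a p) = [:a:] + field_exp c f ([:0, 1:] * p)"
    by (simp only: field_exp_add field_exp_const)
  also have "[\<dots> = [:a:] + flow c f * field_exp c f p] (mod tpow c)"
    unfolding flow_def by (intro cong_add cong_refl cong_field_exp_mult f)
  also have "[[:a:] + flow c f * field_exp c f p = [:a:] + flow c f * pcompose p (flow c f)] (mod tpow c)"
    by (intro cong_add cong_mult cong_refl pCons.IH)
  finally show ?case by (simp add: pcompose_pCons)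
qed

subsection \<open>Coefficients of the flow\<close>

lemma flow_dvd:
  assumes "f \<in> field_space 1 c" "1 \<le> c"
  shows "monom 1 2 dvd flow c f - [:0, 1:]"
proof -
  have X: "monom 1 1 dvd [:0, 1 :: rat:]" by (simp add: monom_1_dvd_iff')
  have "flow c f - [:0, 1:] = (\<Sum>n\<in>{1..c}. divided_power c f n [:0, 1:])"
    unfolding flow_def field_exp_eq
    by (subst atMost_atLeast0, subst sum.atLeast_Suc_atMost) (simp_all add: divided_power_def)
  also have "monom 1 2 dvd \<dots>"
  proof (rule dvd_sum)
    fix n assume "n \<in> {1..c}"
    then have "monom 1 2 dvd monom (1 :: rat) (min (n + 1) (Suc c))" by (intro monom_dvd_monom) auto
    then show "monom 1 2 dvd divided_power c f n [:0, 1:]"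
      using divided_power_dvd[OF assms(1) X] by (rule dvd_trans)
  qed
  finally show ?thesis .
qed

lemma coeff_flow_0: "f \<in> field_space 1 c \<Longrightarrow> 1 \<le> c \<Longrightarrow> coeff (flow c f) 0 = 0"
  and coeff_flow_1: "f \<in> field_space 1 c \<Longrightarrow> 1 \<le> c \<Longrightarrow> coeff (flow c f) 1 = 1"
  using flow_dvd[of f c] by (auto simp: monom_1_dvd_iff' less_2_cases_iff all_conj_distrib)

text \<open>This is triangularity: the coefficient of t^(i+1) in the flow is f_i plus an expression
  in the f_j with j < i.\<close>

lemma flow_diff_dvd:
  assumes f: "f \<in> field_space 1 c" and g: "g \<in> field_space 1 c" and i: "i < c"
    and eq: "\<And>j. j < i \<Longrightarrow> f j = g j"
  shows "monom 1 (i + 2) dvd flow c f - flow c g - monom (f i - g i) (i + 1)"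
proof -
  let ?X = "[:0, 1 :: rat:]"
  define \<Delta> where "\<Delta> n = (field_op c f ^^ n) ?X - (field_op c g ^^ n) ?X" for n
  let ?\<delta> = "monom (f i - g i) (i + 1)"
  have X: "monom 1 1 dvd ?X" by (simp add: monom_1_dvd_iff')
  have dvd_M: "monom (1 :: rat) (i + 2) dvd tpow c" using i by (intro monom_dvd_monom) simp
  have FG: "monom 1 (i + 1) dvd field_poly c f - field_poly c g"
    "monom 1 (i + 2) dvd field_poly c f - field_poly c g - ?\<delta>"
    using eq i by (auto simp: monom_1_dvd_iff' coeff_field_poly less_Suc_eq)
  have mod_dvd: "monom 1 (i + 2) dvd p mod tpow c - p" for p
    using dvd_M by (metis dvd_trans dvd_minus_mod dvd_diff_commute)
  have \<Delta>1: "monom 1 (i + 2) dvd \<Delta> 1 - ?\<delta>"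
  proof -
    have "\<Delta> 1 - ?\<delta> = ((field_poly c f - field_poly c g) mod tpow c - (field_poly c f - field_poly c g))
        + (field_poly c f - field_poly c g - ?\<delta>)"
      by (simp add: \<Delta>_def field_op_def pderiv_pCons poly_mod_diff_left one_pCons[symmetric])
    then show ?thesis by (simp only: dvd_add[OF mod_dvd FG(2)])
  qed
  \<comment> \<open>From the first iterate on, both summands gain a power: the operator raises the
    order of the difference, and the iterate of t is divisible by t^2, so its derivative supplies a
    factor t. Only the first iterate carries the leading term.\<close>
  have step: "monom 1 (i + 2) dvd \<Delta> (Suc n)" if "monom 1 (i + 1) dvd \<Delta> n" "1 \<le> n" for n
  proof -
    let ?q = "(field_op c g ^^ n) ?X"
    have "\<Delta> (Suc n) = field_op c f (\<Delta> n) + (field_op c f ?q - field_op c g ?q)"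
      using field_op_add[of c f "\<Delta> n" ?q] by (simp add: \<Delta>_def)
    moreover have "monom 1 (i + 2) dvd field_op c f (\<Delta> n)"
      using field_op_raises[OF f, of "i + 1" "\<Delta> n"] that i by (simp add: min_def)
    moreover have "monom 1 (i + 2) dvd field_op c f ?q - field_op c g ?q"
    proof -
      have "monom 1 2 dvd monom (1 :: rat) (min (n + 1) (Suc c))"
        using that i by (intro monom_dvd_monom) auto
      then have "monom 1 2 dvd ?q" using field_op_iterate_dvd[OF g X] by (rule dvd_trans)
      then have "monom 1 1 dvd pderiv ?q" by (intro monom_dvd_pderiv) (simp add: numeral_2_eq_2)
      from mult_dvd_mono[OF FG(1) this]
      have "monom 1 (i + 2) dvd (field_poly c f - field_poly c g) * pderiv ?q" by (simp add: mult_monom)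
      then have "monom 1 (i + 2) dvd ((field_poly c f - field_poly c g) * pderiv ?q) mod tpow c"
        using dvd_M by (rule dvd_mod)
      then show ?thesis by (simp add: field_op_def left_diff_distrib poly_mod_diff_left)
    qed
    ultimately show ?thesis by simp
  qed
  have le: "monom (1 :: rat) (i + 1) dvd monom 1 (i + 2)" by (rule monom_dvd_monom) simp
  have \<Delta>1': "monom 1 (i + 1) dvd \<Delta> 1"
  proof -
    have "monom 1 (i + 1) dvd \<Delta> 1 - ?\<delta>" using le \<Delta>1 by (rule dvd_trans)
    moreover have "monom 1 (i + 1) dvd ?\<delta>" by (simp add: monom_1_dvd_iff')
    ultimately have "monom 1 (i + 1) dvd (\<Delta> 1 - ?\<delta>) + ?\<delta>" by (rule dvd_add)
    then show ?thesis by simp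
  qed
  have \<Delta>: "monom 1 (i + 2) dvd \<Delta> n" if "2 \<le> n" for n
    using that
  proof (induction n rule: dec_induct)
    case base
    then show ?case using step[OF \<Delta>1'] by (simp add: numeral_2_eq_2)
  next
    case (step n)
    then show ?case using \<open>\<And>n. monom 1 (i + 1) dvd \<Delta> n \<Longrightarrow> 1 \<le> n \<Longrightarrow> monom 1 (i + 2) dvd \<Delta> (Suc n)\<close>[of n]
        dvd_trans[OF le] by simp
  qed
  have "flow c f - flow c g - ?\<delta>
      = (\<Sum>n\<le>c. Polynomial.smult (1 / fact n) (\<Delta> n) - (if n = 1 then ?\<delta> else 0))"
    using i by (simp add: flow_def field_exp_eq divided_power_def \<Delta>_def sum_subtractf smult_diff_right)
  also have "monom 1 (i + 2) dvd \<dots>"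
  proof (rule dvd_sum)
    fix n :: nat
    consider "n = 0" | "n = 1" | "2 \<le> n" by linarith
    then show "monom 1 (i + 2) dvd Polynomial.smult (1 / fact n) (\<Delta> n) - (if n = 1 then ?\<delta> else 0)"
    proof cases
      case 1
      then show ?thesis by (simp add: \<Delta>_def)
    next
      case 2
      then show ?thesis using \<Delta>1 by simp
    next
      case 3
      then show ?thesis using dvd_smult[OF \<Delta>[OF 3]] by simp
    qed
  qed
  finally show ?thesis .
qed

lemma
  assumes "f \<in> field_space 1 c" "g \<in> field_space 1 c" "i < c" "\<And>j. j < i \<Longrightarrow> f j = g j"
  shows coeff_flow_eq: "j \<le> i \<Longrightarrow> coeff (flow c f) j = coeff (flow c g) j"
    and coeff_flow_diff: "coeff (flow c f) (Suc i) - coeff (flow c g) (Suc i) = f i - g i"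
proof -
  have *: "coeff (flow c f - flow c g - monom (f i - g i) (i + 1)) j = 0" if "j < i + 2" for j
    using flow_diff_dvd[OF assms] that by (simp add: monom_1_dvd_iff')
  show "j \<le> i \<Longrightarrow> coeff (flow c f) j = coeff (flow c g) j" using *[of j] by simp
  show "coeff (flow c f) (Suc i) - coeff (flow c g) (Suc i) = f i - g i" using *[of "Suc i"] by simp
qed

lemma flow_inj:
  assumes f: "f \<in> field_space 1 c" and g: "g \<in> field_space 1 c"
    and eq: "\<And>j. 2 \<le> j \<Longrightarrow> j \<le> c \<Longrightarrow> coeff (flow c f) j = coeff (flow c g) j"
  shows "f = g"
proof
  show "f i = g i" for i
  proof (induction i rule: less_induct)
    case (less i)
    show ?case
    proof (cases "1 \<le> i \<and> i < c")
      case True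
      then show ?thesis
        using coeff_flow_diff[OF f g _ less, of i] eq[of "Suc i"] by simp
    next
      case False
      then show ?thesis using field_space_eq_0[OF f] field_space_eq_0[OF g] by simp
    qed
  qed
qed

lemma flow_surj: "\<exists>f\<in>field_space 1 c. \<forall>j. 2 \<le> j \<and> j \<le> c \<longrightarrow> coeff (flow c f) j = a j"
proof -
  have "\<exists>f\<in>field_space 1 c. \<forall>j. 2 \<le> j \<and> j \<le> n \<longrightarrow> coeff (flow c f) j = a j" if "n \<le> c" for n
    using that
  proof (induction n)
    case 0
    show ?case using field_space_zero by auto
  next
    case (Suc n)
    then obtain f where f: "f \<in> field_space 1 c" "\<And>j. 2 \<le> j \<Longrightarrow> j \<le> n \<Longrightarrow> coeff (flow c f) j = a j"
      by auto
    show ?case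
    \<comment> \<open>The coefficient of t^1 is not prescribed, and index 0 lies outside
      \<open>field_space 1 c\<close>.\<close>
    proof (cases "n = 0")
      case True
      then show ?thesis using f(1) by auto
    next
      case False
      \<comment> \<open>By triangularity, changing \<open>f n\<close> shifts the coefficient of
        t^(n+1) by the same amount and leaves the lower ones alone.\<close>
      define g where "g = f(n := f n + (a (Suc n) - coeff (flow c f) (Suc n)))"
      have g: "g \<in> field_space 1 c"
        using f(1) False Suc.prems by (auto simp: g_def field_space_def)
      have n: "n < c" using Suc.prems by simp
      have eq: "g j = f j" if "j < n" for j using that by (simp add: g_def)
      have "coeff (flow c g) j = a j" if "2 \<le> j" "j \<le> Suc n" for j
      proof (cases "j = Suc n")
        case True
        have "g n = f n + (a (Suc n) - coeff (flow c f) (Suc n))" by (simp add: g_def)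
        then show ?thesis using coeff_flow_diff[OF g f(1) n eq] True by simp
      next
        case False
        then have "j \<le> n" using that by simp
        then show ?thesis using coeff_flow_eq[OF g f(1) n eq, of j] f(2)[of j] that by simp
      qed
      then show ?thesis using g by blast
    qed
  qed
  then show ?thesis by blast
qed

section \<open>The substitution groups\<close>

lemma cong_pcompose_right:
  "[p = q] (mod tpow c) \<Longrightarrow> [pcompose r p = pcompose r q] (mod tpow c)"
proof (induction r)
  case (pCons a r)
  then show ?case unfolding pcompose_pCons by (intro cong_add cong_mult cong_refl) simp_all
qed simp

lemma pcompose_monom: "pcompose (monom a n) p = Polynomial.smult a (p ^ n)"
proof (induction n)
  case (Suc n)
  then show ?case by (simp add: monom_Suc pcompose_pCons)
qed (simp add: monom_0)

text \<open>Substituting r into t^(c+1) gives r^(c+1), still a multiple of t^(c+1) because r has no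
  constant term.\<close>

lemma cong_pcompose_left:
  assumes "[p = q] (mod tpow c)" "coeff r 0 = 0"
  shows "[pcompose p r = pcompose q r] (mod tpow c)"
proof -
  from assms(1) obtain s where s: "p - q = tpow c * s" by (auto simp: cong_iff_dvd_diff)
  have "monom 1 1 dvd r" using assms(2) by (simp add: monom_1_dvd_iff')
  then have "monom 1 1 ^ Suc c dvd r ^ Suc c" by (rule dvd_power_same)
  then have "tpow c dvd r ^ Suc c" by (simp only: monom_power power_one nat_mult_1)
  moreover have "pcompose p r - pcompose q r = r ^ Suc c * pcompose s r"
    by (simp only: pcompose_diff[symmetric] s pcompose_mult pcompose_monom smult_1_left)
  ultimately show ?thesis by (simp add: cong_iff_dvd_diff del: power_Suc)
qed

section \<open>Residue classes, substitutions and the group\<close>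

definition trunc_class :: "nat \<Rightarrow> rat poly \<Rightarrow> rat poly set" where
  "trunc_class c p = trunc_rel c `` {p}"

lemma trunc_rel_iff: "(p, q) \<in> trunc_rel c \<longleftrightarrow> coeff p 0 = 0 \<and> coeff q 0 = 0 \<and> [p = q] (mod tpow c)"
  by (simp add: trunc_rel_def cong_iff_dvd_diff)

lemma in_trunc_class_iff:
  "q \<in> trunc_class c p \<longleftrightarrow> coeff p 0 = 0 \<and> coeff q 0 = 0 \<and> [p = q] (mod tpow c)"
  by (simp add: trunc_class_def trunc_rel_iff)

lemma trunc_class_eq_iff:
  assumes "coeff p 0 = 0" "coeff q 0 = 0"
  shows "trunc_class c p = trunc_class c q \<longleftrightarrow> [p = q] (mod tpow c)"
proof
  assume "trunc_class c p = trunc_class c q"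
  moreover have "q \<in> trunc_class c q" using assms by (simp add: in_trunc_class_iff)
  ultimately have "q \<in> trunc_class c p" by simp
  then show "[p = q] (mod tpow c)" by (simp add: in_trunc_class_iff)
next
  assume pq: "[p = q] (mod tpow c)"
  show "trunc_class c p = trunc_class c q"
    using assms pq cong_trans cong_sym by (auto simp: in_trunc_class_iff) (blast intro: cong_trans cong_sym)+
qed

lemma trunc_algebra_eq: "trunc_algebra c = trunc_class c ` {p. coeff p 0 = 0}"
  by (auto simp: trunc_algebra_def trunc_class_def quotient_def)

lemma trunc_class_in: "coeff p 0 = 0 \<Longrightarrow> trunc_class c p \<in> trunc_algebra c"
  by (simp add: trunc_algebra_eq)

definition subst_poly :: "nat \<Rightarrow> (nat \<Rightarrow> rat) \<Rightarrow> rat poly" where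
  "subst_poly c a = [:0, 1:] + (\<Sum>i=2..c. monom (a i) i)"

lemma coeff_subst_poly:
  "coeff (subst_poly c a) n = (if n = 1 then 1 else if 2 \<le> n \<and> n \<le> c then a n else 0)"
proof -
  have "coeff (\<Sum>i=2..c. monom (a i) i) n = (\<Sum>i=2..c. if i = n then a i else 0)"
    by (simp add: coeff_sum)
  then show ?thesis
    by (cases n rule: nat.exhaust; cases "n - 1") (auto simp: subst_poly_def)
qed

lemma U_map_trunc_class:
  assumes "coeff p 0 = 0"
  shows "U_map c a (trunc_class c p) = trunc_class c (pcompose (subst_poly c a) p)"
proof -
  have eq: "q + (\<Sum>i=2..c. Polynomial.smult (a i) (q ^ i)) = pcompose (subst_poly c a) q" for q
    by (simp add: subst_poly_def pcompose_add pcompose_sum pcompose_monom pcompose_pCons)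
  \<comment> \<open>All representatives give the same class, so the union in \<open>U_map\<close>
    collapses to it.\<close>
  have const: "trunc_class c (pcompose (subst_poly c a) q) = trunc_class c (pcompose (subst_poly c a) p)"
    if "q \<in> trunc_class c p" for q
  proof (subst trunc_class_eq_iff)
    show "[pcompose (subst_poly c a) q = pcompose (subst_poly c a) p] (mod tpow c)"
      using that by (intro cong_pcompose_right) (simp add: in_trunc_class_iff cong_sym_eq)
  qed (use that in \<open>simp_all add: in_trunc_class_iff coeff_subst_poly pcompose_coeff_0 poly_0_coeff_0\<close>)
  have "p \<in> trunc_class c p" using assms by (simp add: in_trunc_class_iff)
  then have "trunc_class c p \<noteq> {}" by blast
  then have "(\<Union>q\<in>trunc_class c p. trunc_class c (pcompose (subst_poly c a) q))
      = trunc_class c (pcompose (subst_poly c a) p)"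
    using const by (rule SUP_eq_const)
  then show ?thesis
    using trunc_class_in[OF assms] by (simp add: U_map_def eq trunc_class_def)
qed

lemma U_map_eq_iff: "U_map c a = U_map c b \<longleftrightarrow> (\<forall>i. 2 \<le> i \<and> i \<le> c \<longrightarrow> a i = b i)"
proof
  assume "U_map c a = U_map c b"
  \<comment> \<open>The image of the class of t recovers the coefficients.\<close>
  then have "U_map c a (trunc_class c [:0, 1:]) = U_map c b (trunc_class c [:0, 1:])" by simp
  then have "trunc_class c (subst_poly c a) = trunc_class c (subst_poly c b)"
    by (simp add: U_map_trunc_class)
  then have "[subst_poly c a = subst_poly c b] (mod tpow c)"
    by (simp add: trunc_class_eq_iff coeff_subst_poly)
  then show "\<forall>i. 2 \<le> i \<and> i \<le> c \<longrightarrow> a i = b i"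
    by (auto simp: cong_tpow_iff coeff_subst_poly split: if_splits)
next
  assume *: "\<forall>i. 2 \<le> i \<and> i \<le> c \<longrightarrow> a i = b i"
  then have "(\<Sum>i=2..c. Polynomial.smult (a i) (p ^ i)) = (\<Sum>i=2..c. Polynomial.smult (b i) (p ^ i))" for p
    by (intro sum.cong) auto
  then show "U_map c a = U_map c b" by (simp add: U_map_def)
qed

text \<open>\<open>U_map\<close> reads only the coefficients 2 to c; for a field in
  \<open>field_space 1 c\<close> with c >= 1 the flow has constant coefficient 0 and linear
  coefficient 1, as such a substitution must.\<close>

definition flow_map :: "nat \<Rightarrow> (nat \<Rightarrow> rat) \<Rightarrow> rat poly set \<Rightarrow> rat poly set" where
  "flow_map c f = U_map c (coeff (flow c f))"

context
  fixes c :: nat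
  assumes c: "4 \<le> c"
  notes [simp del] = One_nat_def
begin

interpretation F: rational_lie_algebra "field_alg 1 c"
  by (rule rational_lie_algebra_field_alg)

lemma flow_map_trunc_class:
  assumes f: "f \<in> field_space 1 c" and p: "coeff p 0 = 0"
  shows "flow_map c f (trunc_class c p) = trunc_class c (pcompose (flow c f) p)"
proof -
  have "1 \<le> c" using c by simp
  have "[subst_poly c (coeff (flow c f)) = flow c f] (mod tpow c)"
    unfolding cong_tpow_iff
  proof (intro allI impI)
    fix i assume "i \<le> c"
    consider "i = 0" | "i = 1" | "2 \<le> i" by linarith
    then show "coeff (subst_poly c (coeff (flow c f))) i = coeff (flow c f) i"
      by cases (use coeff_flow_0[OF f \<open>1 \<le> c\<close>] coeff_flow_1[OF f \<open>1 \<le> c\<close>] \<open>i \<le> c\<close> in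
        \<open>simp_all add: coeff_subst_poly\<close>)
  qed
  then have "[pcompose (subst_poly c (coeff (flow c f))) p = pcompose (flow c f) p] (mod tpow c)"
    using p by (rule cong_pcompose_left)
  then show ?thesis
    using p coeff_flow_0[OF f \<open>1 \<le> c\<close>]
    by (simp add: flow_map_def U_map_trunc_class trunc_class_eq_iff pcompose_coeff_0 poly_0_coeff_0 coeff_subst_poly)
qed

lemma flow_map_bij: "bij_betw (flow_map c) (field_space 1 c) (carrier (U_group c))"
  unfolding bij_betw_def
proof
  show "inj_on (flow_map c) (field_space 1 c)"
    using flow_inj by (auto simp: inj_on_def flow_map_def U_map_eq_iff)
  show "flow_map c ` field_space 1 c = carrier (U_group c)"
  proof
    show "carrier (U_group c) \<subseteq> flow_map c ` field_space 1 c"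
    proof
      fix u assume "u \<in> carrier (U_group c)"
      then obtain a where a: "u = U_map c a" by (auto simp: U_group_def)
      obtain f where "f \<in> field_space 1 c" "\<forall>j. 2 \<le> j \<and> j \<le> c \<longrightarrow> coeff (flow c f) j = a j"
        using flow_surj by blast
      then show "u \<in> flow_map c ` field_space 1 c"
        unfolding a by (intro image_eqI[of _ _ f]) (auto simp: flow_map_def U_map_eq_iff)
    qed
  qed (auto simp: flow_map_def U_group_def)
qed

lemma flow_map_bch:
  assumes f: "f \<in> field_space 1 c" and g: "g \<in> field_space 1 c"
  shows "flow_map c (F.bch f g) = flow_map c f \<otimes>\<^bsub>U_group c\<^esub> flow_map c g"
proof
  fix X
  have "1 \<le> c" using c by simp
  note b = bch_closed[OF c f g]
  show "flow_map c (F.bch f g) X = (flow_map c f \<otimes>\<^bsub>U_group c\<^esub> flow_map c g) X"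
  proof (cases "X \<in> trunc_algebra c")
    case True
    then obtain p where p: "coeff p 0 = 0" and X: "X = trunc_class c p"
      by (auto simp: trunc_algebra_eq)
    have coeff_0: "coeff (pcompose (flow c h) p) 0 = 0" if "h \<in> field_space 1 c" for h
      using coeff_flow_0[OF that \<open>1 \<le> c\<close>] p by (simp add: pcompose_coeff_0 poly_0_coeff_0)
    \<comment> \<open>Applying the homomorphism of g to the flow of f substitutes the flow of g into
      it, which is the composition of f after g.\<close>
    have "[pcompose (flow c f) (flow c g) = field_exp c g (flow c f)] (mod tpow c)"
      using cong_field_exp_pcompose[OF g] by (rule cong_sym)
    also have "field_exp c g (flow c f) = flow c (F.bch f g)"
      unfolding flow_def by (rule field_exp_bch[OF c f g, symmetric])
    finally have "[pcompose (pcompose (flow c f) (flow c g)) p = pcompose (flow c (F.bch f g)) p] (mod tpow c)"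
      using p by (rule cong_pcompose_left)
    moreover have "coeff (pcompose (pcompose (flow c f) (flow c g)) p) 0 = 0"
      using coeff_flow_0[OF f \<open>1 \<le> c\<close>] coeff_0[OF g] by (simp add: pcompose_assoc[symmetric] pcompose_coeff_0 poly_0_coeff_0)
    ultimately have "trunc_class c (pcompose (flow c (F.bch f g)) p)
        = trunc_class c (pcompose (flow c f) (pcompose (flow c g) p))"
      using coeff_0[OF b] by (simp add: trunc_class_eq_iff pcompose_assoc cong_sym_eq)
    then show ?thesis
      using True by (simp add: U_group_def compose_def X flow_map_trunc_class[OF g p]
          flow_map_trunc_class[OF f coeff_0[OF g]] flow_map_trunc_class[OF b p])
  next
    \<comment> \<open>Outside the algebra both maps are \<open>undefined\<close>.\<close>
    case False
    then show ?thesis by (simp add: U_group_def compose_def flow_map_def U_map_def)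
  qed
qed

lemma flow_map_zero: "flow_map c (\<lambda>i. 0) = \<one>\<^bsub>U_group c\<^esub>"
proof
  fix X
  have flow: "flow c (\<lambda>i. 0) = [:0, 1:]" by (simp only: flow_def field_exp_zero_field[OF c])
  show "flow_map c (\<lambda>i. 0) X = \<one>\<^bsub>U_group c\<^esub> X"
  proof (cases "X \<in> trunc_algebra c")
    case True
    then obtain p where p: "coeff p 0 = 0" and X: "X = trunc_class c p"
      by (auto simp: trunc_algebra_eq)
    then show ?thesis
      using True by (simp add: U_group_def flow_map_trunc_class field_space_zero flow pcompose_pCons)
  next
    case False
    then show ?thesis by (simp add: U_group_def flow_map_def U_map_def)
  qed
qed

lemma group_U_group: "group (U_group c)"
proof (rule groupI)
  note bij = flow_map_bij[unfolded bij_betw_def, THEN conjunct2, symmetric]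
  show "\<one>\<^bsub>U_group c\<^esub> \<in> carrier (U_group c)"
    unfolding bij flow_map_zero[symmetric] using field_space_zero by blast
  fix u v assume u: "u \<in> carrier (U_group c)" and v: "v \<in> carrier (U_group c)"
  obtain f g where f: "f \<in> field_space 1 c" "u = flow_map c f" and g: "g \<in> field_space 1 c" "v = flow_map c g"
    using u v unfolding bij by blast
  show "u \<otimes>\<^bsub>U_group c\<^esub> v \<in> carrier (U_group c)"
    unfolding bij f(2) g(2) flow_map_bch[OF f(1) g(1), symmetric] using bch_closed[OF c f(1) g(1)] by blast
next
  fix u assume u: "u \<in> carrier (U_group c)"
  then obtain f where f: "f \<in> field_space 1 c" "u = flow_map c f"
    using flow_map_bij by (auto simp: bij_betw_def)
  have "flow_map c (F.bch (\<lambda>i. 0) f) = flow_map c f"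
    using F.bch_collinear[OF nilpotent_field_alg[OF c], of f 0 1] f by simp
  then show "\<one>\<^bsub>U_group c\<^esub> \<otimes>\<^bsub>U_group c\<^esub> u = u"
    by (simp add: flow_map_zero[symmetric] f flow_map_bch[symmetric] field_space_zero)
  have "flow_map c (\<lambda>i. - f i) \<otimes>\<^bsub>U_group c\<^esub> u = \<one>\<^bsub>U_group c\<^esub>"
    by (simp add: f flow_map_bch[symmetric] field_space_minus bch_minus_self c flow_map_zero)
  moreover have "flow_map c (\<lambda>i. - f i) \<in> carrier (U_group c)"
    by (simp add: flow_map_def U_group_def)
  ultimately show "\<exists>v\<in>carrier (U_group c). v \<otimes>\<^bsub>U_group c\<^esub> u = \<one>\<^bsub>U_group c\<^esub>" by blast
next
  fix u v w
  assume "u \<in> carrier (U_group c)" "v \<in> carrier (U_group c)" "w \<in> carrier (U_group c)"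
  then have "w \<in> trunc_algebra c \<rightarrow> trunc_algebra c"
    by (auto simp: U_group_def trunc_algebra_eq U_map_trunc_class coeff_subst_poly pcompose_coeff_0 poly_0_coeff_0)
  then show "u \<otimes>\<^bsub>U_group c\<^esub> v \<otimes>\<^bsub>U_group c\<^esub> w = u \<otimes>\<^bsub>U_group c\<^esub> (v \<otimes>\<^bsub>U_group c\<^esub> w)"
    by (auto simp: U_group_def compose_def restrict_def fun_eq_iff Pi_iff)
qed

end

section \<open>Existence and uniqueness\<close>

text \<open>Group powers are scalar multiples by \<open>bch_collinear\<close>. Hence the root
  condition holds automatically once the products agree, and roots are unique.\<close>

lemma malcev_pow:
  assumes D: "group D" and L: "rational_lie_algebra L" "lie_algebra.nilpotent class_ring L"
    and carrier: "carrier L = carrier D" and zero: "\<zero>\<^bsub>L\<^esub> = \<one>\<^bsub>D\<^esub>"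
    and mult: "\<And>x y. x \<in> carrier D \<Longrightarrow> y \<in> carrier D \<Longrightarrow> rational_lie_algebra.bch L x y = x \<otimes>\<^bsub>D\<^esub> y"
    and x: "x \<in> carrier D"
  shows "x [^]\<^bsub>D\<^esub> (n :: nat) = of_nat n \<odot>\<^bsub>L\<^esub> x" and "x [^]\<^bsub>D\<^esub> (m :: int) = of_int m \<odot>\<^bsub>L\<^esub> x"
proof -
  interpret D: group D by (rule D)
  interpret L: rational_lie_algebra L by (rule L(1))
  note smult = L.smult_rat_closed[unfolded carrier]
  have nat: "x [^]\<^bsub>D\<^esub> (n :: nat) = of_nat n \<odot>\<^bsub>L\<^esub> x" for n
  proof (induction n)
    case 0
    then show ?case using x by (simp add: L.smult_rat_zero carrier zero)
  next
    case (Suc n)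
    have "x [^]\<^bsub>D\<^esub> Suc n = L.bch (of_nat n \<odot>\<^bsub>L\<^esub> x) (1 \<odot>\<^bsub>L\<^esub> x)"
      using x Suc by (simp add: L.smult_rat_one carrier mult smult)
    also have "\<dots> = of_nat (Suc n) \<odot>\<^bsub>L\<^esub> x"
      using L.bch_collinear[OF L(2), of x "of_nat n" 1] x by (simp add: carrier add.commute)
    finally show ?case .
  qed
  then show "x [^]\<^bsub>D\<^esub> (n :: nat) = of_nat n \<odot>\<^bsub>L\<^esub> x" .
  show "x [^]\<^bsub>D\<^esub> (m :: int) = of_int m \<odot>\<^bsub>L\<^esub> x"
  proof (cases "0 \<le> m")
    case True
    then show ?thesis by (simp add: int_pow_def2 nat)
  next
    case False
    have "(of_int m \<odot>\<^bsub>L\<^esub> x) \<otimes>\<^bsub>D\<^esub> (of_nat (nat (- m)) \<odot>\<^bsub>L\<^esub> x) = \<one>\<^bsub>D\<^esub>"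
      using L.bch_collinear[OF L(2), of x "of_int m" "of_nat (nat (- m))"] x False
      by (simp add: mult smult carrier zero[symmetric] L.smult_rat_zero)
    then have "inv\<^bsub>D\<^esub> (of_nat (nat (- m)) \<odot>\<^bsub>L\<^esub> x) = of_int m \<odot>\<^bsub>L\<^esub> x"
      by (rule D.inv_equality) (simp_all add: smult x)
    then show ?thesis using False by (simp add: int_pow_def2 nat)
  qed
qed

lemma malcev_transport:
  assumes "rational_lie_algebra L" "lie_algebra.nilpotent class_ring L" "group D"
    and bij: "bij_betw h (carrier L) (carrier D)"
    and zero: "h \<zero>\<^bsub>L\<^esub> = \<one>\<^bsub>D\<^esub>"
    and mult: "\<And>x y. x \<in> carrier L \<Longrightarrow> y \<in> carrier L \<Longrightarrow>
      h (rational_lie_algebra.bch L x y) = h x \<otimes>\<^bsub>D\<^esub> h y"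
  shows "is_malcev_lie_algebra D (transport_lie_alg L h)"
    and "rational_lie_isomorphism L (transport_lie_alg L h) h"
proof -
  interpret L: rational_lie_algebra L by (rule assms)
  let ?L = "transport_lie_alg L h"
  have "lie_isomorphism class_ring L ?L h"
    using bij by (intro L.transport_lie_alg) (simp add: bij_betw_def)
  then show iso: "rational_lie_isomorphism L ?L h" by (simp add: rational_lie_isomorphism_def)
  interpret I: rational_lie_isomorphism L ?L h by (rule iso)
  interpret D: group D by (rule assms)
  have carrier: "carrier ?L = carrier D"
    using I.image_carrier bij by (simp add: bij_betw_def)
  have zero': "\<zero>\<^bsub>?L\<^esub> = \<one>\<^bsub>D\<^esub>" using I.hom_zero zero by simp
  have nil: "I.L2.nilpotent" using I.nilpotent_iff assms(2) by simp
  have bch: "I.R2.bch x y = x \<otimes>\<^bsub>D\<^esub> y" if xy: "x \<in> carrier D" "y \<in> carrier D" for x y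
  proof -
    have img: "carrier D = h ` carrier L" using bij by (simp add: bij_betw_def)
    obtain f g where fg: "f \<in> carrier L" "x = h f" "g \<in> carrier L" "y = h g"
      using xy unfolding img by auto
    show ?thesis
      unfolding fg(2,4) mult[OF fg(1,3), symmetric] by (rule I.hom_bch[OF fg(1,3), symmetric])
  qed
  have pow: "((of_int m / of_nat n) \<odot>\<^bsub>?L\<^esub> a) [^]\<^bsub>D\<^esub> n = a [^]\<^bsub>D\<^esub> m"
    if "a \<in> carrier D" "0 < n" for a and m :: int and n :: nat
  proof -
    note pow = malcev_pow[OF assms(3) I.R2.rational_lie_algebra_axioms nil carrier zero' bch]
    have "(of_int m / of_nat n) \<odot>\<^bsub>?L\<^esub> a \<in> carrier D"
      using I.R2.smult_rat_closed[of a] that carrier by simp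
    then show ?thesis
      using that carrier by (simp add: pow I.R2.smult_rat_mult[symmetric])
  qed
  show "is_malcev_lie_algebra D ?L"
    unfolding is_malcev_lie_algebra_def
    using assms(3) I.R2.rational_lie_algebra_axioms nil carrier zero' bch pow by blast
qed

text \<open>Scalar multiplication is determined first, by unique roots, because the comparison of
  curves presupposes common scalars.\<close>

lemma malcev_unique:
  assumes L1: "is_malcev_lie_algebra D L1" and L2: "is_malcev_lie_algebra D L2"
  shows "lie_isomorphism (class_ring :: rat ring) L1 L2 id"
proof -
  note M1 = L1[unfolded is_malcev_lie_algebra_def] and M2 = L2[unfolded is_malcev_lie_algebra_def]
  interpret D: group D using M1 by blast
  interpret L1: rational_lie_algebra L1 using M1 by blast
  interpret L2: rational_lie_algebra L2 using M2 by blast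
  have carrier: "carrier L1 = carrier D" "carrier L2 = carrier D" using M1 M2 by blast+
  have zero: "\<zero>\<^bsub>L1\<^esub> = \<one>\<^bsub>D\<^esub>" "\<zero>\<^bsub>L2\<^esub> = \<one>\<^bsub>D\<^esub>" using M1 M2 by blast+
  have nil: "L1.nilpotent" "L2.nilpotent" using M1 M2 by blast+
  have bch1: "L1.bch x y = x \<otimes>\<^bsub>D\<^esub> y" and bch2: "L2.bch x y = x \<otimes>\<^bsub>D\<^esub> y"
    if "x \<in> carrier D" "y \<in> carrier D" for x y
    using M1 M2 that by blast+
  have roots1: "((of_int m / of_nat n) \<odot>\<^bsub>L1\<^esub> a) [^]\<^bsub>D\<^esub> n = a [^]\<^bsub>D\<^esub> m"
    and roots2: "((of_int m / of_nat n) \<odot>\<^bsub>L2\<^esub> a) [^]\<^bsub>D\<^esub> n = a [^]\<^bsub>D\<^esub> m"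
    if "a \<in> carrier D" "0 < n" for a and m :: int and n :: nat
    using M1 M2 that by blast+
  have closed: "q \<odot>\<^bsub>L1\<^esub> a \<in> carrier D" "q \<odot>\<^bsub>L2\<^esub> a \<in> carrier D" if "a \<in> carrier D" for q a
    using that L1.smult_rat_closed L2.smult_rat_closed carrier by auto
  note pow = malcev_pow(1)[OF D.group_axioms L1.rational_lie_algebra_axioms nil(1) carrier(1) zero(1) bch1]
  have smult: "q \<odot>\<^bsub>L2\<^esub> a = q \<odot>\<^bsub>L1\<^esub> a" if a: "a \<in> carrier D" for q a
  proof -
    obtain m n where mn: "quotient_of q = (m, n)" by (cases "quotient_of q")
    have "0 < n" using mn by (rule quotient_of_denom_pos)
    have q: "q = of_int m / of_nat (nat n)"
      using quotient_of_div[OF mn] \<open>0 < n\<close> by simp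
    \<comment> \<open>Both elements are n-th roots of the same group power of a; n-th powers are
      multiples by n in \<open>L1\<close>, which can be cancelled.\<close>
    have "(q \<odot>\<^bsub>L2\<^esub> a) [^]\<^bsub>D\<^esub> (nat n) = (q \<odot>\<^bsub>L1\<^esub> a) [^]\<^bsub>D\<^esub> (nat n)"
      unfolding q using a \<open>0 < n\<close> by (simp only: roots1 roots2 zero_less_nat_eq)
    then have "of_nat (nat n) \<odot>\<^bsub>L1\<^esub> (q \<odot>\<^bsub>L2\<^esub> a) = of_nat (nat n) \<odot>\<^bsub>L1\<^esub> (q \<odot>\<^bsub>L1\<^esub> a)"
      using closed[OF a] by (simp only: pow)
    then show ?thesis
      using \<open>0 < n\<close> closed[OF a] carrier
      by (intro L1.smult_rat_cancel[of "of_nat (nat n)" "q \<odot>\<^bsub>L2\<^esub> a"]) simp_all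
  qed
  have cancel: "x \<otimes>\<^bsub>D\<^esub> (((- 1) \<odot>\<^bsub>L1\<^esub> x) \<otimes>\<^bsub>D\<^esub> y) = y" if "x \<in> carrier D" "y \<in> carrier D" for x y
  proof -
    have "L1.bch (1 \<odot>\<^bsub>L1\<^esub> x) ((- 1) \<odot>\<^bsub>L1\<^esub> x) = 0 \<odot>\<^bsub>L1\<^esub> x"
      using L1.bch_collinear[OF nil(1), of x 1 "- 1"] that carrier by simp
    then have "x \<otimes>\<^bsub>D\<^esub> ((- 1) \<odot>\<^bsub>L1\<^esub> x) = \<one>\<^bsub>D\<^esub>"
      using that closed carrier by (simp add: L1.smult_rat_one L1.smult_rat_zero bch1 zero)
    then show ?thesis using that closed by (simp add: D.m_assoc[symmetric])
  qed
  interpret common_bch_group L1 L2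
    by unfold_locales
      (use nil carrier bch1 bch2 smult closed cancel in simp_all)
  show ?thesis by (rule lie_isomorphism_id)
qed

theorem proposition3p14:
  shows "(\<forall>k::nat. k \<ge> 2 \<longrightarrow>
            (\<exists>L. is_malcev_lie_algebra (U_group (2 ^ k)) L) \<and>
            (\<forall>L. is_malcev_lie_algebra (U_group (2 ^ k)) L \<longrightarrow>
               lie_algebra (class_ring :: rat ring) L \<and>
               lie_algebra.filiform class_ring L \<and>
               vectorspace.dim class_ring L = 2 ^ k - 1 \<and>
               lie_algebra.solvable class_ring L \<and>
               lie_algebra.derived_length class_ring L = k)) \<and>
         (\<forall>k::nat. k \<ge> 2 \<longrightarrow>
            (\<exists>M :: (rat, nat \<Rightarrow> rat) lie_alg.
               lie_algebra (class_ring :: rat ring) M \<and>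
               vectorspace.fin_dim class_ring M \<and>
               vectorspace.dim class_ring M = 2 ^ k \<and>
               lie_algebra.solvable class_ring M \<and>
               lie_algebra.derived_length class_ring M = k + 1))"
proof (intro conjI allI impI)
  fix k :: nat assume k: "2 \<le> k"
  let ?c = "2 ^ k :: nat"
  let ?F = "field_alg 1 ?c" and ?L = "transport_lie_alg (field_alg 1 ?c) (flow_map ?c)"
  have c: "4 \<le> ?c" using power_increasing[OF k, of "2 :: nat"] by simp
  have F: "rational_lie_algebra ?F"
    by (rule rational_lie_algebra_field_alg)
  have "bij_betw (flow_map ?c) (carrier ?F) (carrier (U_group ?c))"
    using flow_map_bij[OF c] by simp
  moreover have "flow_map ?c \<zero>\<^bsub>?F\<^esub> = \<one>\<^bsub>U_group ?c\<^esub>"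
    using flow_map_zero[OF c] by simp
  moreover have "flow_map ?c (rational_lie_algebra.bch ?F f g) = flow_map ?c f \<otimes>\<^bsub>U_group ?c\<^esub> flow_map ?c g"
    if "f \<in> carrier ?F" "g \<in> carrier ?F" for f g
    using flow_map_bch[OF c] that by simp
  ultimately have malcev: "is_malcev_lie_algebra (U_group ?c) ?L"
    and iso: "rational_lie_isomorphism ?F ?L (flow_map ?c)"
    using malcev_transport[OF F nilpotent_field_alg[OF c] group_U_group[OF c]] by blast+
  from malcev show "\<exists>L. is_malcev_lie_algebra (U_group ?c) L" by blast
  interpret I: rational_lie_isomorphism ?F ?L "flow_map ?c" by (rule iso)
  fix L assume L: "is_malcev_lie_algebra (U_group ?c) L"
  \<comment> \<open>An arbitrary Malcev Lie algebra of the group is linked to the model through the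
    transported copy.\<close>
  interpret J: lie_isomorphism "class_ring :: rat ring" ?L L id
    by (rule malcev_unique[OF malcev L])
  show "lie_algebra (class_ring :: rat ring) L" by (rule J.L2.lie_algebra_axioms)
  show "J.L2.filiform"
    using filiform_field_alg[OF c] by (simp only: J.filiform_iff I.filiform_iff)
  show "J.L2.dim = 2 ^ k - 1"
    using dim_field_alg[of 1 ?c] by (simp add: J.dim_eq I.dim_eq del: One_nat_def)
  \<comment> \<open>The last basis vector e_(2^k - 1) alone spans term k - 1 of the derived series,
    so exactly k steps are needed.\<close>
  have "I.L1.solvable \<and> I.L1.derived_length = k"
  proof (rule solvable_field_alg)
    show "2 ^ m * (1 + 1) - 1 < ?c" if "m < k" for m
    proof -
      have "(2 :: nat) ^ Suc m \<le> 2 ^ k" using that by (intro power_increasing) auto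
      moreover have "(0 :: nat) < 2 ^ m" by simp
      moreover have "(2 :: nat) ^ m * (1 + 1) = 2 * 2 ^ m" by simp
      ultimately show ?thesis unfolding power_Suc by linarith
    qed
  qed simp
  then show "J.L2.solvable" "J.L2.derived_length = k"
    by (simp_all only: J.solvable_iff I.solvable_iff J.derived_length_eq I.derived_length_eq)
next
  fix k :: nat assume k: "2 \<le> k"
  \<comment> \<open>With e_0 included the n-th derived algebra starts at index 2^n - 1, one step
    behind the series without e_0.\<close>
  let ?M = "field_alg 0 (2 ^ k)"
  interpret M: lie_algebra "class_ring :: rat ring" ?M by (rule lie_algebra_field_alg)
  have "M.solvable \<and> M.derived_length = k + 1"
  proof (rule solvable_field_alg)
    show "(2 :: nat) ^ m * (0 + 1) - 1 < 2 ^ k" if "m < k + 1" for m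
    proof -
      have "(2 :: nat) ^ m \<le> 2 ^ k" using that by (intro power_increasing) auto
      moreover have "(0 :: nat) < 2 ^ m" by simp
      moreover have "(2 :: nat) ^ m * (0 + 1) = 2 ^ m" by simp
      ultimately show ?thesis by linarith
    qed
  qed simp
  then show "\<exists>M :: (rat, nat \<Rightarrow> rat) lie_alg.
               lie_algebra (class_ring :: rat ring) M \<and>
               vectorspace.fin_dim class_ring M \<and>
               vectorspace.dim class_ring M = 2 ^ k \<and>
               lie_algebra.solvable class_ring M \<and>
               lie_algebra.derived_length class_ring M = k + 1"
    using dim_field_alg[of 0 "2 ^ k"] M.lie_algebra_axioms by (intro exI[of _ ?M]) simp
qed

end
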